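(* Let $\mathcal{H}$ be a complex Hilbert space and let $T\in\mathcal{B}(\mathcal{H})$ be such that there exists an invertible operator $A_0\in\mathcal{B}(\mathcal{H})$ with $A_0\ge T^*T$, $A_0\ge T^*A_0T$ and $\mathcal{R}[(A_0-T^*T)^{1/2}]=\mathcal{R}[(A_0-T^*A_0T)^{1/2}]$ (equivalently, $T$ has a left invertible quasi-isometric lifting $S'$ on some space $\mathcal{K}'\supset\mathcal{H}$ with $S'^*S'\mathcal{H}\subset\mathcal{H}$). Then $T$ has a left invertible quasi-isometric lifting $S$ on a space $\mathcal{K}\supset\mathcal{H}$ such that $S^*S\mathcal{H}\subset\mathcal{H}$ and $$\mathcal{R}(S)=\mathcal{R}(W)\oplus\overline{S\mathcal{H}},$$ where $W=S|_{\mathcal{K}\ominus\mathcal{H}}$ satisfies the range condition $W^*W\mathcal{R}(W)\subset\mathcal{R}(W)$. Moreover, this $S$ satisfies the range condition $S^*S\mathcal{R}(S)\subset\mathcal{R}(S)$ if and only if $\mathcal{R}(T)\subset\mathcal{N}(A-I)$, where $A=S^*S|_{\mathcal{H}}$. In this case, $T$ is a quasicontraction and $W$ is an isometry.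
   Context: $\mathcal{B}(\mathcal{H})$ is the algebra of bounded operators on $\mathcal{H}$; $\mathcal{R}(X)$, $\mathcal{N}(X)$ are the range and kernel of $X$; $B\ge C$ means $B-C$ is positive. When $\mathcal{K}\supset\mathcal{H}$ is a Hilbert space containing $\mathcal{H}$ as a closed subspace and $P_{\mathcal{K},\mathcal{H}}:\mathcal{K}\to\mathcal{H}$ is the orthogonal projection, $S\in\mathcal{B}(\mathcal{K})$ is a lifting for $T\in\mathcal{B}(\mathcal{H})$ if $P_{\mathcal{K},\mathcal{H}}S=TP_{\mathcal{K},\mathcal{H}}$; then $\mathcal{K}\ominus\mathcal{H}$ is invariant for $S$, and $W=S|_{\mathcal{K}\ominus\mathcal{H}}$ is regarded as an operator on $\mathcal{K}\ominus\mathcal{H}$. $S$ is a quasi-isometry (quasi-isometric) if $S^{*2}S^2=S^*S$, and $T$ is a quasicontraction if $T^{*2}T^2\le T^*T$. $S$ is left invertible if $S^*S$ is invertible. An isometry is an operator $V$ with $V^*V=I$. *)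

theory Defs
  imports "HOL-Analysis.Analysis" "HOL-Algebra.Module" "HOL-Algebra.AbelCoset"
begin

section \<open>Complex Hilbert spaces\<close>

text \<open>
  The lifting space is existentially quantified, so Hilbert spaces are records with a carrier (over
  the modules of HOL-Algebra) rather than types of a class. The ring multiplication and unit that a
  module record inherits play no role for vector spaces.
\<close>

definition complex_ring :: "complex ring" where
  "complex_ring = \<lparr>carrier = UNIV, monoid.mult = (*), one = 1, zero = 0, add = (+)\<rparr>"

record 'a cspace = "(complex, 'a) module" +
  cinner :: "'a \<Rightarrow> 'a \<Rightarrow> complex"

definition hnorm :: "('a, 'm) cspace_scheme \<Rightarrow> 'a \<Rightarrow> real" where
  "hnorm H x = sqrt (Re (cinner H x x))"

text \<open>
  \<open>Metric_space\<close> requires a distance that is nonnegative and symmetric on the whole type,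
  hence the value 0 outside the carrier.
\<close>

definition hdist :: "('a, 'm) cspace_scheme \<Rightarrow> 'a \<Rightarrow> 'a \<Rightarrow> real" where
  "hdist H x y = (if x \<in> carrier H \<and> y \<in> carrier H then hnorm H (x \<ominus>\<^bsub>H\<^esub> y) else 0)"

locale complex_inner_space = Module.module complex_ring H
  for H :: "('a, 'm) cspace_scheme" (structure) +
  assumes cinner_add: "\<lbrakk>x \<in> carrier H; y \<in> carrier H; z \<in> carrier H\<rbrakk>
      \<Longrightarrow> cinner H (x \<oplus> y) z = cinner H x z + cinner H y z"
    and cinner_smult: "\<lbrakk>x \<in> carrier H; y \<in> carrier H\<rbrakk>
      \<Longrightarrow> cinner H (c \<odot>\<^bsub>H\<^esub> x) y = c * cinner H x y"
    and cinner_cnj: "\<lbrakk>x \<in> carrier H; y \<in> carrier H\<rbrakk> \<Longrightarrow> cinner H y x = cnj (cinner H x y)"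
    and cinner_pos: "\<lbrakk>x \<in> carrier H; x \<noteq> \<zero>\<rbrakk> \<Longrightarrow> 0 < Re (cinner H x x)"

context complex_inner_space begin

lemma carrier_complex_ring [simp]: "carrier complex_ring = UNIV"
  by (simp add: complex_ring_def)

lemma cinner_zero_left: "y \<in> carrier H \<Longrightarrow> cinner H \<zero>\<^bsub>H\<^esub> y = 0"
  using cinner_add[of "\<zero>" "\<zero>" y] by simp

lemma a_inv_eq_smult: "y \<in> carrier H \<Longrightarrow> \<ominus>\<^bsub>H\<^esub> y = (-1) \<odot>\<^bsub>H\<^esub> y"
proof -
  assume y: "y \<in> carrier H"
  have "((-1) + 1) \<odot>\<^bsub>H\<^esub> y = (-1) \<odot>\<^bsub>H\<^esub> y \<oplus> 1 \<odot>\<^bsub>H\<^esub> y"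
    using smult_l_distr[of "-1" 1 y] y by (simp add: complex_ring_def)
  moreover have "0 \<odot>\<^bsub>H\<^esub> y = \<zero>\<^bsub>H\<^esub>" using smult_l_null[OF y] by (simp add: complex_ring_def)
  moreover have "1 \<odot>\<^bsub>H\<^esub> y = y" using smult_one[OF y] by (simp add: complex_ring_def)
  ultimately have "(-1) \<odot>\<^bsub>H\<^esub> y \<oplus> y = \<zero>\<^bsub>H\<^esub>" by simp
  thus ?thesis using y minus_equality smult_closed[of "-1" y] by (metis UNIV_I carrier_complex_ring)
qed

lemma smult_carrier: "y \<in> carrier H \<Longrightarrow> c \<odot>\<^bsub>H\<^esub> y \<in> carrier H" by (simp)

lemma cinner_self_nonneg: "x \<in> carrier H \<Longrightarrow> 0 \<le> Re (cinner H x x)"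
  using cinner_pos[of x] cinner_zero_left[of x] by (cases "x = \<zero>\<^bsub>H\<^esub>") auto

lemma cinner_add_right: "\<lbrakk>x \<in> carrier H; y \<in> carrier H; z \<in> carrier H\<rbrakk>
      \<Longrightarrow> cinner H z (x \<oplus> y) = cinner H z x + cinner H z y"
  by (metis add.m_closed cinner_add cinner_cnj complex_cnj_add)

lemma cinner_smult_right: "\<lbrakk>x \<in> carrier H; z \<in> carrier H\<rbrakk>
      \<Longrightarrow> cinner H z (c \<odot>\<^bsub>H\<^esub> x) = cnj c * cinner H z x"
  by (metis smult_carrier cinner_smult cinner_cnj complex_cnj_mult)

lemma Re_cinner_expand: "\<lbrakk>x \<in> carrier H; y \<in> carrier H\<rbrakk> \<Longrightarrow>
   Re (cinner H (x \<oplus> complex_of_real t \<odot>\<^bsub>H\<^esub> y) (x \<oplus> of_real t \<odot>\<^bsub>H\<^esub> y))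
   = Re (cinner H x x) + 2 * t * Re (cinner H x y) + t^2 * Re (cinner H y y)"
  using cinner_cnj[of x y]
  by (simp add: cinner_add_right cinner_smult_right cinner_add cinner_smult smult_carrier algebra_simps power2_eq_square)

lemma Re_cinner_squared_le:
  assumes "x \<in> carrier H" "y \<in> carrier H"
  shows "(Re (cinner H x y))^2 \<le> Re (cinner H x x) * Re (cinner H y y)"
proof (cases "y = \<zero>\<^bsub>H\<^esub>")
  case True
  have "cinner H x y = 0" using assms True cinner_zero_left[of x] cinner_cnj[of y x] by simp
  thus ?thesis using cinner_self_nonneg[OF assms(1)] cinner_self_nonneg[OF assms(2)] by simp
next
  case False
  define a where "a = Re (cinner H x x)"
  define b where "b = Re (cinner H x y)"
  define d where "d = Re (cinner H y y)"
  have d: "d > 0" using cinner_pos[OF assms(2) False] d_def by simp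
  have "0 \<le> a + 2 * (-b/d) * b + (-b/d)^2 * d"
    using cinner_self_nonneg[of "x \<oplus> complex_of_real (-b/d) \<odot>\<^bsub>H\<^esub> y"] Re_cinner_expand[OF assms, of "-b/d"] assms
    unfolding a_def b_def d_def by (simp add: smult_carrier)
  also have "\<dots> = a - b^2/d" using d by (simp add: field_simps power2_eq_square)
  finally show ?thesis using d unfolding a_def[symmetric] b_def[symmetric] d_def[symmetric] by (simp add: field_simps)
qed

lemma hnorm_triangle:
  assumes "x \<in> carrier H" "y \<in> carrier H"
  shows "hnorm H (x \<oplus> y) \<le> hnorm H x + hnorm H y"
proof -
  have 1: "Re (cinner H (x \<oplus> y) (x \<oplus> y)) = Re (cinner H x x) + 2 * Re (cinner H x y) + Re (cinner H y y)"
    using assms cinner_cnj[of x y] by (simp add: cinner_add_right cinner_add)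
  have "Re (cinner H x y) \<le> sqrt (Re (cinner H x x)) * sqrt (Re (cinner H y y))"
    using Re_cinner_squared_le[OF assms] by (simp add: real_le_rsqrt real_sqrt_mult[symmetric])
  hence "Re (cinner H (x \<oplus> y) (x \<oplus> y)) \<le> (sqrt (Re (cinner H x x)) + sqrt (Re (cinner H y y)))^2"
    unfolding 1 power2_sum using cinner_self_nonneg[OF assms(1)] cinner_self_nonneg[OF assms(2)] by simp
  thus ?thesis unfolding hnorm_def using cinner_self_nonneg assms by (simp add: real_le_lsqrt)
qed

lemma hnorm_minus_commute: assumes "x \<in> carrier H" "y \<in> carrier H"
  shows "hnorm H (x \<ominus> y) = hnorm H (y \<ominus> x)"
proof -
  have "x \<ominus> y = (-1) \<odot>\<^bsub>H\<^esub> (y \<ominus> x)"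
    using assms a_inv_eq_smult[of "y \<ominus> x"] by (simp add: a_minus_def minus_add a_comm)
  thus ?thesis using assms unfolding hnorm_def by (simp add: cinner_smult_right cinner_smult)
qed

lemma Metric_space_hdist: "Metric_space (carrier H) (hdist H)"
proof
  fix x y show "0 \<le> hdist H x y" by (simp add: hdist_def hnorm_def cinner_self_nonneg)
  show "hdist H x y = hdist H y x" by (simp add: hdist_def hnorm_minus_commute)
next
  fix x y assume xy: "x \<in> carrier H" "y \<in> carrier H"
  have "hnorm H (x \<ominus> y) = 0 \<longleftrightarrow> x \<ominus> y = \<zero>\<^bsub>H\<^esub>"
    using cinner_pos[of "x \<ominus> y"] cinner_zero_left[of "\<zero>\<^bsub>H\<^esub>"] xy unfolding hnorm_def by force
  moreover have "x \<ominus> y = \<zero>\<^bsub>H\<^esub> \<longleftrightarrow> x = y"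
    using xy by (metis a_minus_def a_inv_closed minus_minus minus_equality r_neg)
  ultimately show "hdist H x y = 0 \<longleftrightarrow> x = y" using xy by (simp add: hdist_def)
next
  fix x y z assume "x \<in> carrier H" "y \<in> carrier H" "z \<in> carrier H"
  moreover from this have "x \<ominus> z = (x \<ominus> y) \<oplus> (y \<ominus> z)"
    by (simp add: a_minus_def a_assoc[symmetric]) (simp add: a_assoc l_neg)
  ultimately show "hdist H x z \<le> hdist H x y + hdist H y z"
    using hnorm_triangle[of "x \<ominus> y" "y \<ominus> z"] by (simp add: hdist_def)
qed

end

locale hilbert_space = complex_inner_space +
  assumes complete: "Metric_space.mcomplete (carrier H) (hdist H)"

definition hclosure :: "('a, 'm) cspace_scheme \<Rightarrow> 'a set \<Rightarrow> 'a set" where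
  "hclosure H X = Metric_space.mtopology (carrier H) (hdist H) closure_of X"


section \<open>Bounded operators\<close>

text \<open>
  Operators are extensional functions (\<open>undefined\<close> outside the carrier), so that two
  operators are equal as functions iff they agree on the carrier.
\<close>

definition bounded_ops :: "('a, 'm) cspace_scheme \<Rightarrow> ('b, 'n) cspace_scheme \<Rightarrow> ('a \<Rightarrow> 'b) set" where
  "bounded_ops H K = {T \<in> carrier H \<rightarrow>\<^sub>E carrier K.
     (\<forall>x\<in>carrier H. \<forall>y\<in>carrier H. T (x \<oplus>\<^bsub>H\<^esub> y) = T x \<oplus>\<^bsub>K\<^esub> T y) \<and>
     (\<forall>c. \<forall>x\<in>carrier H. T (c \<odot>\<^bsub>H\<^esub> x) = c \<odot>\<^bsub>K\<^esub> T x) \<and>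
     (\<exists>C. \<forall>x\<in>carrier H. hnorm K (T x) \<le> C * hnorm H x)}"

abbreviation id_op :: "('a, 'm) cspace_scheme \<Rightarrow> 'a \<Rightarrow> 'a" where
  "id_op H \<equiv> (\<lambda>x\<in>carrier H. x)"

abbreviation op_comp :: "('a, 'm) cspace_scheme \<Rightarrow> ('a \<Rightarrow> 'a) \<Rightarrow> ('a \<Rightarrow> 'a) \<Rightarrow> 'a \<Rightarrow> 'a" where
  "op_comp H A B \<equiv> compose (carrier H) A B"

definition op_diff :: "('a, 'm) cspace_scheme \<Rightarrow> ('a \<Rightarrow> 'a) \<Rightarrow> ('a \<Rightarrow> 'a) \<Rightarrow> 'a \<Rightarrow> 'a" where
  "op_diff H A B = (\<lambda>x\<in>carrier H. A x \<ominus>\<^bsub>H\<^esub> B x)"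

definition adj :: "('a, 'm) cspace_scheme \<Rightarrow> ('a \<Rightarrow> 'a) \<Rightarrow> 'a \<Rightarrow> 'a" where
  "adj H T = (THE R. R \<in> bounded_ops H H \<and>
     (\<forall>x\<in>carrier H. \<forall>y\<in>carrier H. cinner H (T x) y = cinner H x (R y)))"

text \<open>The operator \<open>T\<^sup>* T\<close>.\<close>

definition gram :: "('a, 'm) cspace_scheme \<Rightarrow> ('a \<Rightarrow> 'a) \<Rightarrow> 'a \<Rightarrow> 'a" where
  "gram H T = op_comp H (adj H T) T"

definition op_invertible :: "('a, 'm) cspace_scheme \<Rightarrow> ('a \<Rightarrow> 'a) \<Rightarrow> bool" where
  "op_invertible H A \<longleftrightarrow> A \<in> bounded_ops H H \<and>
     (\<exists>B\<in>bounded_ops H H. op_comp H A B = id_op H \<and> op_comp H B A = id_op H)"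

text \<open>Over the complex numbers, positivity of the quadratic form entails self-adjointness.\<close>

definition op_positive :: "('a, 'm) cspace_scheme \<Rightarrow> ('a \<Rightarrow> 'a) \<Rightarrow> bool" where
  "op_positive H A \<longleftrightarrow> A \<in> bounded_ops H H \<and> (\<forall>x\<in>carrier H. cinner H (A x) x \<in> \<real>\<^sub>\<ge>\<^sub>0)"

definition op_le :: "('a, 'm) cspace_scheme \<Rightarrow> ('a \<Rightarrow> 'a) \<Rightarrow> ('a \<Rightarrow> 'a) \<Rightarrow> bool" where
  "op_le H C B \<longleftrightarrow> op_positive H (op_diff H B C)"

definition op_sqrt :: "('a, 'm) cspace_scheme \<Rightarrow> ('a \<Rightarrow> 'a) \<Rightarrow> 'a \<Rightarrow> 'a" where
  "op_sqrt H A = (THE B. op_positive H B \<and> op_comp H B B = A)"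

abbreviation op_range :: "('a, 'm) cspace_scheme \<Rightarrow> ('a \<Rightarrow> 'b) \<Rightarrow> 'b set" where
  "op_range H T \<equiv> T ` carrier H"

definition left_invertible :: "('a, 'm) cspace_scheme \<Rightarrow> ('a \<Rightarrow> 'a) \<Rightarrow> bool" where
  "left_invertible H S \<longleftrightarrow> S \<in> bounded_ops H H \<and> op_invertible H (gram H S)"

definition isometry :: "('a, 'm) cspace_scheme \<Rightarrow> ('a \<Rightarrow> 'a) \<Rightarrow> bool" where
  "isometry H V \<longleftrightarrow> V \<in> bounded_ops H H \<and> gram H V = id_op H"

definition quasi_isometry :: "('a, 'm) cspace_scheme \<Rightarrow> ('a \<Rightarrow> 'a) \<Rightarrow> bool" where
  "quasi_isometry H S \<longleftrightarrow> S \<in> bounded_ops H H \<and>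
     op_comp H (op_comp H (adj H S) (adj H S)) (op_comp H S S) = gram H S"

definition quasicontraction :: "('a, 'm) cspace_scheme \<Rightarrow> ('a \<Rightarrow> 'a) \<Rightarrow> bool" where
  "quasicontraction H T \<longleftrightarrow> T \<in> bounded_ops H H \<and>
     op_le H (op_comp H (op_comp H (adj H T) (adj H T)) (op_comp H T T)) (gram H T)"

definition range_condition :: "('a, 'm) cspace_scheme \<Rightarrow> ('a \<Rightarrow> 'a) \<Rightarrow> bool" where
  "range_condition H S \<longleftrightarrow> gram H S ` op_range H S \<subseteq> op_range H S"

definition orthogonal_sum ::
    "('a, 'm) cspace_scheme \<Rightarrow> 'a set \<Rightarrow> 'a set \<Rightarrow> 'a set \<Rightarrow> bool" where
  "orthogonal_sum K X Y Z \<longleftrightarrow>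
     X = Y <+>\<^bsub>K\<^esub> Z \<and> (\<forall>y\<in>Y. \<forall>z\<in>Z. cinner K y z = 0)"


section \<open>Liftings\<close>

text \<open>
  The inclusion of \<open>H\<close> in a larger space \<open>K\<close> is an isometric embedding \<open>J\<close>; its image is closed
  in \<open>K\<close> because \<open>H\<close> is complete.
\<close>

definition isometric_embedding ::
    "('a, 'm) cspace_scheme \<Rightarrow> ('b, 'n) cspace_scheme \<Rightarrow> ('a \<Rightarrow> 'b) \<Rightarrow> bool" where
  "isometric_embedding H K J \<longleftrightarrow> J \<in> bounded_ops H K \<and>
     (\<forall>x\<in>carrier H. \<forall>y\<in>carrier H. cinner K (J x) (J y) = cinner H x y)"

text \<open>The orthogonal projection of \<open>K\<close> onto \<open>H\<close>, with values in \<open>H\<close>.\<close>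

definition proj_onto ::
    "('a, 'm) cspace_scheme \<Rightarrow> ('b, 'n) cspace_scheme \<Rightarrow> ('a \<Rightarrow> 'b) \<Rightarrow> 'b \<Rightarrow> 'a" where
  "proj_onto H K J k = (THE h. h \<in> carrier H \<and>
     (\<forall>g\<in>carrier H. cinner K (k \<ominus>\<^bsub>K\<^esub> J h) (J g) = 0))"

text \<open>The space \<open>K \<ominus> H\<close>.\<close>

definition orth_compl ::
    "('a, 'm) cspace_scheme \<Rightarrow> ('b, 'n) cspace_scheme \<Rightarrow> ('a \<Rightarrow> 'b) \<Rightarrow> ('b, 'n) cspace_scheme" where
  "orth_compl H K J =
     K\<lparr>carrier := {k \<in> carrier K. \<forall>h\<in>carrier H. cinner K k (J h) = 0}\<rparr>"

definition lifting :: "('a, 'm) cspace_scheme \<Rightarrow> ('b, 'n) cspace_scheme \<Rightarrow> ('a \<Rightarrow> 'b) \<Rightarrow>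
    ('a \<Rightarrow> 'a) \<Rightarrow> ('b \<Rightarrow> 'b) \<Rightarrow> bool" where
  "lifting H K J T S \<longleftrightarrow> S \<in> bounded_ops K K \<and>
     (\<forall>k\<in>carrier K. proj_onto H K J (S k) = T (proj_onto H K J k))"

definition left_inv_quasi_isometric_lifting :: "('a, 'm) cspace_scheme \<Rightarrow> ('b, 'n) cspace_scheme \<Rightarrow>
    ('a \<Rightarrow> 'b) \<Rightarrow> ('a \<Rightarrow> 'a) \<Rightarrow> ('b \<Rightarrow> 'b) \<Rightarrow> bool" where
  "left_inv_quasi_isometric_lifting H K J T S \<longleftrightarrow>
     hilbert_space K \<and> isometric_embedding H K J \<and> lifting H K J T S \<and>
     left_invertible K S \<and> quasi_isometry K S"

text \<open>The inclusion \<open>S\<^sup>* S H \<subseteq> H\<close>, and the operator that \<open>S\<^sup>* S\<close> then induces on \<open>H\<close>.\<close>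

definition gram_invariant :: "('a, 'm) cspace_scheme \<Rightarrow> ('b, 'n) cspace_scheme \<Rightarrow>
    ('a \<Rightarrow> 'b) \<Rightarrow> ('b \<Rightarrow> 'b) \<Rightarrow> bool" where
  "gram_invariant H K J S \<longleftrightarrow> gram K S ` (J ` carrier H) \<subseteq> J ` carrier H"

definition gram_restr :: "('a, 'm) cspace_scheme \<Rightarrow> ('b, 'n) cspace_scheme \<Rightarrow>
    ('a \<Rightarrow> 'b) \<Rightarrow> ('b \<Rightarrow> 'b) \<Rightarrow> 'a \<Rightarrow> 'a" where
  "gram_restr H K J S = (\<lambda>x\<in>carrier H. inv_into (carrier H) J (gram K S (J x)))"

definition compl_restr :: "('a, 'm) cspace_scheme \<Rightarrow> ('b, 'n) cspace_scheme \<Rightarrow>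
    ('a \<Rightarrow> 'b) \<Rightarrow> ('b \<Rightarrow> 'b) \<Rightarrow> 'b \<Rightarrow> 'b" where
  "compl_restr H K J S = restrict S (carrier (orth_compl H K J))"

text \<open>The hypothesis on \<open>T\<close>: existence of the operator \<open>A\<^sub>0\<close>.\<close>

definition has_range_majorant :: "('a, 'm) cspace_scheme \<Rightarrow> ('a \<Rightarrow> 'a) \<Rightarrow> bool" where
  "has_range_majorant H T \<longleftrightarrow> (\<exists>A. op_invertible H A \<and>
     op_le H (gram H T) A \<and>
     op_le H (op_comp H (adj H T) (op_comp H A T)) A \<and>
     op_range H (op_sqrt H (op_diff H A (gram H T))) =
       op_range H (op_sqrt H (op_diff H A (op_comp H (adj H T) (op_comp H A T)))))"

end

theory Submission
  imports Defs
begin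

text \<open>
  Write a lifting of \<open>T\<close> on \<open>H \<oplus> H'\<close> as a lower triangular matrix \<open>S = [T 0; E W]\<close>. The inclusion
  \<open>S\<^sup>* S H \<subseteq> H\<close> says that \<open>W\<^sup>* E = 0\<close>, so that \<open>S\<^sup>* S = A \<oplus> W\<^sup>* W\<close> with \<open>A = T\<^sup>* T + E\<^sup>* E\<close>.
  The quasi-isometry identity then reads \<open>A - T\<^sup>* A T = E\<^sup>* (W\<^sup>* W) E\<close> on \<open>H\<close>. The two defects
  \<open>A - T\<^sup>* T = E\<^sup>* E\<close> and \<open>A - T\<^sup>* A T = (W E)\<^sup>* (W E)\<close> are therefore equivalent as quadratic forms,
  because \<open>S\<close> is bounded and bounded below. For positive operators the equivalence of the forms is the
  equality of the ranges of the square roots (\<open>bound_imp_range_subset\<close>, \<open>range_subset_imp_bound\<close>), and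
  this gives the operator majorant (\<open>range_majorant_of_lifting\<close>).

  Conversely, let \<open>A\<close> be such a majorant, \<open>R = sqrt (A - T\<^sup>* T)\<close> and \<open>Q = sqrt (A - T\<^sup>* A T)\<close>. Equality of
  the ranges yields an operator \<open>C\<close>, bounded below, with \<open>C R = Q\<close> and \<open>C = I\<close> on the kernel of \<open>R\<close>
  (\<open>equal_range_intertwiner\<close>). On the square-summable sequences in \<open>H\<close> put
  \<open>S (x\<^sub>0, x\<^sub>1, x\<^sub>2, x\<^sub>3, ...) = (T x\<^sub>0, R x\<^sub>0, C x\<^sub>1, x\<^sub>2, x\<^sub>3, ...)\<close>.
  Its Gram operator is the diagonal operator with entries \<open>A\<close>, \<open>C\<^sup>* C\<close>, \<open>I\<close>, \<open>I\<close>, ... (\<open>cinner_S_S\<close>). From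
  this one formula all properties of \<open>S\<close> follow: it is bounded below, it is a quasi-isometry since
  \<open>(C R)\<^sup>* C R = A - T\<^sup>* A T\<close>, and the images of \<open>H\<close> and of its complement are orthogonal. The range of
  \<open>W\<close> lives in the coordinates where \<open>W\<^sup>* W\<close> is the identity, hence is invariant under it.

  For a quasi-isometry, \<open>(S\<^sup>* S - I) S\<close> always maps into the orthogonal complement of the range of \<open>S\<close>;
  so the range condition means \<open>S\<^sup>* S S = S\<close> (\<open>range_condition_iff_fixed\<close>). Its first coordinate is
  \<open>A T = T\<close>. If this holds then \<open>T\<^sup>* A T = T\<^sup>* T\<close>, so \<open>R = Q\<close>, \<open>C = I\<close> and \<open>W\<close> is an isometry; and
  \<open>T\<^sup>* T \<le> A\<close> gives \<open>T\<^sup>*\<^sup>2 T\<^sup>2 \<le> T\<^sup>* A T = T\<^sup>* T\<close>.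

  The operator theory behind this is developed for the spaces at hand. One minimisation argument
  (\<open>Riesz_along\<close>) provides adjoints, orthogonal projections, inverses of Gram operators that are bounded
  below and the solutions of the range inclusions; a fixed point iteration provides square roots; and
  a gliding hump replaces the closed graph theorem in the range inclusion.
\<close>

section \<open>Inner products and convergence\<close>

context complex_inner_space begin

lemma cinner_zero_right: "x \<in> carrier H \<Longrightarrow> cinner H x \<zero>\<^bsub>H\<^esub> = 0"
  by (metis cinner_cnj cinner_zero_left complex_cnj_zero M.zero_closed)

lemma cinner_minus_left:
  "\<lbrakk>x \<in> carrier H; y \<in> carrier H; z \<in> carrier H\<rbrakk>
    \<Longrightarrow> cinner H (x \<ominus>\<^bsub>H\<^esub> y) z = cinner H x z - cinner H y z"
  by (simp add: a_minus_def cinner_add a_inv_eq_smult cinner_smult smult_carrier)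

lemma cinner_minus_right:
  "\<lbrakk>x \<in> carrier H; y \<in> carrier H; z \<in> carrier H\<rbrakk>
    \<Longrightarrow> cinner H z (x \<ominus>\<^bsub>H\<^esub> y) = cinner H z x - cinner H z y"
  by (simp add: a_minus_def cinner_add_right a_inv_eq_smult cinner_smult_right smult_carrier)

lemmas cinner_rules = cinner_add cinner_smult cinner_minus_left cinner_add_right
  cinner_smult_right cinner_minus_right cinner_zero_left cinner_zero_right smult_carrier

lemma cinner_eq_zero_iff: "x \<in> carrier H \<Longrightarrow> cinner H x x = 0 \<longleftrightarrow> x = \<zero>\<^bsub>H\<^esub>"
  using cinner_pos[of x] cinner_zero_left[of x] by fastforce

lemma minus_eq_zeroD:
  assumes "x \<in> carrier H" "y \<in> carrier H" "x \<ominus>\<^bsub>H\<^esub> y = \<zero>\<^bsub>H\<^esub>" shows "x = y"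
  using assms by (metis a_minus_def a_inv_closed minus_minus minus_equality)

lemma minus_self: "x \<in> carrier H \<Longrightarrow> x \<ominus>\<^bsub>H\<^esub> x = \<zero>\<^bsub>H\<^esub>"
  by (simp add: a_minus_def r_neg)

text \<open>
  Vectors are compared through their inner products: this turns every identity between linear
  combinations into arithmetic of complex numbers.
\<close>

lemma vec_eqI:
  assumes "x \<in> carrier H" "y \<in> carrier H" "\<And>z. z \<in> carrier H \<Longrightarrow> cinner H x z = cinner H y z"
  shows "x = y"
proof -
  have "cinner H (x \<ominus>\<^bsub>H\<^esub> y) (x \<ominus>\<^bsub>H\<^esub> y) = 0"
    using assms by (simp add: cinner_minus_left)
  then show ?thesis using assms minus_eq_zeroD cinner_eq_zero_iff by simp
qed

lemma vec_eqI_right: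
  assumes "x \<in> carrier H" "y \<in> carrier H" "\<And>z. z \<in> carrier H \<Longrightarrow> cinner H z x = cinner H z y"
  shows "x = y"
  using assms by (intro vec_eqI) (auto, metis cinner_cnj)

lemma hnorm_ge_0: "x \<in> carrier H \<Longrightarrow> 0 \<le> hnorm H x"
  by (simp add: hnorm_def cinner_self_nonneg)

lemma hnorm_sq: "x \<in> carrier H \<Longrightarrow> (hnorm H x)\<^sup>2 = Re (cinner H x x)"
  by (simp add: hnorm_def cinner_self_nonneg)

lemma cinner_self: "x \<in> carrier H \<Longrightarrow> cinner H x x = complex_of_real ((hnorm H x)\<^sup>2)"
  using cinner_cnj[of x x] by (simp add: hnorm_sq complex_eq_iff)

lemma hnorm_eq_0_iff: "x \<in> carrier H \<Longrightarrow> hnorm H x = 0 \<longleftrightarrow> x = \<zero>\<^bsub>H\<^esub>"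
  by (metis cinner_eq_zero_iff cinner_self of_real_eq_0_iff power_eq_0_iff zero_power2)

lemma hnorm_zero: "hnorm H \<zero>\<^bsub>H\<^esub> = 0"
  by (simp add: hnorm_eq_0_iff)

lemma hnorm_smult: "x \<in> carrier H \<Longrightarrow> hnorm H (c \<odot>\<^bsub>H\<^esub> x) = cmod c * hnorm H x"
proof -
  assume x: "x \<in> carrier H"
  have "cinner H (c \<odot>\<^bsub>H\<^esub> x) (c \<odot>\<^bsub>H\<^esub> x) = (c * cnj c) * cinner H x x"
    using x by (simp add: cinner_rules)
  also have "\<dots> = complex_of_real ((cmod c)\<^sup>2 * (hnorm H x)\<^sup>2)"
    using x complex_norm_square[of c] by (simp add: cinner_self)
  finally have "(hnorm H (c \<odot>\<^bsub>H\<^esub> x))\<^sup>2 = (cmod c * hnorm H x)\<^sup>2"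
    using x by (simp add: hnorm_sq smult_carrier power_mult_distrib)
  then show ?thesis using x by (simp add: hnorm_ge_0 smult_carrier power2_eq_iff_nonneg)
qed

lemma Cauchy_Schwarz:
  assumes x: "x \<in> carrier H" and y: "y \<in> carrier H"
  shows "cmod (cinner H x y) \<le> hnorm H x * hnorm H y"
proof (cases "cinner H x y = 0")
  case True
  then show ?thesis using assms by (simp add: hnorm_ge_0)
next
  case False
  \<comment> \<open>Rotate \<open>x\<close> so that the inner product becomes real, then use the real inequality.\<close>
  define c where "c = cnj (cinner H x y) / cmod (cinner H x y)"
  have c: "cmod c = 1" using False by (simp add: c_def norm_divide)
  have "c * cinner H x y = complex_of_real (cmod (cinner H x y))"
    using False by (simp add: c_def complex_norm_square[symmetric] mult.commute power2_eq_square)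
  then have "Re (cinner H (c \<odot>\<^bsub>H\<^esub> x) y) = cmod (cinner H x y)"
    using assms by (simp add: cinner_rules)
  then have "(cmod (cinner H x y))\<^sup>2 \<le> (hnorm H (c \<odot>\<^bsub>H\<^esub> x) * hnorm H y)\<^sup>2"
    using Re_cinner_squared_le[of "c \<odot>\<^bsub>H\<^esub> x" y] assms
    by (simp add: power_mult_distrib hnorm_sq smult_carrier)
  then show ?thesis
    using assms c by (simp add: hnorm_smult hnorm_ge_0 power2_le_iff_abs_le abs_mult)
qed

lemma hnorm_minus_triangle:
  assumes "x \<in> carrier H" "y \<in> carrier H" "z \<in> carrier H"
  shows "hnorm H (x \<ominus>\<^bsub>H\<^esub> z) \<le> hnorm H (x \<ominus>\<^bsub>H\<^esub> y) + hnorm H (y \<ominus>\<^bsub>H\<^esub> z)"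
proof -
  have "x \<ominus>\<^bsub>H\<^esub> z = (x \<ominus>\<^bsub>H\<^esub> y) \<oplus>\<^bsub>H\<^esub> (y \<ominus>\<^bsub>H\<^esub> z)"
    using assms by (intro vec_eqI) (auto simp: cinner_rules)
  then show ?thesis using hnorm_triangle[of "x \<ominus>\<^bsub>H\<^esub> y" "y \<ominus>\<^bsub>H\<^esub> z"] assms by simp
qed

lemma hnorm_le_add_minus:
  assumes "x \<in> carrier H" "y \<in> carrier H"
  shows "hnorm H x \<le> hnorm H (x \<ominus>\<^bsub>H\<^esub> y) + hnorm H y"
proof -
  have "x = (x \<ominus>\<^bsub>H\<^esub> y) \<oplus>\<^bsub>H\<^esub> y" using assms by (intro vec_eqI) (auto simp: cinner_rules)
  then show ?thesis using hnorm_triangle[of "x \<ominus>\<^bsub>H\<^esub> y" y] assms by simp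
qed

lemma hnorm_diff_le:
  assumes "x \<in> carrier H" "y \<in> carrier H"
  shows "\<bar>hnorm H x - hnorm H y\<bar> \<le> hnorm H (x \<ominus>\<^bsub>H\<^esub> y)"
  using hnorm_le_add_minus[OF assms] hnorm_le_add_minus[OF assms(2,1)] hnorm_minus_commute[OF assms]
  by simp

lemma hnorm_add_sq_orthogonal:
  assumes "x \<in> carrier H" "y \<in> carrier H" "cinner H x y = 0"
  shows "(hnorm H (x \<oplus>\<^bsub>H\<^esub> y))\<^sup>2 = (hnorm H x)\<^sup>2 + (hnorm H y)\<^sup>2"
  using assms cinner_cnj[of x y] by (simp add: hnorm_sq cinner_rules)

end

definition conv_to :: "('a, 'm) cspace_scheme \<Rightarrow> (nat \<Rightarrow> 'a) \<Rightarrow> 'a \<Rightarrow> bool" where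
  "conv_to H \<sigma> x \<longleftrightarrow> (\<forall>n. \<sigma> n \<in> carrier H) \<and> x \<in> carrier H \<and>
     (\<lambda>n. hnorm H (\<sigma> n \<ominus>\<^bsub>H\<^esub> x)) \<longlonglongrightarrow> 0"

definition cauchy_in :: "('a, 'm) cspace_scheme \<Rightarrow> (nat \<Rightarrow> 'a) \<Rightarrow> bool" where
  "cauchy_in H \<sigma> \<longleftrightarrow> (\<forall>n. \<sigma> n \<in> carrier H) \<and>
     (\<forall>e>0. \<exists>N. \<forall>m\<ge>N. \<forall>n\<ge>N. hnorm H (\<sigma> m \<ominus>\<^bsub>H\<^esub> \<sigma> n) < e)"

context complex_inner_space begin

interpretation MS: Metric_space "carrier H" "hdist H" by (rule Metric_space_hdist)

lemma limitin_iff_conv_to: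
  assumes "\<And>n. \<sigma> n \<in> carrier H"
  shows "limitin MS.mtopology \<sigma> x sequentially \<longleftrightarrow> conv_to H \<sigma> x"
proof -
  have "x \<in> carrier H \<Longrightarrow> hdist H (\<sigma> n) x = hnorm H (\<sigma> n \<ominus>\<^bsub>H\<^esub> x)" for n
    using assms by (simp add: hdist_def)
  then show ?thesis
    using assms unfolding MS.limitin_metric_dist_null conv_to_def by auto
qed

lemma MCauchy_iff_cauchy_in: "MS.MCauchy \<sigma> \<longleftrightarrow> cauchy_in H \<sigma>"
  unfolding MS.MCauchy_def cauchy_in_def by (auto simp: hdist_def image_subset_iff)

lemma hclosure_iff_conv_to:
  assumes "X \<subseteq> carrier H"
  shows "x \<in> hclosure H X \<longleftrightarrow> (\<exists>\<sigma>. (\<forall>n. \<sigma> n \<in> X) \<and> conv_to H \<sigma> x)"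
proof -
  have "x \<in> hclosure H X \<longleftrightarrow> (\<exists>\<sigma>. range \<sigma> \<subseteq> X \<inter> carrier H \<and> limitin MS.mtopology \<sigma> x sequentially)"
    unfolding hclosure_def MS.closure_of_sequentially using MS.limitin_mspace by blast
  also have "\<dots> \<longleftrightarrow> (\<exists>\<sigma>. (\<forall>n. \<sigma> n \<in> X) \<and> conv_to H \<sigma> x)"
    using assms limitin_iff_conv_to by (metis (no_types, lifting) image_subset_iff inf.absorb1 rangeI
      UNIV_I subset_iff)
  finally show ?thesis .
qed

lemma hilbert_spaceI:
  assumes "\<And>\<sigma>. cauchy_in H \<sigma> \<Longrightarrow> \<exists>x. conv_to H \<sigma> x"
  shows "hilbert_space H"
proof
  show "MS.mcomplete"
    unfolding MS.mcomplete_def MCauchy_iff_cauchy_in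
  proof (intro allI impI)
    fix \<sigma> assume \<sigma>: "cauchy_in H \<sigma>"
    then obtain x where "conv_to H \<sigma> x" using assms by auto
    then show "\<exists>x. limitin MS.mtopology \<sigma> x sequentially"
      using \<sigma> limitin_iff_conv_to[of \<sigma> x] unfolding cauchy_in_def by auto
  qed
qed

lemma conv_to_carrier: "conv_to H \<sigma> x \<Longrightarrow> x \<in> carrier H" "conv_to H \<sigma> x \<Longrightarrow> \<sigma> n \<in> carrier H"
  by (auto simp: conv_to_def)

lemma conv_toI:
  assumes "\<And>n. \<sigma> n \<in> carrier H" "x \<in> carrier H" "e \<longlonglongrightarrow> 0"
    and "\<And>n. hnorm H (\<sigma> n \<ominus>\<^bsub>H\<^esub> x) \<le> e n"
  shows "conv_to H \<sigma> x"
proof -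
  have "(\<lambda>n. hnorm H (\<sigma> n \<ominus>\<^bsub>H\<^esub> x)) \<longlonglongrightarrow> 0"
    by (rule tendsto_sandwich[OF _ _ tendsto_const assms(3)]) (auto simp: assms hnorm_ge_0)
  then show ?thesis using assms by (simp add: conv_to_def)
qed

lemma conv_to_cinner:
  assumes "conv_to H \<sigma> x" "z \<in> carrier H"
  shows "(\<lambda>n. cinner H (\<sigma> n) z) \<longlonglongrightarrow> cinner H x z"
proof -
  have "(\<lambda>n. cinner H (\<sigma> n) z - cinner H x z) \<longlonglongrightarrow> 0"
  proof (rule Lim_null_comparison)
    show "\<forall>\<^sub>F n in sequentially. norm (cinner H (\<sigma> n) z - cinner H x z)
        \<le> hnorm H (\<sigma> n \<ominus>\<^bsub>H\<^esub> x) * hnorm H z"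
      using assms Cauchy_Schwarz[of "\<sigma> _ \<ominus>\<^bsub>H\<^esub> x" z]
      by (intro always_eventually allI) (simp add: conv_to_carrier cinner_minus_left)
    show "(\<lambda>n. hnorm H (\<sigma> n \<ominus>\<^bsub>H\<^esub> x) * hnorm H z) \<longlonglongrightarrow> 0"
      using assms tendsto_mult_left_zero unfolding conv_to_def by blast
  qed
  then show ?thesis using LIM_zero_iff by blast
qed

lemma conv_to_cinner_right:
  assumes "conv_to H \<sigma> x" "z \<in> carrier H"
  shows "(\<lambda>n. cinner H z (\<sigma> n)) \<longlonglongrightarrow> cinner H z x"
proof -
  have "(\<lambda>n. cnj (cinner H (\<sigma> n) z)) \<longlonglongrightarrow> cnj (cinner H x z)"
    using conv_to_cinner[OF assms] tendsto_cnj by blast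
  then show ?thesis using assms conv_to_carrier by (simp add: cinner_cnj[symmetric])
qed

lemma conv_to_hnorm:
  assumes "conv_to H \<sigma> x"
  shows "(\<lambda>n. hnorm H (\<sigma> n)) \<longlonglongrightarrow> hnorm H x"
proof -
  have "(\<lambda>n. hnorm H (\<sigma> n) - hnorm H x) \<longlonglongrightarrow> 0"
    by (rule Lim_null_comparison[where g="\<lambda>n. hnorm H (\<sigma> n \<ominus>\<^bsub>H\<^esub> x)"])
      (use assms in \<open>auto simp: conv_to_def hnorm_diff_le\<close>)
  then show ?thesis using LIM_zero_iff by blast
qed

lemma conv_to_unique:
  assumes "conv_to H \<sigma> x" "conv_to H \<sigma> y" shows "x = y"
  using conv_to_cinner[OF assms(1)] conv_to_cinner[OF assms(2)] LIMSEQ_unique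
  by (intro vec_eqI) (use assms conv_to_carrier in blast)+

lemma conv_to_add:
  assumes "conv_to H \<sigma> x" "conv_to H \<tau> y"
  shows "conv_to H (\<lambda>n. \<sigma> n \<oplus>\<^bsub>H\<^esub> \<tau> n) (x \<oplus>\<^bsub>H\<^esub> y)"
proof (rule conv_toI)
  have "(\<lambda>n. hnorm H (\<sigma> n \<ominus>\<^bsub>H\<^esub> x) + hnorm H (\<tau> n \<ominus>\<^bsub>H\<^esub> y)) \<longlonglongrightarrow> 0 + 0"
    using assms unfolding conv_to_def by (intro tendsto_add) auto
  then show "(\<lambda>n. hnorm H (\<sigma> n \<ominus>\<^bsub>H\<^esub> x) + hnorm H (\<tau> n \<ominus>\<^bsub>H\<^esub> y)) \<longlonglongrightarrow> 0" by simp
  fix n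
  have "(\<sigma> n \<oplus>\<^bsub>H\<^esub> \<tau> n) \<ominus>\<^bsub>H\<^esub> (x \<oplus>\<^bsub>H\<^esub> y) = (\<sigma> n \<ominus>\<^bsub>H\<^esub> x) \<oplus>\<^bsub>H\<^esub> (\<tau> n \<ominus>\<^bsub>H\<^esub> y)"
    using assms conv_to_carrier by (intro vec_eqI) (auto simp: cinner_rules)
  then show "hnorm H ((\<sigma> n \<oplus>\<^bsub>H\<^esub> \<tau> n) \<ominus>\<^bsub>H\<^esub> (x \<oplus>\<^bsub>H\<^esub> y))
      \<le> hnorm H (\<sigma> n \<ominus>\<^bsub>H\<^esub> x) + hnorm H (\<tau> n \<ominus>\<^bsub>H\<^esub> y)"
    using hnorm_triangle[of "\<sigma> n \<ominus>\<^bsub>H\<^esub> x" "\<tau> n \<ominus>\<^bsub>H\<^esub> y"] assms conv_to_carrier by simp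
qed (use assms conv_to_carrier in auto)

lemma conv_to_smult:
  assumes "conv_to H \<sigma> x"
  shows "conv_to H (\<lambda>n. c \<odot>\<^bsub>H\<^esub> \<sigma> n) (c \<odot>\<^bsub>H\<^esub> x)"
proof (rule conv_toI)
  show "(\<lambda>n. cmod c * hnorm H (\<sigma> n \<ominus>\<^bsub>H\<^esub> x)) \<longlonglongrightarrow> 0"
    using assms unfolding conv_to_def by (intro tendsto_mult_right_zero) auto
  fix n
  have "c \<odot>\<^bsub>H\<^esub> \<sigma> n \<ominus>\<^bsub>H\<^esub> c \<odot>\<^bsub>H\<^esub> x = c \<odot>\<^bsub>H\<^esub> (\<sigma> n \<ominus>\<^bsub>H\<^esub> x)"
    using assms conv_to_carrier by (intro vec_eqI) (auto simp: cinner_rules algebra_simps)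
  then show "hnorm H (c \<odot>\<^bsub>H\<^esub> \<sigma> n \<ominus>\<^bsub>H\<^esub> c \<odot>\<^bsub>H\<^esub> x) \<le> cmod c * hnorm H (\<sigma> n \<ominus>\<^bsub>H\<^esub> x)"
    using assms conv_to_carrier by (simp add: hnorm_smult)
qed (use assms conv_to_carrier smult_carrier in auto)

end

context hilbert_space begin

lemma cauchy_conv: assumes "cauchy_in H \<sigma>" obtains x where "conv_to H \<sigma> x"
proof -
  interpret MS: Metric_space "carrier H" "hdist H" by (rule Metric_space_hdist)
  show ?thesis
    using assms complete that limitin_iff_conv_to
    unfolding MS.mcomplete_def MCauchy_iff_cauchy_in cauchy_in_def by metis
qed

end

section \<open>Bounded operators\<close>

lemma bounded_opsD:
  assumes "T \<in> bounded_ops H K"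
  shows "x \<in> carrier H \<Longrightarrow> T x \<in> carrier K"
    and "\<lbrakk>x \<in> carrier H; y \<in> carrier H\<rbrakk> \<Longrightarrow> T (x \<oplus>\<^bsub>H\<^esub> y) = T x \<oplus>\<^bsub>K\<^esub> T y"
    and "x \<in> carrier H \<Longrightarrow> T (c \<odot>\<^bsub>H\<^esub> x) = c \<odot>\<^bsub>K\<^esub> T x"
  using assms unfolding bounded_ops_def by auto

lemma bounded_ops_eqI:
  assumes "T \<in> bounded_ops H K" "R \<in> bounded_ops H K" "\<And>x. x \<in> carrier H \<Longrightarrow> T x = R x"
  shows "T = R"
proof (rule PiE_ext)
  show "T \<in> carrier H \<rightarrow>\<^sub>E carrier K" using assms(1) unfolding bounded_ops_def by blast
  show "R \<in> carrier H \<rightarrow>\<^sub>E carrier K" using assms(2) unfolding bounded_ops_def by blast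
qed (rule assms(3))

lemma bounded_opsI:
  assumes "\<And>x. x \<in> carrier H \<Longrightarrow> T x \<in> carrier K"
    and "\<And>x y. \<lbrakk>x \<in> carrier H; y \<in> carrier H\<rbrakk> \<Longrightarrow> T (x \<oplus>\<^bsub>H\<^esub> y) = T x \<oplus>\<^bsub>K\<^esub> T y"
    and "\<And>x c. x \<in> carrier H \<Longrightarrow> T (c \<odot>\<^bsub>H\<^esub> x) = c \<odot>\<^bsub>K\<^esub> T x"
    and "\<And>x. x \<notin> carrier H \<Longrightarrow> T x = undefined"
    and "\<And>x. x \<in> carrier H \<Longrightarrow> hnorm K (T x) \<le> C * hnorm H x"
  shows "T \<in> bounded_ops H K"
  unfolding bounded_ops_def using assms by (auto simp: PiE_def extensional_def intro!: exI[of _ C])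

locale space_pair = H: complex_inner_space H + K: complex_inner_space K
  for H :: "('a, 'm) cspace_scheme" and K :: "('b, 'n) cspace_scheme"
begin

lemma bound_pos:
  assumes "T \<in> bounded_ops H K"
  obtains C where "C > 0" "\<And>x. x \<in> carrier H \<Longrightarrow> hnorm K (T x) \<le> C * hnorm H x"
proof -
  obtain C where C: "\<forall>x\<in>carrier H. hnorm K (T x) \<le> C * hnorm H x"
    using assms unfolding bounded_ops_def by auto
  have "hnorm K (T x) \<le> max C 1 * hnorm H x" if "x \<in> carrier H" for x
    using C that by (meson H.hnorm_ge_0 max.cobounded1 mult_right_mono order_trans)
  then show ?thesis using that[of "max C 1"] by simp
qed

lemma bounded_ops_minus:
  assumes "T \<in> bounded_ops H K" "x \<in> carrier H" "y \<in> carrier H"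
  shows "T (x \<ominus>\<^bsub>H\<^esub> y) = T x \<ominus>\<^bsub>K\<^esub> T y"
  using assms bounded_opsD[OF assms(1)]
  by (simp add: a_minus_def H.a_inv_eq_smult K.a_inv_eq_smult H.smult_carrier)

lemma bounded_ops_zero:
  assumes "T \<in> bounded_ops H K" shows "T \<zero>\<^bsub>H\<^esub> = \<zero>\<^bsub>K\<^esub>"
  using bounded_ops_minus[OF assms, of "\<zero>\<^bsub>H\<^esub>" "\<zero>\<^bsub>H\<^esub>"] bounded_opsD(1)[OF assms]
  by (simp add: H.minus_self K.minus_self)

lemma bounded_ops_conv_to:
  assumes "T \<in> bounded_ops H K" "conv_to H \<sigma> x"
  shows "conv_to K (\<lambda>n. T (\<sigma> n)) (T x)"
proof -
  obtain C where C: "\<And>x. x \<in> carrier H \<Longrightarrow> hnorm K (T x) \<le> C * hnorm H x"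
    using bound_pos[OF assms(1)] by metis
  show ?thesis
  proof (rule K.conv_toI)
    show "(\<lambda>n. C * hnorm H (\<sigma> n \<ominus>\<^bsub>H\<^esub> x)) \<longlonglongrightarrow> 0"
      using assms(2) unfolding conv_to_def by (intro tendsto_mult_right_zero) auto
    show "hnorm K (T (\<sigma> n) \<ominus>\<^bsub>K\<^esub> T x) \<le> C * hnorm H (\<sigma> n \<ominus>\<^bsub>H\<^esub> x)" for n
      using C[of "\<sigma> n \<ominus>\<^bsub>H\<^esub> x"] bounded_ops_minus[OF assms(1), of "\<sigma> n" x]
        H.conv_to_carrier[OF assms(2)] by simp
  qed (use H.conv_to_carrier[OF assms(2)] bounded_opsD[OF assms(1)] in auto)
qed

end

context complex_inner_space begin

lemma hnorm_add_sq:
  assumes "x \<in> carrier H" "y \<in> carrier H"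
  shows "(hnorm H (x \<oplus>\<^bsub>H\<^esub> y))\<^sup>2 = (hnorm H x)\<^sup>2 + 2 * Re (cinner H x y) + (hnorm H y)\<^sup>2"
  using assms cinner_cnj[of x y] by (simp add: hnorm_sq cinner_rules)

lemma hnorm_minus_sq:
  assumes "x \<in> carrier H" "y \<in> carrier H"
  shows "(hnorm H (x \<ominus>\<^bsub>H\<^esub> y))\<^sup>2 = (hnorm H x)\<^sup>2 - 2 * Re (cinner H x y) + (hnorm H y)\<^sup>2"
  using assms cinner_cnj[of x y] by (simp add: hnorm_sq cinner_rules)

lemma hnorm_minus_le:
  assumes "x \<in> carrier H" "y \<in> carrier H"
  shows "hnorm H (x \<ominus>\<^bsub>H\<^esub> y) \<le> hnorm H x + hnorm H y"
  using hnorm_triangle[of x "(-1) \<odot>\<^bsub>H\<^esub> y"] assms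
  by (simp add: a_minus_def a_inv_eq_smult hnorm_smult smult_carrier)

end

section \<open>The Riesz theorem and adjoints\<close>

text \<open>
  A quadratic polynomial in \<open>t\<close> that vanishes and is minimal at \<open>0\<close> has no linear part; this is how the
  minimiser in the Riesz theorem is recognised.
\<close>

lemma linear_coeff_zero:
  fixes a b :: real
  assumes "\<And>t. 0 \<le> 2 * t * a + t\<^sup>2 * b" "b \<ge> 0"
  shows "a = 0"
proof (rule ccontr)
  assume "a \<noteq> 0"
  have "0 \<le> 2 * (- a / (b + 1)) * a + (- a / (b + 1))\<^sup>2 * b" by (rule assms)
  also have "\<dots> = - (a\<^sup>2 * (b + 2)) / (b + 1)\<^sup>2"
    using assms(2) by (simp add: divide_simps power2_eq_square) (simp add: algebra_simps)
  also have "\<dots> < 0" using assms(2) \<open>a \<noteq> 0\<close> by (simp add: divide_neg_pos)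
  finally show False by simp
qed

text \<open>
  By the parallelogram law the images under \<open>A\<close> of a minimising sequence of \<open>\<parallel>A x\<parallel>\<^sup>2 - 2 Re (f x)\<close> form a
  Cauchy sequence, and its limit represents \<open>f\<close>. Instances: \<open>A = I\<close> is the Riesz representation
  theorem, a square root in place of \<open>A\<close> gives range inclusions, and an operator that is bounded below
  gives the inverse of its Gram operator. The approximating sequence is part of the conclusion because
  the last two need that \<open>y\<close> lies in the closure of the range of \<open>A\<close>.
\<close>

lemma (in space_pair) Riesz_along:
  assumes K: "hilbert_space K" and A: "A \<in> bounded_ops H K"
    and f_add: "\<And>x y. \<lbrakk>x \<in> carrier H; y \<in> carrier H\<rbrakk> \<Longrightarrow> f (x \<oplus>\<^bsub>H\<^esub> y) = f x + f y"
    and f_smult: "\<And>c x. x \<in> carrier H \<Longrightarrow> f (c \<odot>\<^bsub>H\<^esub> x) = c * f x"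
    and f_bound: "\<And>x. x \<in> carrier H \<Longrightarrow> cmod (f x) \<le> C * hnorm K (A x)"
  obtains y \<sigma> where "\<And>n. \<sigma> n \<in> carrier H" "conv_to K (\<lambda>n. A (\<sigma> n)) y"
    "\<And>x. x \<in> carrier H \<Longrightarrow> f x = cinner K (A x) y"
proof -
  note [simp] = bounded_opsD[OF A] H.smult_carrier K.smult_carrier
  define q where "q x = (hnorm K (A x))\<^sup>2 - 2 * Re (f x)" for x
  have q_ge: "- C\<^sup>2 \<le> q x" if x: "x \<in> carrier H" for x
  proof -
    have "Re (f x) \<le> C * hnorm K (A x)"
      using f_bound[OF x] complex_Re_le_cmod order_trans by blast
    moreover have "0 \<le> (hnorm K (A x) - C)\<^sup>2" by simp
    ultimately show ?thesis unfolding q_def power2_diff by (simp add: algebra_simps)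
  qed
  define d where "d = Inf (q ` carrier H)"
  have d_le: "d \<le> q x" if "x \<in> carrier H" for x
    unfolding d_def using that q_ge by (intro cInf_lower) (auto intro!: bdd_belowI[of _ "- C\<^sup>2"])
  have "\<exists>x\<in>carrier H. q x < d + 1 / real (Suc n)" for n
    using cInf_lessD[of "q ` carrier H" "d + 1 / real (Suc n)"] H.M.zero_closed
    unfolding d_def[symmetric] by auto
  then obtain \<sigma> where \<sigma>: "\<And>n. \<sigma> n \<in> carrier H" "\<And>n. q (\<sigma> n) < d + 1 / real (Suc n)" by metis
  have par: "(hnorm K (A x \<ominus>\<^bsub>K\<^esub> A y))\<^sup>2 \<le> 2 * (q x + q y - 2 * d)"
    if xy: "x \<in> carrier H" "y \<in> carrier H" for x y
  proof -
    have "q ((1/2) \<odot>\<^bsub>H\<^esub> (x \<oplus>\<^bsub>H\<^esub> y)) = (1/4) * (hnorm K (A x \<oplus>\<^bsub>K\<^esub> A y))\<^sup>2 - Re (f x + f y)"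
      using xy by (simp add: q_def f_add f_smult K.hnorm_smult power_mult_distrib power2_eq_square norm_divide)
        (simp add: field_simps)
    moreover have "d \<le> q ((1/2) \<odot>\<^bsub>H\<^esub> (x \<oplus>\<^bsub>H\<^esub> y))" using xy by (intro d_le) simp
    ultimately show ?thesis
      using xy by (simp add: q_def K.hnorm_add_sq K.hnorm_minus_sq algebra_simps)
  qed
  have "cauchy_in K (\<lambda>n. A (\<sigma> n))"
    unfolding cauchy_in_def
  proof (intro conjI allI impI)
    fix e :: real assume e: "e > 0"
    obtain N :: nat where N: "4 / e\<^sup>2 < real N" using reals_Archimedean2 by blast
    show "\<exists>N. \<forall>m\<ge>N. \<forall>n\<ge>N. hnorm K (A (\<sigma> m) \<ominus>\<^bsub>K\<^esub> A (\<sigma> n)) < e"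
    proof (intro exI[of _ N] allI impI)
      fix m n assume mn: "N \<le> m" "N \<le> n"
      have s: "1 / real (Suc k) < e\<^sup>2 / 4" if "N \<le> k" for k
      proof -
        have "4 / e\<^sup>2 < real (Suc k)" using N that by linarith
        then show ?thesis using e by (simp add: field_simps)
      qed
      have "(hnorm K (A (\<sigma> m) \<ominus>\<^bsub>K\<^esub> A (\<sigma> n)))\<^sup>2 < e\<^sup>2"
        using par[OF \<sigma>(1) \<sigma>(1), of m n] \<sigma>(2)[of m] \<sigma>(2)[of n] s[OF mn(1)] s[OF mn(2)] by simp
      then show "hnorm K (A (\<sigma> m) \<ominus>\<^bsub>K\<^esub> A (\<sigma> n)) < e"
        by (rule power2_less_imp_less) (use e in simp)
    qed
  qed (simp add: \<sigma>)
  then obtain y where y: "conv_to K (\<lambda>n. A (\<sigma> n)) y" using hilbert_space.cauchy_conv[OF K] by blast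
  note [simp] = K.conv_to_carrier(1)[OF y]
  have re: "Re (cinner K (A x) y) = Re (f x)" if x: "x \<in> carrier H" for x
  proof -
    have "0 \<le> 2 * t * (Re (cinner K (A x) y) - Re (f x)) + t\<^sup>2 * (hnorm K (A x))\<^sup>2" for t
    proof -
      have *: "0 \<le> 1 / real (Suc n) + 2 * t * (Re (cinner K (A x) (A (\<sigma> n))) - Re (f x)) + t\<^sup>2 * (hnorm K (A x))\<^sup>2" for n
      proof -
        have "d \<le> q (\<sigma> n \<oplus>\<^bsub>H\<^esub> complex_of_real t \<odot>\<^bsub>H\<^esub> x)" using x \<sigma> by (intro d_le) simp
        also have "\<dots> = q (\<sigma> n) + 2 * t * (Re (cinner K (A x) (A (\<sigma> n))) - Re (f x)) + t\<^sup>2 * (hnorm K (A x))\<^sup>2"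
          using x \<sigma>(1)[of n] K.cinner_cnj[of "A x" "A (\<sigma> n)"]
          by (simp add: q_def K.hnorm_add_sq K.hnorm_smult f_add f_smult power_mult_distrib
              K.cinner_smult_right algebra_simps)
        finally show ?thesis using \<sigma>(2)[of n] by linarith
      qed
      have "(\<lambda>n. 1 / real (Suc n) + 2 * t * (Re (cinner K (A x) (A (\<sigma> n))) - Re (f x)) + t\<^sup>2 * (hnorm K (A x))\<^sup>2)
          \<longlonglongrightarrow> 0 + 2 * t * (Re (cinner K (A x) y) - Re (f x)) + t\<^sup>2 * (hnorm K (A x))\<^sup>2"
        using K.conv_to_cinner_right[OF y, of "A x"] x LIMSEQ_inverse_real_of_nat
        by (intro tendsto_intros) (auto simp: inverse_eq_divide)
      then show ?thesis using * LIMSEQ_le_const by fastforce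
    qed
    then show ?thesis using linear_coeff_zero[of "Re (cinner K (A x) y) - Re (f x)"] by force
  qed
  have "f x = cinner K (A x) y" if x: "x \<in> carrier H" for x
  proof (rule complex_eqI)
    show "Re (f x) = Re (cinner K (A x) y)" using re[OF x] by simp
    \<comment> \<open>The imaginary part is the real part at \<open>\<i> x\<close>.\<close>
    show "Im (f x) = Im (cinner K (A x) y)"
      using re[of "\<i> \<odot>\<^bsub>H\<^esub> x"] x by (simp add: f_smult K.cinner_smult)
  qed
  then show ?thesis by (rule that[OF \<sigma>(1) y])
qed

context complex_inner_space begin

lemma id_op_bounded: "id_op H \<in> bounded_ops H H"
  by (rule bounded_opsI[where C=1]) (auto simp: smult_carrier)

lemma op_diff_bounded:
  assumes "A \<in> bounded_ops H H" "B \<in> bounded_ops H H"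
  shows "op_diff H A B \<in> bounded_ops H H"
proof -
  interpret HH: space_pair H H ..
  obtain a where a: "\<And>x. x \<in> carrier H \<Longrightarrow> hnorm H (A x) \<le> a * hnorm H x"
    using HH.bound_pos[OF assms(1)] by metis
  obtain b where b: "\<And>x. x \<in> carrier H \<Longrightarrow> hnorm H (B x) \<le> b * hnorm H x"
    using HH.bound_pos[OF assms(2)] by metis
  note [simp] = bounded_opsD[OF assms(1)] bounded_opsD[OF assms(2)] smult_carrier
  show ?thesis
  proof (rule bounded_opsI[where C="a + b"])
    fix x y assume xy: "x \<in> carrier H" "y \<in> carrier H"
    show "op_diff H A B (x \<oplus>\<^bsub>H\<^esub> y) = op_diff H A B x \<oplus>\<^bsub>H\<^esub> op_diff H A B y"
      using xy by (intro vec_eqI) (auto simp: op_diff_def cinner_rules)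
  next
    fix x c assume x: "x \<in> carrier H"
    show "op_diff H A B (c \<odot>\<^bsub>H\<^esub> x) = c \<odot>\<^bsub>H\<^esub> op_diff H A B x"
      using x by (intro vec_eqI) (auto simp: op_diff_def cinner_rules algebra_simps)
  next
    fix x assume x: "x \<in> carrier H"
    have "hnorm H (A x \<ominus>\<^bsub>H\<^esub> B x) \<le> hnorm H (A x) + hnorm H (B x)"
      using x by (intro hnorm_minus_le) auto
    then show "hnorm H (op_diff H A B x) \<le> (a + b) * hnorm H x"
      using a[OF x] b[OF x] x by (simp add: op_diff_def algebra_simps)
  qed (auto simp: op_diff_def)
qed

end

lemma bounded_ops_compose:
  assumes "complex_inner_space H" "complex_inner_space K" "complex_inner_space L"
    and A: "A \<in> bounded_ops K L" and B: "B \<in> bounded_ops H K"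
  shows "compose (carrier H) A B \<in> bounded_ops H L"
proof -
  interpret H: complex_inner_space H by fact
  interpret K: complex_inner_space K by fact
  interpret L: complex_inner_space L by fact
  interpret HK: space_pair H K ..
  interpret KL: space_pair K L ..
  obtain a where a: "a > 0" "\<And>x. x \<in> carrier K \<Longrightarrow> hnorm L (A x) \<le> a * hnorm K x"
    using KL.bound_pos[OF A] by metis
  obtain b where b: "\<And>x. x \<in> carrier H \<Longrightarrow> hnorm K (B x) \<le> b * hnorm H x"
    using HK.bound_pos[OF B] by metis
  note [simp] = bounded_opsD[OF A] bounded_opsD[OF B] H.smult_carrier
  show ?thesis
  proof (rule bounded_opsI[where C="a * b"])
    fix x assume x: "x \<in> carrier H"
    have "hnorm L (A (B x)) \<le> a * (b * hnorm H x)"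
      using a(2)[of "B x"] b[OF x] x a(1) by (meson bounded_opsD(1)[OF B] mult_left_mono less_imp_le order_trans)
    then show "hnorm L (compose (carrier H) A B x) \<le> a * b * hnorm H x"
      using x by (simp add: compose_def)
  qed (auto simp: compose_def)
qed

lemma (in space_pair) adjoint_exists:
  assumes H: "hilbert_space H" and T: "T \<in> bounded_ops H K"
  shows "\<exists>R\<in>bounded_ops K H. \<forall>x\<in>carrier H. \<forall>y\<in>carrier K. cinner K (T x) y = cinner H x (R y)"
proof -
  note [simp] = bounded_opsD[OF T] H.smult_carrier K.smult_carrier
  obtain C where C: "C > 0" "\<And>x. x \<in> carrier H \<Longrightarrow> hnorm K (T x) \<le> C * hnorm H x"
    using bound_pos[OF T] by metis
  interpret HH: space_pair H H ..
  have T_bound: "cmod (cinner K (T x) y) \<le> C * hnorm K y * hnorm H x"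
    if "x \<in> carrier H" "y \<in> carrier K" for x y
  proof -
    have "cmod (cinner K (T x) y) \<le> hnorm K (T x) * hnorm K y" using that K.Cauchy_Schwarz by simp
    also have "\<dots> \<le> C * hnorm H x * hnorm K y" using C that K.hnorm_ge_0 by (intro mult_right_mono) auto
    finally show ?thesis by (simp add: algebra_simps)
  qed
  have "\<exists>u\<in>carrier H. \<forall>x\<in>carrier H. cinner K (T x) y = cinner H x u" if y: "y \<in> carrier K" for y
  proof (rule HH.Riesz_along[OF H H.id_op_bounded, where f="\<lambda>x. cinner K (T x) y" and C="C * hnorm K y"])
    fix u \<sigma> assume "conv_to H (\<lambda>n. id_op H (\<sigma> n)) u"
      "\<And>x. x \<in> carrier H \<Longrightarrow> cinner K (T x) y = cinner H (id_op H x) u"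
    then show "\<exists>u\<in>carrier H. \<forall>x\<in>carrier H. cinner K (T x) y = cinner H x u"
      using H.conv_to_carrier(1) by (intro bexI[of _ u]) auto
  qed (use y T_bound in \<open>simp_all add: K.cinner_rules\<close>)
  then obtain r where r: "\<And>y. y \<in> carrier K \<Longrightarrow> r y \<in> carrier H"
    "\<And>x y. \<lbrakk>x \<in> carrier H; y \<in> carrier K\<rbrakk> \<Longrightarrow> cinner H x (r y) = cinner K (T x) y" by metis
  define R where "R = (\<lambda>y\<in>carrier K. r y)"
  have R: "\<And>y. y \<in> carrier K \<Longrightarrow> R y \<in> carrier H"
    "\<And>x y. \<lbrakk>x \<in> carrier H; y \<in> carrier K\<rbrakk> \<Longrightarrow> cinner H x (R y) = cinner K (T x) y"
    using r by (auto simp: R_def)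
  have "R \<in> bounded_ops K H"
  proof (rule bounded_opsI[where C=C])
    fix x y assume "x \<in> carrier K" "y \<in> carrier K"
    then show "R (x \<oplus>\<^bsub>K\<^esub> y) = R x \<oplus>\<^bsub>H\<^esub> R y"
      using R by (intro H.vec_eqI_right) (auto simp: H.cinner_rules K.cinner_rules)
  next
    fix x c assume "x \<in> carrier K"
    then show "R (c \<odot>\<^bsub>K\<^esub> x) = c \<odot>\<^bsub>H\<^esub> R x"
      using R by (intro H.vec_eqI_right) (auto simp: H.cinner_rules K.cinner_rules)
  next
    fix y assume y: "y \<in> carrier K"
    have "hnorm H (R y) * hnorm H (R y) = cmod (cinner H (R y) (R y))"
      by (simp only: H.cinner_self[OF R(1)[OF y]] norm_of_real) (simp add: power2_eq_square)
    also have "\<dots> \<le> C * hnorm K y * hnorm H (R y)"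
      using y R T_bound[of "R y" y] by simp
    finally have "hnorm H (R y) = 0 \<or> hnorm H (R y) \<le> C * hnorm K y"
      using H.hnorm_ge_0[of "R y"] R(1)[OF y] by (auto simp: mult_le_cancel_right)
    then show "hnorm H (R y) \<le> C * hnorm K y"
      using C(1) K.hnorm_ge_0[OF y] by auto
  qed (use R in \<open>auto simp: R_def\<close>)
  then show ?thesis using R(2) by (intro bexI[of _ R]) auto
qed

context hilbert_space begin

lemma space_pair_self: "space_pair H H" ..

lemma adj_properties:
  assumes T: "T \<in> bounded_ops H H"
  shows adj_bounded: "adj H T \<in> bounded_ops H H"
    and cinner_adj_right: "\<lbrakk>x \<in> carrier H; y \<in> carrier H\<rbrakk> \<Longrightarrow> cinner H x (adj H T y) = cinner H (T x) y"
proof -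
  define P where "P R \<longleftrightarrow> R \<in> bounded_ops H H \<and>
     (\<forall>x\<in>carrier H. \<forall>y\<in>carrier H. cinner H (T x) y = cinner H x (R y))" for R
  obtain R where R: "P R"
    using space_pair.adjoint_exists[OF space_pair_self hilbert_space_axioms T] by (auto simp: P_def)
  have "R' = R" if "P R'" for R'
  proof (rule bounded_ops_eqI)
    fix y assume "y \<in> carrier H"
    then show "R' y = R y"
      using R that bounded_opsD(1)[of R H H] bounded_opsD(1)[of R' H H]
      by (intro vec_eqI_right) (auto simp: P_def)
  qed (use R that in \<open>auto simp: P_def\<close>)
  then have "P (adj H T)" unfolding adj_def P_def[symmetric] using theI[of P R] R by blast
  then show "adj H T \<in> bounded_ops H H"
    "\<lbrakk>x \<in> carrier H; y \<in> carrier H\<rbrakk> \<Longrightarrow> cinner H x (adj H T y) = cinner H (T x) y"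
    by (auto simp: P_def)
qed

lemma cinner_adj_left:
  assumes "T \<in> bounded_ops H H" "x \<in> carrier H" "y \<in> carrier H"
  shows "cinner H (adj H T x) y = cinner H x (T y)"
  using cinner_adj_right[OF assms(1,3,2)] assms adj_bounded bounded_opsD(1)
  by (metis cinner_cnj)

lemma op_comp_bounded:
  "\<lbrakk>A \<in> bounded_ops H H; B \<in> bounded_ops H H\<rbrakk> \<Longrightarrow> op_comp H A B \<in> bounded_ops H H"
  by (intro bounded_ops_compose) (rule complex_inner_space_axioms)+

lemma gram_bounded: "T \<in> bounded_ops H H \<Longrightarrow> gram H T \<in> bounded_ops H H"
  unfolding gram_def by (intro op_comp_bounded adj_bounded)

lemma cinner_gram:
  assumes "T \<in> bounded_ops H H" "x \<in> carrier H" "y \<in> carrier H"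
  shows "cinner H (gram H T x) y = cinner H (T x) (T y)"
  using assms by (simp add: gram_def compose_def cinner_adj_left bounded_opsD(1)[OF assms(1)])

lemma bounded_ops_eq_iff:
  assumes "A \<in> bounded_ops H H" "B \<in> bounded_ops H H"
  shows "A = B \<longleftrightarrow> (\<forall>x\<in>carrier H. \<forall>y\<in>carrier H. cinner H (A x) y = cinner H (B x) y)"
proof
  assume *: "\<forall>x\<in>carrier H. \<forall>y\<in>carrier H. cinner H (A x) y = cinner H (B x) y"
  show "A = B"
    by (rule bounded_ops_eqI[OF assms])
      (use * bounded_opsD(1)[OF assms(1)] bounded_opsD(1)[OF assms(2)] in \<open>auto intro!: vec_eqI\<close>)
qed auto

lemma isometry_iff:
  assumes "V \<in> bounded_ops H H"
  shows "isometry H V \<longleftrightarrow> (\<forall>x\<in>carrier H. \<forall>y\<in>carrier H. cinner H (V x) (V y) = cinner H x y)"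
  using assms unfolding isometry_def
  by (simp add: bounded_ops_eq_iff gram_bounded id_op_bounded cinner_gram)

lemma op_power_gram_bounded:
  assumes "S \<in> bounded_ops H H"
  shows "op_comp H (op_comp H (adj H S) (adj H S)) (op_comp H S S) \<in> bounded_ops H H"
  using assms by (intro op_comp_bounded adj_bounded)

lemma cinner_op_power_gram:
  assumes "S \<in> bounded_ops H H" "x \<in> carrier H" "y \<in> carrier H"
  shows "cinner H (op_comp H (op_comp H (adj H S) (adj H S)) (op_comp H S S) x) y
    = cinner H (S (S x)) (S (S y))"
  using assms bounded_opsD(1)[OF assms(1)] bounded_opsD(1)[OF adj_bounded[OF assms(1)]]
  by (simp add: compose_def cinner_adj_left)

lemma quasi_isometry_iff:
  assumes "S \<in> bounded_ops H H"
  shows "quasi_isometry H S \<longleftrightarrow>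
    (\<forall>x\<in>carrier H. \<forall>y\<in>carrier H. cinner H (S (S x)) (S (S y)) = cinner H (S x) (S y))"
  using assms unfolding quasi_isometry_def
  by (simp add: bounded_ops_eq_iff op_power_gram_bounded gram_bounded cinner_gram cinner_op_power_gram)

lemma op_le_iff:
  assumes "A \<in> bounded_ops H H" "B \<in> bounded_ops H H"
  shows "op_le H A B \<longleftrightarrow> (\<forall>x\<in>carrier H. cinner H (B x) x - cinner H (A x) x \<in> \<real>\<^sub>\<ge>\<^sub>0)"
  using assms op_diff_bounded[OF assms(2,1)] bounded_opsD(1)[OF assms(1)] bounded_opsD(1)[OF assms(2)]
  unfolding op_le_def op_positive_def by (simp add: op_diff_def cinner_minus_left)

lemma quasicontraction_iff:
  assumes "S \<in> bounded_ops H H"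
  shows "quasicontraction H S \<longleftrightarrow> (\<forall>x\<in>carrier H. hnorm H (S (S x)) \<le> hnorm H (S x))"
proof -
  have "cinner H (S x) (S x) - cinner H (S (S x)) (S (S x)) \<in> \<real>\<^sub>\<ge>\<^sub>0
      \<longleftrightarrow> hnorm H (S (S x)) \<le> hnorm H (S x)" if x: "x \<in> carrier H" for x
  proof -
    have S: "S x \<in> carrier H" "S (S x) \<in> carrier H" using bounded_opsD(1)[OF assms] x by auto
    then have "cinner H (S x) (S x) - cinner H (S (S x)) (S (S x))
      = complex_of_real ((hnorm H (S x))\<^sup>2 - (hnorm H (S (S x)))\<^sup>2)" by (simp add: cinner_self)
    then show ?thesis using S hnorm_ge_0
      by (simp only: nonneg_Reals_of_real_iff) (simp add: abs_le_square_iff[symmetric])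
  qed
  then show ?thesis
    using assms unfolding quasicontraction_def
    by (simp add: op_le_iff op_power_gram_bounded gram_bounded cinner_gram cinner_op_power_gram)
qed

end

section \<open>Positive operators and their square roots\<close>

text \<open>
  The square root iteration and the gliding hump both control their increments by those of a convergent
  real sequence; the second conclusion is the explicit estimate of the remainder.
\<close>

lemma (in complex_inner_space) cauchy_inI_majorised:
  assumes \<sigma>: "\<And>n. \<sigma> n \<in> carrier H" and t: "convergent t"
    and le: "\<And>n. hnorm H (\<sigma> (Suc n) \<ominus>\<^bsub>H\<^esub> \<sigma> n) \<le> t (Suc n) - t n"
  shows "cauchy_in H \<sigma>" and "\<And>m n. n \<le> m \<Longrightarrow> hnorm H (\<sigma> m \<ominus>\<^bsub>H\<^esub> \<sigma> n) \<le> t m - t n"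
proof -
  show *: "hnorm H (\<sigma> m \<ominus>\<^bsub>H\<^esub> \<sigma> n) \<le> t m - t n" if "n \<le> m" for m n
    using that
  proof (induction m rule: dec_induct)
    case base
    show ?case using \<sigma> by (simp add: minus_self hnorm_zero)
  next
    case (step m)
    then show ?case using hnorm_minus_triangle[of "\<sigma> (Suc m)" "\<sigma> m" "\<sigma> n"] \<sigma> le[of m] by fastforce
  qed
  show "cauchy_in H \<sigma>"
    unfolding cauchy_in_def
  proof (intro conjI allI impI)
    fix e :: real assume "e > 0"
    then obtain N where N: "\<And>m n. \<lbrakk>N \<le> m; N \<le> n\<rbrakk> \<Longrightarrow> \<bar>t m - t n\<bar> < e"
      using convergent_Cauchy[OF t] unfolding Cauchy_def dist_real_def by metis
    show "\<exists>N. \<forall>m\<ge>N. \<forall>n\<ge>N. hnorm H (\<sigma> m \<ominus>\<^bsub>H\<^esub> \<sigma> n) < e"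
    proof (intro exI[of _ N] allI impI)
      fix m n assume "N \<le> m" "N \<le> n"
      then have "\<bar>t m - t n\<bar> < e" by (rule N)
      then show "hnorm H (\<sigma> m \<ominus>\<^bsub>H\<^esub> \<sigma> n) < e"
        using *[of n m] *[of m n] hnorm_minus_commute[OF \<sigma> \<sigma>, of m n] by (cases "n \<le> m") auto
    qed
  qed (rule \<sigma>)
qed

text \<open>
  If \<open>Y\<close> is a fixed point of \<open>Y \<mapsto> (B + Y\<^sup>2) / 2\<close> then \<open>(I - Y)\<^sup>2 = I - B\<close>. For \<open>\<parallel>B\<parallel> \<le> 1\<close> the iteration started at
  \<open>0\<close> converges in norm, because its increments are dominated by those of the same iteration
  for the real number \<open>B = 1\<close>, which increases to \<open>1\<close>.
\<close>

primrec sqrt_iterate :: "('a, 'm) cspace_scheme \<Rightarrow> ('a \<Rightarrow> 'a) \<Rightarrow> nat \<Rightarrow> 'a \<Rightarrow> 'a" where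
  "sqrt_iterate H B 0 = (\<lambda>x\<in>carrier H. \<zero>\<^bsub>H\<^esub>)"
| "sqrt_iterate H B (Suc n) = (\<lambda>x\<in>carrier H.
     (1/2) \<odot>\<^bsub>H\<^esub> (B x \<oplus>\<^bsub>H\<^esub> sqrt_iterate H B n (sqrt_iterate H B n x)))"

primrec sqrt_majorant :: "nat \<Rightarrow> real" where
  "sqrt_majorant 0 = 0"
| "sqrt_majorant (Suc n) = (1 + (sqrt_majorant n)\<^sup>2) / 2"

lemma sqrt_majorant_bounds: "0 \<le> sqrt_majorant n \<and> sqrt_majorant n \<le> 1"
  by (induction n) (auto simp: power_le_one)

lemma sqrt_majorant_mono: "sqrt_majorant n \<le> sqrt_majorant (Suc n)"
proof -
  have "0 \<le> (1 - sqrt_majorant n)\<^sup>2" by simp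
  then show ?thesis unfolding power2_diff by simp
qed

lemma convergent_sqrt_majorant: "convergent sqrt_majorant"
  using sqrt_majorant_bounds sqrt_majorant_mono
  by (intro Bseq_mono_convergent BseqI'[of _ 1]) (auto simp: abs_le_iff lift_Suc_mono_le intro: order_trans)

context hilbert_space begin

lemma sqrt_iterate_bounded:
  assumes B: "B \<in> bounded_ops H H" and B_le: "\<And>x. x \<in> carrier H \<Longrightarrow> hnorm H (B x) \<le> hnorm H x"
  shows "sqrt_iterate H B n \<in> bounded_ops H H
    \<and> (\<forall>x\<in>carrier H. hnorm H (sqrt_iterate H B n x) \<le> sqrt_majorant n * hnorm H x)"
proof (induction n)
  case 0
  show ?case
    by (auto intro!: bounded_opsI[where C=0] simp: smult_carrier hnorm_zero)
next
  case (Suc n)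
  let ?Y = "sqrt_iterate H B n"
  have Y: "?Y \<in> bounded_ops H H"
    and Y_le: "\<And>x. x \<in> carrier H \<Longrightarrow> hnorm H (?Y x) \<le> sqrt_majorant n * hnorm H x" using Suc by auto
  note [simp] = bounded_opsD[OF Y] bounded_opsD[OF B] smult_carrier
  have le: "hnorm H (sqrt_iterate H B (Suc n) x) \<le> sqrt_majorant (Suc n) * hnorm H x"
    if x: "x \<in> carrier H" for x
  proof -
    have "hnorm H (?Y (?Y x)) \<le> sqrt_majorant n * (sqrt_majorant n * hnorm H x)"
      using Y_le[of "?Y x"] Y_le[OF x] x sqrt_majorant_bounds
      by (meson bounded_opsD(1)[OF Y] mult_left_mono order_trans)
    moreover have "hnorm H (B x \<oplus>\<^bsub>H\<^esub> ?Y (?Y x)) \<le> hnorm H (B x) + hnorm H (?Y (?Y x))"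
      using x by (intro hnorm_triangle) auto
    ultimately show ?thesis
      using x B_le[OF x] by (simp add: hnorm_smult norm_divide power2_eq_square algebra_simps)
  qed
  have "sqrt_iterate H B (Suc n) \<in> bounded_ops H H"
  proof (rule bounded_opsI[where C="sqrt_majorant (Suc n)"])
    fix x y assume "x \<in> carrier H" "y \<in> carrier H"
    then show "sqrt_iterate H B (Suc n) (x \<oplus>\<^bsub>H\<^esub> y)
        = sqrt_iterate H B (Suc n) x \<oplus>\<^bsub>H\<^esub> sqrt_iterate H B (Suc n) y"
      by (intro vec_eqI) (auto simp: cinner_rules algebra_simps)
  next
    fix x c assume "x \<in> carrier H"
    then show "sqrt_iterate H B (Suc n) (c \<odot>\<^bsub>H\<^esub> x) = c \<odot>\<^bsub>H\<^esub> sqrt_iterate H B (Suc n) x"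
      by (intro vec_eqI) (auto simp: cinner_rules algebra_simps)
  qed (use le in auto)
  then show ?case using le by blast
qed

lemma sqrt_iterate_diff:
  assumes B: "B \<in> bounded_ops H H" and B_le: "\<And>x. x \<in> carrier H \<Longrightarrow> hnorm H (B x) \<le> hnorm H x"
    and x: "x \<in> carrier H"
  shows "hnorm H (sqrt_iterate H B (Suc n) x \<ominus>\<^bsub>H\<^esub> sqrt_iterate H B n x)
    \<le> (sqrt_majorant (Suc n) - sqrt_majorant n) * hnorm H x"
  using x
proof (induction n arbitrary: x)
  case 0
  have "(1/2) \<odot>\<^bsub>H\<^esub> (B x \<oplus>\<^bsub>H\<^esub> \<zero>\<^bsub>H\<^esub>) \<ominus>\<^bsub>H\<^esub> \<zero>\<^bsub>H\<^esub> = (1/2) \<odot>\<^bsub>H\<^esub> B x"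
    using 0 bounded_opsD(1)[OF B] by (intro vec_eqI) (auto simp: cinner_rules)
  then show ?case using 0 bounded_opsD(1)[OF B] B_le[OF 0] by (simp add: hnorm_smult norm_divide)
next
  case (Suc n)
  interpret HH: space_pair H H ..
  let ?Y = "sqrt_iterate H B n" and ?Z = "sqrt_iterate H B (Suc n)"
  have YZ: "?Y \<in> bounded_ops H H" "?Z \<in> bounded_ops H H"
    and Z_le: "\<And>x. x \<in> carrier H \<Longrightarrow> hnorm H (?Z x) \<le> sqrt_majorant (Suc n) * hnorm H x"
    and Y_le: "\<And>x. x \<in> carrier H \<Longrightarrow> hnorm H (?Y x) \<le> sqrt_majorant n * hnorm H x"
    using sqrt_iterate_bounded[OF B B_le] by blast+
  note [simp] = bounded_opsD(1)[OF YZ(1)] bounded_opsD(1)[OF YZ(2)] bounded_opsD(1)[OF B] smult_carrier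
  note [simp del] = sqrt_iterate.simps
  define s where "s = sqrt_majorant n"
  define s' where "s' = sqrt_majorant (Suc n)"
  have s: "0 \<le> s" "s \<le> s'" "0 \<le> s'"
    using sqrt_majorant_bounds[of n] sqrt_majorant_mono[of n] unfolding s_def s'_def by linarith+
  let ?u = "?Z (?Z x \<ominus>\<^bsub>H\<^esub> ?Y x)" and ?v = "?Z (?Y x) \<ominus>\<^bsub>H\<^esub> ?Y (?Y x)"
  have "hnorm H ?u \<le> s' * hnorm H (?Z x \<ominus>\<^bsub>H\<^esub> ?Y x)"
    unfolding s'_def by (rule Z_le) (use Suc.prems in simp)
  also have "\<dots> \<le> s' * ((s' - s) * hnorm H x)"
    unfolding s_def s'_def using Suc.IH[OF Suc.prems] s(3)[unfolded s'_def] by (rule mult_left_mono)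
  finally have u_le: "hnorm H ?u \<le> s' * ((s' - s) * hnorm H x)" .
  have "hnorm H ?v \<le> (s' - s) * hnorm H (?Y x)"
    unfolding s_def s'_def by (rule Suc.IH) (use Suc.prems in simp)
  also have "\<dots> \<le> (s' - s) * (s * hnorm H x)"
    using Y_le[OF Suc.prems] s(2) unfolding s_def[symmetric] by (intro mult_left_mono) simp_all
  finally have v_le: "hnorm H ?v \<le> (s' - s) * (s * hnorm H x)" .
  have "sqrt_iterate H B (Suc (Suc n)) x = (1/2) \<odot>\<^bsub>H\<^esub> (B x \<oplus>\<^bsub>H\<^esub> ?Z (?Z x))"
    and "?Z x = (1/2) \<odot>\<^bsub>H\<^esub> (B x \<oplus>\<^bsub>H\<^esub> ?Y (?Y x))"
    using Suc.prems by (simp_all add: sqrt_iterate.simps(2)[of H B "Suc n"] sqrt_iterate.simps(2)[of H B n])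
  moreover have "(1/2) \<odot>\<^bsub>H\<^esub> (B x \<oplus>\<^bsub>H\<^esub> ?Z (?Z x)) \<ominus>\<^bsub>H\<^esub> (1/2) \<odot>\<^bsub>H\<^esub> (B x \<oplus>\<^bsub>H\<^esub> ?Y (?Y x))
      = (1/2) \<odot>\<^bsub>H\<^esub> (?u \<oplus>\<^bsub>H\<^esub> ?v)"
    using Suc.prems by (intro vec_eqI) (auto simp: cinner_rules HH.bounded_ops_minus[OF YZ(2)] algebra_simps)
  ultimately have "hnorm H (sqrt_iterate H B (Suc (Suc n)) x \<ominus>\<^bsub>H\<^esub> ?Z x) = (1/2) * hnorm H (?u \<oplus>\<^bsub>H\<^esub> ?v)"
    using Suc.prems by (simp add: hnorm_smult norm_divide)
  also have "\<dots> \<le> (1/2) * (hnorm H ?u + hnorm H ?v)"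
    using Suc.prems hnorm_triangle[of ?u ?v] by simp
  also have "\<dots> \<le> (1/2) * (s' * ((s' - s) * hnorm H x) + (s' - s) * (s * hnorm H x))"
    using u_le v_le by simp
  finally have "hnorm H (sqrt_iterate H B (Suc (Suc n)) x \<ominus>\<^bsub>H\<^esub> ?Z x)
      \<le> (1/2) * (s' * ((s' - s) * hnorm H x) + (s' - s) * (s * hnorm H x))" .
  also have "\<dots> = (sqrt_majorant (Suc (Suc n)) - sqrt_majorant (Suc n)) * hnorm H x"
    by (simp add: s_def s'_def field_simps power2_eq_square)
  finally show ?case .
qed

lemma sqrt_iterate_limit:
  assumes B: "B \<in> bounded_ops H H" and B_le: "\<And>x. x \<in> carrier H \<Longrightarrow> hnorm H (B x) \<le> hnorm H x"
  shows "\<exists>Y\<in>bounded_ops H H. \<forall>x\<in>carrier H. hnorm H (Y x) \<le> hnorm H x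
    \<and> conv_to H (\<lambda>n. sqrt_iterate H B n x) (Y x)
    \<and> (\<forall>z\<in>carrier H. cinner H (Y (Y x)) z = 2 * cinner H (Y x) z - cinner H (B x) z)"
proof -
  interpret HH: space_pair H H ..
  let ?Y = "sqrt_iterate H B"
  have Yn: "?Y n \<in> bounded_ops H H" for n using sqrt_iterate_bounded[OF B B_le] by blast
  have Yn_le: "hnorm H (?Y n x) \<le> hnorm H x" if x: "x \<in> carrier H" for n x
  proof -
    have "hnorm H (?Y n x) \<le> sqrt_majorant n * hnorm H x" using sqrt_iterate_bounded[OF B B_le] x by blast
    also have "\<dots> \<le> 1 * hnorm H x"
      using sqrt_majorant_bounds[of n] x by (intro mult_right_mono) (auto simp: hnorm_ge_0)
    finally show ?thesis by simp
  qed
  note [simp] = bounded_opsD[OF Yn] bounded_opsD[OF B] smult_carrier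
  note [simp del] = sqrt_iterate.simps
  have "\<exists>y. conv_to H (\<lambda>n. ?Y n x) y" if x: "x \<in> carrier H" for x
  proof -
    have "cauchy_in H (\<lambda>n. ?Y n x)"
    proof (rule cauchy_inI_majorised(1))
      show "convergent (\<lambda>n. sqrt_majorant n * hnorm H x)"
        using convergent_sqrt_majorant convergent_mult[OF _ convergent_const] by blast
    qed (use x sqrt_iterate_diff[OF B B_le] in \<open>auto simp: left_diff_distrib\<close>)
    then show ?thesis by (rule cauchy_conv) blast
  qed
  then obtain L where L: "\<And>x. x \<in> carrier H \<Longrightarrow> conv_to H (\<lambda>n. ?Y n x) (L x)" by metis
  define Y where "Y = (\<lambda>x\<in>carrier H. L x)"
  have conv: "conv_to H (\<lambda>n. ?Y n x) (Y x)" if "x \<in> carrier H" for x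
    using L that by (simp add: Y_def)
  have Y_carrier [simp]: "Y x \<in> carrier H" if "x \<in> carrier H" for x
    using conv[OF that] conv_to_carrier(1) by blast
  have Y_le: "hnorm H (Y x) \<le> hnorm H x" if x: "x \<in> carrier H" for x
    using LIMSEQ_le_const2[OF conv_to_hnorm[OF conv[OF x]]] Yn_le[OF x] by blast
  have Y: "Y \<in> bounded_ops H H"
  proof (rule bounded_opsI[where C=1])
    fix x y assume xy: "x \<in> carrier H" "y \<in> carrier H"
    show "Y (x \<oplus>\<^bsub>H\<^esub> y) = Y x \<oplus>\<^bsub>H\<^esub> Y y"
      using conv_to_unique[OF conv[of "x \<oplus>\<^bsub>H\<^esub> y"]] conv_to_add[OF conv conv, of x y] xy by simp
  next
    fix x c assume x: "x \<in> carrier H"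
    show "Y (c \<odot>\<^bsub>H\<^esub> x) = c \<odot>\<^bsub>H\<^esub> Y x"
      using conv_to_unique[OF conv[of "c \<odot>\<^bsub>H\<^esub> x"]] conv_to_smult[OF conv, of x c] x by simp
  qed (simp_all add: Y_le, simp add: Y_def)
  have YY: "cinner H (Y (Y x)) z = 2 * cinner H (Y x) z - cinner H (B x) z"
    if x: "x \<in> carrier H" and z: "z \<in> carrier H" for x z
  proof -
    have "conv_to H (\<lambda>n. ?Y n (?Y n x)) (Y (Y x))"
    proof (rule conv_toI)
      have "(\<lambda>n. hnorm H (?Y n x \<ominus>\<^bsub>H\<^esub> Y x) + hnorm H (?Y n (Y x) \<ominus>\<^bsub>H\<^esub> Y (Y x))) \<longlonglongrightarrow> 0 + 0"
        using conv[OF x] conv[of "Y x"] x unfolding conv_to_def by (intro tendsto_add) auto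
      then show "(\<lambda>n. hnorm H (?Y n x \<ominus>\<^bsub>H\<^esub> Y x) + hnorm H (?Y n (Y x) \<ominus>\<^bsub>H\<^esub> Y (Y x))) \<longlonglongrightarrow> 0" by simp
      show "hnorm H (?Y n (?Y n x) \<ominus>\<^bsub>H\<^esub> Y (Y x))
          \<le> hnorm H (?Y n x \<ominus>\<^bsub>H\<^esub> Y x) + hnorm H (?Y n (Y x) \<ominus>\<^bsub>H\<^esub> Y (Y x))" for n
        using x hnorm_minus_triangle[of "?Y n (?Y n x)" "?Y n (Y x)" "Y (Y x)"]
          Yn_le[of "?Y n x \<ominus>\<^bsub>H\<^esub> Y x" n] by (simp add: HH.bounded_ops_minus[OF Yn])
    qed (use x in auto)
    moreover have "conv_to H (\<lambda>n. B x) (B x)"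
      using x by (simp add: conv_to_def minus_self hnorm_zero)
    ultimately have "conv_to H (\<lambda>n. (1/2) \<odot>\<^bsub>H\<^esub> (B x \<oplus>\<^bsub>H\<^esub> ?Y n (?Y n x))) ((1/2) \<odot>\<^bsub>H\<^esub> (B x \<oplus>\<^bsub>H\<^esub> Y (Y x)))"
      by (intro conv_to_smult conv_to_add)
    then have "conv_to H (\<lambda>n. ?Y (Suc n) x) ((1/2) \<odot>\<^bsub>H\<^esub> (B x \<oplus>\<^bsub>H\<^esub> Y (Y x)))"
      using x by (simp add: sqrt_iterate.simps)
    moreover have "conv_to H (\<lambda>n. ?Y (Suc n) x) (Y x)"
      using conv[OF x] LIMSEQ_Suc unfolding conv_to_def by auto
    ultimately have "Y x = (1/2) \<odot>\<^bsub>H\<^esub> (B x \<oplus>\<^bsub>H\<^esub> Y (Y x))" using conv_to_unique by blast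
    from arg_cong[OF this, of "\<lambda>u. cinner H u z"] show ?thesis using x z by (simp add: cinner_rules field_simps)
  qed
  show ?thesis by (intro bexI[OF _ Y] ballI conjI Y_le conv YY)
qed

text \<open>Polarisation: a quadratic form with real values comes from a symmetric operator.\<close>

lemma op_positive_symmetric:
  assumes P: "op_positive H P" and x: "x \<in> carrier H" and y: "y \<in> carrier H"
  shows "cinner H (P x) y = cinner H x (P y)"
proof -
  have Pb: "P \<in> bounded_ops H H" and pos: "\<And>x. x \<in> carrier H \<Longrightarrow> cinner H (P x) x \<in> \<real>\<^sub>\<ge>\<^sub>0"
    using P by (auto simp: op_positive_def)
  note [simp] = bounded_opsD[OF Pb] smult_carrier x y
  have im: "Im (cinner H (P u) u) = 0" if "u \<in> carrier H" for u
    using pos[OF that] by (simp add: complex_nonneg_Reals_iff)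
  have "Im (cinner H (P x) y) = - Im (cinner H (P y) x)"
    using im[of "x \<oplus>\<^bsub>H\<^esub> y"] im[of x] im[of y] by (simp add: cinner_rules)
  moreover have "Re (cinner H (P x) y) = Re (cinner H (P y) x)"
    using im[of "x \<oplus>\<^bsub>H\<^esub> \<i> \<odot>\<^bsub>H\<^esub> y"] im[of x] im[of y] by (simp add: cinner_rules)
  ultimately have "cinner H (P x) y = cnj (cinner H (P y) x)" by (simp add: complex_eq_iff)
  then show ?thesis by (simp add: cinner_cnj[symmetric])
qed

text \<open>
  The form of \<open>P\<close> is nonnegative at \<open>x - P x / a\<close>; expanding it there gives the inequality
  \<open>P\<^sup>2 \<le> a P\<close>.
\<close>

lemma op_positive_hnorm_le:
  assumes P: "op_positive H P" and a: "a > 0" "\<And>x. x \<in> carrier H \<Longrightarrow> hnorm H (P x) \<le> a * hnorm H x"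
    and x: "x \<in> carrier H"
  shows "(hnorm H (P x))\<^sup>2 \<le> a * Re (cinner H (P x) x)"
proof -
  have Pb: "P \<in> bounded_ops H H" using P by (simp add: op_positive_def)
  note [simp] = bounded_opsD[OF Pb] smult_carrier x
  define p where "p = (hnorm H (P x))\<^sup>2"
  have pos: "0 \<le> Re (cinner H (P u) u)" if "u \<in> carrier H" for u
    using P that by (auto simp: op_positive_def complex_nonneg_Reals_iff)
  have "Re (cinner H (P (P x)) (P x)) \<le> hnorm H (P (P x)) * hnorm H (P x)"
    using Cauchy_Schwarz[of "P (P x)" "P x"] complex_Re_le_cmod order_trans by auto
  also have "\<dots> \<le> a * p"
    using a(2)[of "P x"] mult_right_mono[OF _ hnorm_ge_0[of "P x"]]
    by (fastforce simp: p_def power2_eq_square mult.assoc)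
  finally have PP: "Re (cinner H (P (P x)) (P x)) \<le> a * p" .
  have sym: "cinner H (P (P x)) x = cinner H (P x) (P x)" using op_positive_symmetric[OF P] by simp
  let ?t = "- (1 / a)"
  have "0 \<le> Re (cinner H (P (x \<oplus>\<^bsub>H\<^esub> complex_of_real ?t \<odot>\<^bsub>H\<^esub> P x)) (x \<oplus>\<^bsub>H\<^esub> complex_of_real ?t \<odot>\<^bsub>H\<^esub> P x))"
    by (intro pos) simp
  also have "\<dots> = Re (cinner H (P x) x) + 2 * ?t * p + ?t\<^sup>2 * Re (cinner H (P (P x)) (P x))"
    by (simp add: cinner_rules sym hnorm_sq[symmetric] cinner_self p_def power2_eq_square algebra_simps)
  also have "\<dots> \<le> Re (cinner H (P x) x) + 2 * ?t * p + ?t\<^sup>2 * (a * p)"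
    using PP by (intro add_left_mono mult_left_mono) auto
  also have "\<dots> = Re (cinner H (P x) x) - p / a" using a(1) by (simp add: field_simps power2_eq_square)
  finally show ?thesis using a(1) by (simp add: p_def field_simps)
qed

text \<open>
  Scaling by the bound \<open>a\<close> makes \<open>B = I - P / a\<close> a contraction, and \<open>R = sqrt a (I - Y)\<close> with the fixed point \<open>Y\<close>
  of the iteration for \<open>B\<close>. Being a limit of polynomials in \<open>P\<close>, the root commutes with everything
  that commutes with \<open>P\<close>; uniqueness rests on this.
\<close>

lemma positive_sqrt_exists:
  assumes P: "op_positive H P"
  shows "\<exists>R. op_positive H R \<and> op_comp H R R = P \<and>
    (\<forall>Z\<in>bounded_ops H H. (\<forall>u\<in>carrier H. Z (P u) = P (Z u)) \<longrightarrow> (\<forall>x\<in>carrier H. Z (R x) = R (Z x)))"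
proof -
  interpret HH: space_pair H H ..
  have Pb: "P \<in> bounded_ops H H" using P by (simp add: op_positive_def)
  obtain a where a: "a > 0" "\<And>x. x \<in> carrier H \<Longrightarrow> hnorm H (P x) \<le> a * hnorm H x"
    using HH.bound_pos[OF Pb] by metis
  note [simp] = bounded_opsD[OF Pb] smult_carrier
  define c where "c = complex_of_real (1 / a)"
  define B where "B = op_diff H (id_op H) (\<lambda>x\<in>carrier H. c \<odot>\<^bsub>H\<^esub> P x)"
  have B_apply: "B x = x \<ominus>\<^bsub>H\<^esub> c \<odot>\<^bsub>H\<^esub> P x" if "x \<in> carrier H" for x
    using that by (simp add: B_def op_diff_def)
  have "(\<lambda>x\<in>carrier H. c \<odot>\<^bsub>H\<^esub> P x) \<in> bounded_ops H H"
  proof (rule bounded_opsI[where C=1])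
    fix x y assume "x \<in> carrier H" "y \<in> carrier H"
    then show "(\<lambda>x\<in>carrier H. c \<odot>\<^bsub>H\<^esub> P x) (x \<oplus>\<^bsub>H\<^esub> y)
        = (\<lambda>x\<in>carrier H. c \<odot>\<^bsub>H\<^esub> P x) x \<oplus>\<^bsub>H\<^esub> (\<lambda>x\<in>carrier H. c \<odot>\<^bsub>H\<^esub> P x) y"
      by (intro vec_eqI) (auto simp: cinner_rules algebra_simps)
  next
    fix x d assume "x \<in> carrier H"
    then show "(\<lambda>x\<in>carrier H. c \<odot>\<^bsub>H\<^esub> P x) (d \<odot>\<^bsub>H\<^esub> x) = d \<odot>\<^bsub>H\<^esub> (\<lambda>x\<in>carrier H. c \<odot>\<^bsub>H\<^esub> P x) x"
      by (intro vec_eqI) (auto simp: cinner_rules)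
  next
    fix x assume "x \<in> carrier H"
    then show "hnorm H ((\<lambda>x\<in>carrier H. c \<odot>\<^bsub>H\<^esub> P x) x) \<le> 1 * hnorm H x"
      using a by (simp add: c_def hnorm_smult norm_divide field_simps)
  qed auto
  then have B: "B \<in> bounded_ops H H" unfolding B_def by (intro op_diff_bounded id_op_bounded)
  have B_le: "hnorm H (B x) \<le> hnorm H x" if x: "x \<in> carrier H" for x
  proof -
    have "(hnorm H (B x))\<^sup>2 = (hnorm H x)\<^sup>2 - 2 / a * Re (cinner H (P x) x) + (1 / a)\<^sup>2 * (hnorm H (P x))\<^sup>2"
      using x a(1) op_positive_symmetric[OF P x x]
      by (simp add: B_apply hnorm_minus_sq hnorm_smult cinner_smult_right c_def norm_divide power_mult_distrib power_divide)
    also have "\<dots> \<le> (hnorm H x)\<^sup>2 - 2 / a * Re (cinner H (P x) x) + (1 / a)\<^sup>2 * (a * Re (cinner H (P x) x))"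
      using op_positive_hnorm_le[OF P a x] by (intro add_left_mono mult_left_mono) auto
    also have "\<dots> = (hnorm H x)\<^sup>2 - Re (cinner H (P x) x) / a"
      using a(1) by (simp add: field_simps power2_eq_square)
    also have "\<dots> \<le> (hnorm H x)\<^sup>2"
      using P x a(1) by (auto simp: op_positive_def complex_nonneg_Reals_iff)
    finally show ?thesis by (rule power2_le_imp_le) (rule hnorm_ge_0[OF x])
  qed
  obtain Y where Yb: "Y \<in> bounded_ops H H"
    and Y: "\<forall>x\<in>carrier H. hnorm H (Y x) \<le> hnorm H x
      \<and> conv_to H (\<lambda>n. sqrt_iterate H B n x) (Y x)
      \<and> (\<forall>z\<in>carrier H. cinner H (Y (Y x)) z = 2 * cinner H (Y x) z - cinner H (B x) z)"
    using sqrt_iterate_limit[OF B B_le] ..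
  have Y_le: "hnorm H (Y x) \<le> hnorm H x"
    and Y_lim: "conv_to H (\<lambda>n. sqrt_iterate H B n x) (Y x)" if "x \<in> carrier H" for x
    using Y that by auto
  have YY: "cinner H (Y (Y x)) z = 2 * cinner H (Y x) z - cinner H (B x) z"
    if "x \<in> carrier H" "z \<in> carrier H" for x z
    using Y that by auto
  have Yn: "sqrt_iterate H B n \<in> bounded_ops H H" for n using sqrt_iterate_bounded[OF B B_le] by blast
  note [simp] = bounded_opsD[OF B] bounded_opsD[OF Yb] bounded_opsD(1)[OF Yn]
  have B_sym: "cinner H (B x) y = cinner H x (B y)" if "x \<in> carrier H" "y \<in> carrier H" for x y
    using that op_positive_symmetric[OF P that] by (simp add: B_apply cinner_rules c_def)
  have Yn_sym: "cinner H (sqrt_iterate H B n x) y = cinner H x (sqrt_iterate H B n y)"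
    if "x \<in> carrier H" "y \<in> carrier H" for x y n
    using that
  proof (induction n arbitrary: x y)
    case (Suc n)
    then show ?case by (simp add: cinner_rules B_sym)
  qed (simp add: cinner_rules)
  have Y_sym: "cinner H (Y x) y = cinner H x (Y y)" if "x \<in> carrier H" "y \<in> carrier H" for x y
    using LIMSEQ_unique[OF conv_to_cinner[OF Y_lim[of x], of y]] conv_to_cinner_right[OF Y_lim[of y], of x] that
    by (simp add: Yn_sym)
  define r where "r = complex_of_real (sqrt a)"
  have rr: "r * r = complex_of_real a"
    unfolding r_def of_real_mult[symmetric] using a(1) by simp
  define R where "R = (\<lambda>x\<in>carrier H. r \<odot>\<^bsub>H\<^esub> (x \<ominus>\<^bsub>H\<^esub> Y x))"
  have Rb: "R \<in> bounded_ops H H"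
  proof (rule bounded_opsI[where C="sqrt a * 2"])
    fix x y assume "x \<in> carrier H" "y \<in> carrier H"
    then show "R (x \<oplus>\<^bsub>H\<^esub> y) = R x \<oplus>\<^bsub>H\<^esub> R y"
      by (intro vec_eqI) (auto simp: R_def cinner_rules algebra_simps)
  next
    fix x d assume "x \<in> carrier H"
    then show "R (d \<odot>\<^bsub>H\<^esub> x) = d \<odot>\<^bsub>H\<^esub> R x"
      by (intro vec_eqI) (auto simp: R_def cinner_rules algebra_simps)
  next
    fix x assume x: "x \<in> carrier H"
    then show "hnorm H (R x) \<le> sqrt a * 2 * hnorm H x"
      using hnorm_minus_le[of x "Y x"] Y_le[of x] a(1) by (simp add: R_def r_def hnorm_smult)
  qed (auto simp: R_def)
  have "cinner H (R x) x \<in> \<real>\<^sub>\<ge>\<^sub>0" if x: "x \<in> carrier H" for x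
  proof -
    have "Im (cinner H (Y x) x) = 0"
      using Y_sym[OF x x] cinner_cnj[of "Y x" x] x by (simp add: complex_eq_iff)
    moreover have "Re (cinner H (Y x) x) \<le> (hnorm H x)\<^sup>2"
    proof -
      have "Re (cinner H (Y x) x) \<le> hnorm H (Y x) * hnorm H x"
        using Cauchy_Schwarz[of "Y x" x] complex_Re_le_cmod order_trans x by auto
      also have "\<dots> \<le> hnorm H x * hnorm H x" using Y_le[OF x] hnorm_ge_0[OF x] by (rule mult_right_mono)
      finally show ?thesis by (simp add: power2_eq_square)
    qed
    ultimately show ?thesis
      using x a(1) by (simp add: R_def r_def cinner_rules cinner_self complex_nonneg_Reals_iff)
  qed
  then have Rp: "op_positive H R" using Rb by (simp add: op_positive_def)
  have RR: "op_comp H R R = P"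
  proof (rule bounded_ops_eqI[OF op_comp_bounded[OF Rb Rb] Pb])
    fix x assume x: "x \<in> carrier H"
    have "r \<odot>\<^bsub>H\<^esub> (r \<odot>\<^bsub>H\<^esub> (x \<ominus>\<^bsub>H\<^esub> Y x) \<ominus>\<^bsub>H\<^esub> Y (r \<odot>\<^bsub>H\<^esub> (x \<ominus>\<^bsub>H\<^esub> Y x))) = P x"
    proof (rule vec_eqI)
      fix z assume z: "z \<in> carrier H"
      have "cinner H (r \<odot>\<^bsub>H\<^esub> (r \<odot>\<^bsub>H\<^esub> (x \<ominus>\<^bsub>H\<^esub> Y x) \<ominus>\<^bsub>H\<^esub> Y (r \<odot>\<^bsub>H\<^esub> (x \<ominus>\<^bsub>H\<^esub> Y x)))) z
          = (r * r) * (cinner H x z - 2 * cinner H (Y x) z + cinner H (Y (Y x)) z)"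
        using x z by (simp add: cinner_rules HH.bounded_ops_minus[OF Yb] algebra_simps)
      also have "\<dots> = complex_of_real a * (c * cinner H (P x) z)"
        using x z by (simp add: YY rr B_apply cinner_rules)
      also have "\<dots> = cinner H (P x) z" using a(1) by (simp add: c_def)
      finally show "cinner H (r \<odot>\<^bsub>H\<^esub> (r \<odot>\<^bsub>H\<^esub> (x \<ominus>\<^bsub>H\<^esub> Y x) \<ominus>\<^bsub>H\<^esub> Y (r \<odot>\<^bsub>H\<^esub> (x \<ominus>\<^bsub>H\<^esub> Y x)))) z = cinner H (P x) z" .
    qed (use x in auto)
    then show "op_comp H R R x = P x" using x by (simp add: compose_def R_def)
  qed
  have comm: "Z (R x) = R (Z x)"
    if Z: "Z \<in> bounded_ops H H" and ZP: "\<And>u. u \<in> carrier H \<Longrightarrow> Z (P u) = P (Z u)" and x: "x \<in> carrier H" for Z x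
  proof -
    note [simp] = bounded_opsD[OF Z]
    have ZB: "Z (B u) = B (Z u)" if "u \<in> carrier H" for u
      using that by (simp add: B_apply HH.bounded_ops_minus[OF Z] ZP)
    have ZYn: "Z (sqrt_iterate H B n u) = sqrt_iterate H B n (Z u)" if "u \<in> carrier H" for n u
      using that
    proof (induction n arbitrary: u)
      case (Suc n)
      then show ?case by (simp add: ZB)
    qed (simp add: HH.bounded_ops_zero[OF Z])
    have "conv_to H (\<lambda>n. Z (sqrt_iterate H B n x)) (Z (Y x))"
      using HH.bounded_ops_conv_to[OF Z Y_lim[OF x]] .
    then have "Z (Y x) = Y (Z x)"
      using Y_lim[of "Z x"] conv_to_unique x by (simp add: ZYn)
    then show ?thesis using x by (simp add: R_def HH.bounded_ops_minus[OF Z])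
  qed
  show ?thesis
    using Rp RR comm by (intro exI[of _ R] conjI ballI impI) simp_all
qed

lemma positive_kernel:
  assumes P: "op_positive H P" and x: "x \<in> carrier H" and 0: "cinner H (P x) x = 0"
  shows "P x = \<zero>\<^bsub>H\<^esub>"
proof -
  interpret HH: space_pair H H ..
  have Pb: "P \<in> bounded_ops H H" using P by (simp add: op_positive_def)
  obtain a where a: "a > 0" "\<And>x. x \<in> carrier H \<Longrightarrow> hnorm H (P x) \<le> a * hnorm H x"
    using HH.bound_pos[OF Pb] by metis
  have "(hnorm H (P x))\<^sup>2 \<le> 0" using op_positive_hnorm_le[OF P a x] 0 by simp
  then show ?thesis using hnorm_eq_0_iff bounded_opsD(1)[OF Pb x] by simp
qed

text \<open>
  Two positive roots \<open>R\<close>, \<open>Q\<close> of \<open>P\<close> that commute satisfy \<open>(R + Q) (R - Q) = 0\<close>; positivity makes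
  both \<open>R\<close> and \<open>Q\<close> vanish on the range of \<open>R - Q\<close>, hence \<open>(R - Q)\<^sup>2 = 0\<close>.
\<close>

lemma op_sqrt_properties:
  assumes P: "op_positive H P"
  shows op_sqrt_positive: "op_positive H (op_sqrt H P)"
    and op_sqrt_square: "op_comp H (op_sqrt H P) (op_sqrt H P) = P"
proof -
  interpret HH: space_pair H H ..
  obtain R where R: "op_positive H R" "op_comp H R R = P"
    and comm: "\<forall>Z\<in>bounded_ops H H. (\<forall>u\<in>carrier H. Z (P u) = P (Z u)) \<longrightarrow> (\<forall>x\<in>carrier H. Z (R x) = R (Z x))"
    using positive_sqrt_exists[OF P] by blast
  have Rb: "R \<in> bounded_ops H H" and Pb: "P \<in> bounded_ops H H"
    using R P by (simp_all add: op_positive_def)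
  have "Q = R" if Q: "op_positive H Q" "op_comp H Q Q = P" for Q
  proof (rule bounded_ops_eqI)
    show Qb: "Q \<in> bounded_ops H H" using Q by (simp add: op_positive_def)
    note [simp] = bounded_opsD[OF Rb] bounded_opsD[OF Qb] smult_carrier
      HH.bounded_ops_minus[OF Rb] HH.bounded_ops_minus[OF Qb] bounded_opsD(1)[OF Pb]
    have PQ: "Q (Q u) = P u" and PR: "R (R u) = P u" if "u \<in> carrier H" for u
      using fun_cong[OF Q(2), of u] fun_cong[OF R(2), of u] that by (simp_all add: compose_def)
    have QR: "Q (R u) = R (Q u)" if "u \<in> carrier H" for u
      using comm Qb that by (simp add: PQ[symmetric])
    fix x assume x: "x \<in> carrier H"
    define y where "y = R x \<ominus>\<^bsub>H\<^esub> Q x"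
    have y: "y \<in> carrier H" using x by (simp add: y_def)
    have "cinner H (R y) y + cinner H (Q y) y = 0"
      using x y by (simp add: y_def cinner_rules PQ PR QR)
    moreover have "cinner H (R y) y \<in> \<real>\<^sub>\<ge>\<^sub>0" "cinner H (Q y) y \<in> \<real>\<^sub>\<ge>\<^sub>0"
      using R(1) Q(1) y by (auto simp: op_positive_def)
    ultimately have "cinner H (R y) y = 0" "cinner H (Q y) y = 0"
      by (auto simp: complex_nonneg_Reals_iff complex_eq_iff)
    then have "R y = \<zero>\<^bsub>H\<^esub>" "Q y = \<zero>\<^bsub>H\<^esub>"
      using positive_kernel[OF R(1) y] positive_kernel[OF Q(1) y] by simp_all
    moreover have "cinner H y y = cinner H x (R y) - cinner H x (Q y)"
      using op_positive_symmetric[OF R(1) x y] op_positive_symmetric[OF Q(1) x y] x y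
      by (simp add: y_def cinner_minus_left)
    ultimately have "y = \<zero>\<^bsub>H\<^esub>" using x y cinner_eq_zero_iff by (simp add: cinner_zero_right)
    then show "Q x = R x" using x minus_eq_zeroD[of "R x" "Q x"] by (simp add: y_def)
  qed (rule Rb)
  then have "op_positive H (op_sqrt H P) \<and> op_comp H (op_sqrt H P) (op_sqrt H P) = P"
    unfolding op_sqrt_def using R theI[of "\<lambda>B. op_positive H B \<and> op_comp H B B = P" R] by blast
  then show "op_positive H (op_sqrt H P)" "op_comp H (op_sqrt H P) (op_sqrt H P) = P" by auto
qed

lemma cinner_op_sqrt:
  assumes P: "op_positive H P" and x: "x \<in> carrier H" and y: "y \<in> carrier H"
  shows "cinner H (op_sqrt H P x) (op_sqrt H P y) = cinner H (P x) y"
proof -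
  let ?R = "op_sqrt H P"
  have R: "?R \<in> bounded_ops H H" using op_sqrt_positive[OF P] by (simp add: op_positive_def)
  have "cinner H (?R x) (?R y) = cinner H (?R (?R x)) y"
    using op_positive_symmetric[OF op_sqrt_positive[OF P], of "?R x" y] bounded_opsD(1)[OF R] x y by simp
  also have "?R (?R x) = P x"
    using fun_cong[OF op_sqrt_square[OF P], of x] x by (simp add: compose_def)
  finally show ?thesis .
qed

end

section \<open>Range inclusion and majorisation\<close>

text \<open>
  The vector \<open>h\<close> is the sum of the series of \<open>\<plusminus> e\<^sub>n / 3\<^sup>n\<close>, with signs chosen so that the \<open>n\<close>-th summand
  moves the real part of the inner product with \<open>e\<^sub>n\<close> away from \<open>0\<close>, by \<open>1 / 3\<^sup>n\<close>. All later summands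
  together contribute at most half of this.
\<close>

lemma (in hilbert_space) gliding_hump:
  assumes e: "\<And>n. e n \<in> carrier H" "\<And>n. hnorm H (e n) = 1"
  obtains h where "h \<in> carrier H" "\<And>n. (1/2) * (1/3) ^ n \<le> cmod (cinner H h (e n))"
proof -
  define s :: "nat \<Rightarrow> 'a \<Rightarrow> real" where "s n u = (if 0 \<le> Re (cinner H u (e n)) then 1 else -1)" for n u
  define \<sigma> where "\<sigma> = rec_nat \<zero>\<^bsub>H\<^esub> (\<lambda>n u. u \<oplus>\<^bsub>H\<^esub> complex_of_real (s n u * (1/3) ^ n) \<odot>\<^bsub>H\<^esub> e n)"
  have \<sigma>_Suc: "\<sigma> (Suc n) = \<sigma> n \<oplus>\<^bsub>H\<^esub> complex_of_real (s n (\<sigma> n) * (1/3) ^ n) \<odot>\<^bsub>H\<^esub> e n" for n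
    by (simp add: \<sigma>_def)
  have \<sigma>: "\<sigma> n \<in> carrier H" for n
    by (induction n) (use e in \<open>auto simp: \<sigma>_Suc smult_carrier\<close>, simp add: \<sigma>_def)
  \<comment> \<open>The partial sums of \<open>1 + 1/3 + 1/9 + ...\<close>; their increments bound those of \<open>\<sigma>\<close>.\<close>
  define t :: "nat \<Rightarrow> real" where "t n = (3/2) * (1 - (1/3) ^ n)" for n
  have "convergent t"
    unfolding t_def by (rule convergentI[of _ "(3/2) * (1 - 0)"]) (intro tendsto_intros LIMSEQ_power_zero, simp)
  moreover have "hnorm H (\<sigma> (Suc n) \<ominus>\<^bsub>H\<^esub> \<sigma> n) \<le> t (Suc n) - t n" for n
  proof -
    have "\<sigma> (Suc n) \<ominus>\<^bsub>H\<^esub> \<sigma> n = complex_of_real (s n (\<sigma> n) * (1/3) ^ n) \<odot>\<^bsub>H\<^esub> e n"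
      unfolding \<sigma>_Suc using \<sigma> e by (intro vec_eqI) (auto simp: cinner_rules)
    then have "hnorm H (\<sigma> (Suc n) \<ominus>\<^bsub>H\<^esub> \<sigma> n) = (1/3) ^ n"
      using e by (simp add: hnorm_smult norm_mult norm_power s_def norm_divide)
    then show ?thesis by (simp add: t_def field_simps)
  qed
  ultimately have Cauchy: "cauchy_in H \<sigma>"
    and tail: "\<And>m n. n \<le> m \<Longrightarrow> hnorm H (\<sigma> m \<ominus>\<^bsub>H\<^esub> \<sigma> n) \<le> t m - t n"
    using cauchy_inI_majorised[of \<sigma> t] \<sigma> by simp_all
  obtain h where h: "conv_to H \<sigma> h" by (rule cauchy_conv[OF Cauchy])
  have big: "(1/2) * (1/3) ^ n \<le> cmod (cinner H (\<sigma> m) (e n))" if "Suc n \<le> m" for n m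
  proof -
    have *: "complex_of_real (s n (\<sigma> n)) * cinner H (\<sigma> (Suc n)) (e n)
        = complex_of_real (s n (\<sigma> n)) * cinner H (\<sigma> n) (e n) + complex_of_real ((1/3) ^ n)"
      unfolding \<sigma>_Suc using \<sigma> e by (simp add: cinner_rules cinner_self s_def)
    have "(1/3) ^ n \<le> Re (complex_of_real (s n (\<sigma> n)) * cinner H (\<sigma> (Suc n)) (e n))"
      unfolding * by (simp add: s_def)
    also have "\<dots> \<le> cmod (complex_of_real (s n (\<sigma> n)) * cinner H (\<sigma> (Suc n)) (e n))"
      by (rule complex_Re_le_cmod)
    also have "\<dots> = cmod (cinner H (\<sigma> (Suc n)) (e n))" by (simp add: norm_mult s_def)
    finally have 1: "(1/3) ^ n \<le> cmod (cinner H (\<sigma> (Suc n)) (e n))" .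
    have "cmod (cinner H (\<sigma> m) (e n) - cinner H (\<sigma> (Suc n)) (e n)) = cmod (cinner H (\<sigma> m \<ominus>\<^bsub>H\<^esub> \<sigma> (Suc n)) (e n))"
      using \<sigma> e by (simp add: cinner_rules)
    also have "\<dots> \<le> hnorm H (\<sigma> m \<ominus>\<^bsub>H\<^esub> \<sigma> (Suc n))"
      using Cauchy_Schwarz[of "\<sigma> m \<ominus>\<^bsub>H\<^esub> \<sigma> (Suc n)" "e n"] \<sigma> e by simp
    also have "\<dots> \<le> t m - t (Suc n)" by (rule tail[OF that])
    also have "\<dots> \<le> (1/2) * (1/3) ^ n"
      using zero_le_power[of "1/3 :: real" m] unfolding t_def power_Suc by (simp add: field_simps)
    finally have "cmod (cinner H (\<sigma> m) (e n) - cinner H (\<sigma> (Suc n)) (e n)) \<le> (1/2) * (1/3) ^ n" .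
    then show ?thesis
      using 1 norm_triangle_ineq3[of "cinner H (\<sigma> m) (e n)" "cinner H (\<sigma> (Suc n)) (e n)"] by linarith
  qed
  have "(1/2) * (1/3) ^ n \<le> cmod (cinner H h (e n))" for n
    by (rule LIMSEQ_le_const[OF tendsto_norm[OF conv_to_cinner[OF h e(1)]]]) (use big in blast)
  then show ?thesis using that conv_to_carrier(1)[OF h] by blast
qed

locale positive_pair = hilbert_space H for H :: "('a, 'm) cspace_scheme" +
  fixes R Q :: "'a \<Rightarrow> 'a"
  assumes R: "op_positive H R" and Q: "op_positive H Q"
begin

lemma R_bounded: "R \<in> bounded_ops H H" and Q_bounded: "Q \<in> bounded_ops H H"
  using R Q by (auto simp: op_positive_def)

lemmas RQ_simps = bounded_opsD[OF R_bounded] bounded_opsD[OF Q_bounded]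

lemmas R_sym = op_positive_symmetric[OF R] and Q_sym = op_positive_symmetric[OF Q]

text \<open>
  If no bound exists there are \<open>x\<^sub>n\<close> with \<open>\<parallel>Q x\<^sub>n\<parallel> > 4\<^sup>n \<parallel>R x\<^sub>n\<parallel>\<close>. A vector \<open>h\<close> whose inner products with the
  directions of \<open>Q x\<^sub>n\<close> are at least of order \<open>3\<^sup>-\<^sup>n\<close> cannot satisfy \<open>Q h = R y\<close>, since this
  would bound these products by \<open>\<parallel>y\<parallel> 4\<^sup>-\<^sup>n\<close>.
\<close>

lemma range_subset_imp_bound:
  assumes sub: "op_range H Q \<subseteq> op_range H R"
  obtains c where "c > 0" "\<And>x. x \<in> carrier H \<Longrightarrow> hnorm H (Q x) \<le> c * hnorm H (R x)"
proof (rule ccontr)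
  assume no: "\<not> thesis"
  note [simp] = RQ_simps smult_carrier
  have "\<exists>x\<in>carrier H. 4 ^ n * hnorm H (R x) < hnorm H (Q x)" for n :: nat
    using no that[of "4 ^ n"] by (meson not_le zero_less_numeral zero_less_power)
  then obtain x where x: "\<And>n. x n \<in> carrier H" "\<And>n::nat. 4 ^ n * hnorm H (R (x n)) < hnorm H (Q (x n))" by metis
  define q where "q n = hnorm H (Q (x n))" for n
  have q: "q n > 0" for n
  proof -
    have "0 \<le> 4 ^ n * hnorm H (R (x n))" using x(1) by (intro mult_nonneg_nonneg) (auto simp: hnorm_ge_0)
    then show ?thesis using x(2)[of n] by (simp add: q_def)
  qed
  define e where "e n = complex_of_real (1 / q n) \<odot>\<^bsub>H\<^esub> Q (x n)" for n
  have e: "e n \<in> carrier H" "hnorm H (e n) = 1" for n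
    using x(1)[of n] q[of n] by (auto simp: e_def hnorm_smult q_def norm_divide)
  obtain h where h: "h \<in> carrier H" "\<And>n. (1/2) * (1/3) ^ n \<le> cmod (cinner H h (e n))"
    using gliding_hump[of e, OF e] by blast
  obtain y where y: "y \<in> carrier H" "Q h = R y" using sub h(1) by auto
  have "(4/3) ^ n \<le> 2 * hnorm H y" for n :: nat
  proof -
    have "cinner H h (e n) = complex_of_real (1 / q n) * cinner H y (R (x n))"
      using x(1)[of n] h(1) y Q_sym[of h "x n"] R_sym[of y "x n"] by (simp add: e_def cinner_smult_right)
    then have "cmod (cinner H h (e n)) = cmod (cinner H y (R (x n))) / q n"
      using q[of n] by (simp add: norm_mult norm_divide)
    also have "\<dots> \<le> hnorm H y * hnorm H (R (x n)) / q n"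
      using Cauchy_Schwarz[of y "R (x n)"] x(1) y q[of n] by (intro divide_right_mono) auto
    also have "\<dots> \<le> hnorm H y * (q n / 4 ^ n) / q n"
      using x(2)[of n] q[of n] hnorm_ge_0[OF y(1)]
      by (intro divide_right_mono mult_left_mono) (auto simp: q_def field_simps)
    also have "\<dots> = hnorm H y / 4 ^ n" using q[of n] by simp
    finally have "(1/2) * (1/3) ^ n \<le> hnorm H y / 4 ^ n" using h(2)[of n] by linarith
    then show ?thesis by (simp add: field_simps power_divide)
  qed
  moreover obtain n where "2 * hnorm H y < (4/3) ^ n" using real_arch_pow[of "4/3" "2 * hnorm H y"] by auto
  ultimately show False by (meson not_le)
qed

text \<open>
  The functional \<open>R x \<mapsto> \<langle>Q x, h\<rangle>\<close> is bounded on the range of \<open>R\<close>. The representing vector is taken in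
  the closure of that range, which makes it orthogonal to the kernel of \<open>R\<close>.
\<close>

lemma bound_imp_Riesz:
  assumes c0: "0 \<le> c" and c: "\<And>x. x \<in> carrier H \<Longrightarrow> hnorm H (Q x) \<le> c * hnorm H (R x)" and h: "h \<in> carrier H"
  shows "\<exists>y\<in>carrier H. (\<forall>x\<in>carrier H. cinner H (R x) y = cinner H (Q x) h) \<and>
    (\<forall>v\<in>carrier H. R v = \<zero>\<^bsub>H\<^esub> \<longrightarrow> cinner H v y = 0) \<and> hnorm H y \<le> c * hnorm H h"
proof -
  note [simp] = RQ_simps smult_carrier
  have le: "cmod (cinner H (Q x) h) \<le> c * hnorm H h * hnorm H (R x)" if x: "x \<in> carrier H" for x
  proof -
    have "cmod (cinner H (Q x) h) \<le> hnorm H (Q x) * hnorm H h" using Cauchy_Schwarz x h by simp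
    also have "\<dots> \<le> c * hnorm H (R x) * hnorm H h" using c[OF x] h by (intro mult_right_mono) (auto simp: hnorm_ge_0)
    finally show ?thesis by (simp add: algebra_simps)
  qed
  show ?thesis
  proof (rule space_pair.Riesz_along[OF space_pair_self hilbert_space_axioms R_bounded,
        where f="\<lambda>x. cinner H (Q x) h" and C="c * hnorm H h"])
    fix y \<sigma>
    assume \<sigma>: "\<And>n::nat. \<sigma> n \<in> carrier H" and y: "conv_to H (\<lambda>n. R (\<sigma> n)) y"
      and f: "\<And>x. x \<in> carrier H \<Longrightarrow> cinner H (Q x) h = cinner H (R x) y"
    note yc = conv_to_carrier(1)[OF y]
    show "\<exists>y\<in>carrier H. (\<forall>x\<in>carrier H. cinner H (R x) y = cinner H (Q x) h) \<and>
      (\<forall>v\<in>carrier H. R v = \<zero>\<^bsub>H\<^esub> \<longrightarrow> cinner H v y = 0) \<and> hnorm H y \<le> c * hnorm H h"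
    proof (intro bexI[OF _ yc] conjI ballI impI)
      show "cinner H (R x) y = cinner H (Q x) h" if "x \<in> carrier H" for x using f[OF that] by simp
    next
      fix v assume v: "v \<in> carrier H" "R v = \<zero>\<^bsub>H\<^esub>"
      then have "cinner H v (R (\<sigma> n)) = 0" for n
        using R_sym[OF v(1) \<sigma>, of n] cinner_zero_left[OF \<sigma>, of n] by simp
      then show "cinner H v y = 0"
        using conv_to_cinner_right[OF y v(1)] by (simp add: LIMSEQ_const_iff)
    next
      have 1: "(\<lambda>n. cmod (cinner H (R (\<sigma> n)) y)) \<longlonglongrightarrow> cmod (cinner H y y)"
        by (intro tendsto_norm conv_to_cinner[OF y yc])
      have 2: "(\<lambda>n. c * hnorm H h * hnorm H (R (\<sigma> n))) \<longlonglongrightarrow> c * hnorm H h * hnorm H y"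
        by (intro tendsto_mult_left conv_to_hnorm y)
      have "cmod (cinner H y y) \<le> c * hnorm H h * hnorm H y"
        by (rule LIMSEQ_le[OF 1 2]) (use le[OF \<sigma>] f[OF \<sigma>] in auto)
      then have "hnorm H y * hnorm H y \<le> c * hnorm H h * hnorm H y"
        by (simp only: cinner_self[OF yc] norm_of_real) (simp add: power2_eq_square)
      then show "hnorm H y \<le> c * hnorm H h"
        using hnorm_ge_0[OF yc] c0 hnorm_ge_0[OF h]
        by (cases "hnorm H y = 0") (auto simp: mult_le_cancel_right)
    qed
  next
    fix x y assume "x \<in> carrier H" "y \<in> carrier H"
    then show "cinner H (Q (x \<oplus>\<^bsub>H\<^esub> y)) h = cinner H (Q x) h + cinner H (Q y) h"
      using h by (simp add: cinner_add)
  next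
    fix x d assume x: "x \<in> carrier H"
    show "cinner H (Q (d \<odot>\<^bsub>H\<^esub> x)) h = d * cinner H (Q x) h"
      unfolding RQ_simps(6)[OF x] by (rule cinner_smult[OF RQ_simps(4)[OF x] h])
  next
    fix x assume x: "x \<in> carrier H"
    show "cmod (cinner H (Q x) h) \<le> c * hnorm H h * hnorm H (R x)" by (rule le[OF x])
  qed
qed

lemma bound_imp_range_subset:
  assumes "0 \<le> c" "\<And>x. x \<in> carrier H \<Longrightarrow> hnorm H (Q x) \<le> c * hnorm H (R x)"
  shows "op_range H Q \<subseteq> op_range H R"
proof clarify
  fix h assume h: "h \<in> carrier H"
  obtain y where y: "y \<in> carrier H" and "(\<forall>x\<in>carrier H. cinner H (R x) y = cinner H (Q x) h) \<and>
    (\<forall>v\<in>carrier H. R v = \<zero>\<^bsub>H\<^esub> \<longrightarrow> cinner H v y = 0) \<and> hnorm H y \<le> c * hnorm H h"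
    using bound_imp_Riesz[OF assms h] ..
  then have Ry: "\<And>x. x \<in> carrier H \<Longrightarrow> cinner H (R x) y = cinner H (Q x) h" by simp
  have "Q h = R y"
  proof (rule vec_eqI_right)
    fix z assume z: "z \<in> carrier H"
    show "cinner H z (Q h) = cinner H z (R y)"
      using Ry[OF z] Q_sym[OF z h] R_sym[OF z y] by simp
  qed (rule RQ_simps(4)[OF h] RQ_simps(1)[OF y])+
  then show "Q h \<in> op_range H R" using y by blast
qed

text \<open>
  The range of the symmetric operator \<open>R\<close> and its kernel span a dense subspace: a vector orthogonal
  to the range lies in the kernel.
\<close>

lemma vec_eq_on_range_and_kernel:
  assumes u: "u \<in> carrier H" and w: "w \<in> carrier H"
    and ran: "\<And>x. x \<in> carrier H \<Longrightarrow> cinner H (R x) u = cinner H (R x) w"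
    and ker: "\<And>v. \<lbrakk>v \<in> carrier H; R v = \<zero>\<^bsub>H\<^esub>\<rbrakk> \<Longrightarrow> cinner H v u = cinner H v w"
  shows "u = w"
proof -
  define d where "d = u \<ominus>\<^bsub>H\<^esub> w"
  have d: "d \<in> carrier H" using u w by (simp add: d_def)
  have "R d = \<zero>\<^bsub>H\<^esub>"
  proof (rule vec_eqI_right)
    fix z assume z: "z \<in> carrier H"
    have "cinner H z (R d) = cinner H (R z) d" using R_sym[OF z d] by simp
    also have "\<dots> = 0" using ran[OF z] RQ_simps(1)[OF z] u w by (simp add: d_def cinner_minus_right)
    finally show "cinner H z (R d) = cinner H z \<zero>\<^bsub>H\<^esub>" using z by (simp add: cinner_zero_right)
  qed (simp_all add: RQ_simps(1) d)
  then have "cinner H d u = cinner H d w" by (rule ker[OF d])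
  then have "cinner H d d = 0" unfolding d_def using d[unfolded d_def] u w by (simp add: cinner_minus_right)
  then have "d = \<zero>\<^bsub>H\<^esub>" using d cinner_eq_zero_iff by simp
  then show ?thesis using u w minus_eq_zeroD by (simp add: d_def)
qed

lemma eq_on_range_and_kernel:
  assumes C: "C \<in> bounded_ops H H" and D: "D \<in> bounded_ops H H"
    and ran: "\<And>x. x \<in> carrier H \<Longrightarrow> C (R x) = D (R x)"
    and ker: "\<And>v. \<lbrakk>v \<in> carrier H; R v = \<zero>\<^bsub>H\<^esub>\<rbrakk> \<Longrightarrow> C v = D v"
  shows "C = D"
proof (rule bounded_ops_eqI[OF C D])
  fix x assume x: "x \<in> carrier H"
  note C' = bounded_opsD(1)[OF C] bounded_opsD(1)[OF adj_bounded[OF C]] cinner_adj_right[OF C]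
  note D' = bounded_opsD(1)[OF D] bounded_opsD(1)[OF adj_bounded[OF D]] cinner_adj_right[OF D]
  show "C x = D x"
  proof (rule vec_eqI)
    fix z assume z: "z \<in> carrier H"
    have "adj H C z = adj H D z"
    proof (rule vec_eq_on_range_and_kernel)
      fix u assume u: "u \<in> carrier H"
      show "cinner H (R u) (adj H C z) = cinner H (R u) (adj H D z)"
        using C'(3)[OF RQ_simps(1)[OF u] z] D'(3)[OF RQ_simps(1)[OF u] z] ran[OF u] by simp
    next
      fix v assume v: "v \<in> carrier H" "R v = \<zero>\<^bsub>H\<^esub>"
      show "cinner H v (adj H C z) = cinner H v (adj H D z)"
        using C'(3)[OF v(1) z] D'(3)[OF v(1) z] ker[OF v] by simp
    qed (rule C'(2)[OF z] D'(2)[OF z])+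
    then show "cinner H (C x) z = cinner H (D x) z"
      using C'(3)[OF x z] D'(3)[OF x z] by simp
  qed (rule C'(1)[OF x] D'(1)[OF x])+
qed

text \<open>
  The operator \<open>C\<close> is obtained as the adjoint of \<open>G\<close>, where \<open>G z\<close> is determined by its inner products
  with the range and the kernel of \<open>R\<close>.
\<close>

lemma extension_exists:
  assumes c: "0 \<le> c" "\<And>x. x \<in> carrier H \<Longrightarrow> hnorm H (Q x) \<le> c * hnorm H (R x)"
  shows "\<exists>C\<in>bounded_ops H H. (\<forall>x\<in>carrier H. C (R x) = Q x) \<and> (\<forall>v\<in>carrier H. R v = \<zero>\<^bsub>H\<^esub> \<longrightarrow> C v = v)"
proof -
  interpret RR: positive_pair H R R by unfold_locales (rule R)+
  have self_bound: "hnorm H (R x) \<le> 1 * hnorm H (R x)" if "x \<in> carrier H" for x by simp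
  note [simp] = RQ_simps smult_carrier
  have "\<forall>z\<in>carrier H. \<exists>y. y \<in> carrier H \<and> (\<forall>x\<in>carrier H. cinner H (R x) y = cinner H (Q x) z)
      \<and> (\<forall>v\<in>carrier H. R v = \<zero>\<^bsub>H\<^esub> \<longrightarrow> cinner H v y = cinner H v z)
      \<and> hnorm H y \<le> (c + 2) * hnorm H z"
  proof
    fix z assume z: "z \<in> carrier H"
    obtain p where p: "p \<in> carrier H" and p': "(\<forall>x\<in>carrier H. cinner H (R x) p = cinner H (Q x) z) \<and>
      (\<forall>v\<in>carrier H. R v = \<zero>\<^bsub>H\<^esub> \<longrightarrow> cinner H v p = 0) \<and> hnorm H p \<le> c * hnorm H z"
      using bound_imp_Riesz[OF c z] ..
    \<comment> \<open>The vector \<open>z - q\<close> is the projection of \<open>z\<close> onto the kernel of \<open>R\<close>.\<close>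
    obtain q where q: "q \<in> carrier H" and q': "(\<forall>x\<in>carrier H. cinner H (R x) q = cinner H (R x) z) \<and>
      (\<forall>v\<in>carrier H. R v = \<zero>\<^bsub>H\<^esub> \<longrightarrow> cinner H v q = 0) \<and> hnorm H q \<le> 1 * hnorm H z"
      using RR.bound_imp_Riesz[OF zero_le_one self_bound z] ..
    show "\<exists>y. y \<in> carrier H \<and> (\<forall>x\<in>carrier H. cinner H (R x) y = cinner H (Q x) z)
      \<and> (\<forall>v\<in>carrier H. R v = \<zero>\<^bsub>H\<^esub> \<longrightarrow> cinner H v y = cinner H v z)
      \<and> hnorm H y \<le> (c + 2) * hnorm H z"
    proof (intro exI[of _ "p \<oplus>\<^bsub>H\<^esub> (z \<ominus>\<^bsub>H\<^esub> q)"] conjI ballI impI)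
      show "p \<oplus>\<^bsub>H\<^esub> (z \<ominus>\<^bsub>H\<^esub> q) \<in> carrier H" using p q z by simp
      show "cinner H (R x) (p \<oplus>\<^bsub>H\<^esub> (z \<ominus>\<^bsub>H\<^esub> q)) = cinner H (Q x) z" if "x \<in> carrier H" for x
        using that p q z p' q' by (simp add: cinner_add_right cinner_minus_right)
      show "cinner H v (p \<oplus>\<^bsub>H\<^esub> (z \<ominus>\<^bsub>H\<^esub> q)) = cinner H v z" if "v \<in> carrier H" "R v = \<zero>\<^bsub>H\<^esub>" for v
        using that p q z p' q' by (simp add: cinner_add_right cinner_minus_right)
      have "hnorm H (p \<oplus>\<^bsub>H\<^esub> (z \<ominus>\<^bsub>H\<^esub> q)) \<le> hnorm H p + (hnorm H z + hnorm H q)"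
        using hnorm_triangle[of p "z \<ominus>\<^bsub>H\<^esub> q"] hnorm_minus_le[of z q] p q z by simp
      also have "\<dots> \<le> (c + 2) * hnorm H z" using p' q' by (simp add: algebra_simps)
      finally show "hnorm H (p \<oplus>\<^bsub>H\<^esub> (z \<ominus>\<^bsub>H\<^esub> q)) \<le> (c + 2) * hnorm H z" .
    qed
  qed
  from bchoice[OF this] obtain g where g':
    "\<forall>z\<in>carrier H. g z \<in> carrier H \<and> (\<forall>x\<in>carrier H. cinner H (R x) (g z) = cinner H (Q x) z)
      \<and> (\<forall>v\<in>carrier H. R v = \<zero>\<^bsub>H\<^esub> \<longrightarrow> cinner H v (g z) = cinner H v z)
      \<and> hnorm H (g z) \<le> (c + 2) * hnorm H z" ..
  then have g: "\<And>z. z \<in> carrier H \<Longrightarrow> g z \<in> carrier H"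
    "\<And>z x. \<lbrakk>z \<in> carrier H; x \<in> carrier H\<rbrakk> \<Longrightarrow> cinner H (R x) (g z) = cinner H (Q x) z"
    "\<And>z v. \<lbrakk>z \<in> carrier H; v \<in> carrier H; R v = \<zero>\<^bsub>H\<^esub>\<rbrakk> \<Longrightarrow> cinner H v (g z) = cinner H v z"
    "\<And>z. z \<in> carrier H \<Longrightarrow> hnorm H (g z) \<le> (c + 2) * hnorm H z"
    by auto
  define G where "G = (\<lambda>z\<in>carrier H. g z)"
  have G: "G \<in> bounded_ops H H"
  proof (rule bounded_opsI[where C="c + 2"])
    fix x y assume xy: "x \<in> carrier H" "y \<in> carrier H"
    have "g (x \<oplus>\<^bsub>H\<^esub> y) = g x \<oplus>\<^bsub>H\<^esub> g y"
      by (rule vec_eq_on_range_and_kernel) (use xy in \<open>simp_all add: g(1-3) cinner_add_right\<close>)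
    then show "G (x \<oplus>\<^bsub>H\<^esub> y) = G x \<oplus>\<^bsub>H\<^esub> G y" using xy by (simp add: G_def)
  next
    fix x d assume x: "x \<in> carrier H"
    have "g (d \<odot>\<^bsub>H\<^esub> x) = d \<odot>\<^bsub>H\<^esub> g x"
      by (rule vec_eq_on_range_and_kernel) (use x in \<open>simp_all add: g(1-3) cinner_smult_right\<close>)
    then show "G (d \<odot>\<^bsub>H\<^esub> x) = d \<odot>\<^bsub>H\<^esub> G x" using x by (simp add: G_def)
  qed (use g in \<open>auto simp: G_def\<close>)
  note [simp] = bounded_opsD(1)[OF adj_bounded[OF G]]
  show ?thesis
  proof (intro bexI[OF _ adj_bounded[OF G]] conjI ballI impI)
    fix x assume x: "x \<in> carrier H"
    show "adj H G (R x) = Q x"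
      using x g(2) by (intro vec_eqI) (auto simp: cinner_adj_left[OF G], simp add: G_def)
  next
    fix v assume v: "v \<in> carrier H" "R v = \<zero>\<^bsub>H\<^esub>"
    show "adj H G v = v"
      using v g(3) by (intro vec_eqI) (auto simp: cinner_adj_left[OF G], simp add: G_def)
  qed
qed

end

text \<open>
  Exchanging \<open>R\<close> and \<open>Q\<close> gives an operator \<open>D\<close> such that \<open>D C\<close> is the identity on the range and on the
  kernel of \<open>R\<close>, hence everywhere; so \<open>C\<close> is bounded below.
\<close>

lemma (in hilbert_space) equal_range_intertwiner:
  assumes R: "op_positive H R" and Q: "op_positive H Q" and ran: "op_range H R = op_range H Q"
  shows "\<exists>C b. C \<in> bounded_ops H H \<and> 0 < b \<and> (\<forall>x\<in>carrier H. C (R x) = Q x)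
    \<and> (\<forall>v\<in>carrier H. R v = \<zero>\<^bsub>H\<^esub> \<longrightarrow> C v = v)
    \<and> (\<forall>u\<in>carrier H. hnorm H u \<le> b * hnorm H (C u))"
proof -
  interpret RQ: positive_pair H R Q by unfold_locales (rule R Q)+
  interpret QR: positive_pair H Q R by unfold_locales (rule R Q)+
  obtain c where c: "c > 0" "\<And>x. x \<in> carrier H \<Longrightarrow> hnorm H (Q x) \<le> c * hnorm H (R x)"
    using RQ.range_subset_imp_bound ran by auto
  obtain d where d: "d > 0" "\<And>x. x \<in> carrier H \<Longrightarrow> hnorm H (R x) \<le> d * hnorm H (Q x)"
    using QR.range_subset_imp_bound ran by auto
  obtain C where Cb: "C \<in> bounded_ops H H"
    and C: "(\<forall>x\<in>carrier H. C (R x) = Q x) \<and> (\<forall>v\<in>carrier H. R v = \<zero>\<^bsub>H\<^esub> \<longrightarrow> C v = v)"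
    using RQ.extension_exists[OF less_imp_le[OF c(1)] c(2)] ..
  obtain D where Db: "D \<in> bounded_ops H H"
    and D: "(\<forall>x\<in>carrier H. D (Q x) = R x) \<and> (\<forall>v\<in>carrier H. Q v = \<zero>\<^bsub>H\<^esub> \<longrightarrow> D v = v)"
    using QR.extension_exists[OF less_imp_le[OF d(1)] d(2)] ..
  have kernel: "Q v = \<zero>\<^bsub>H\<^esub>" if "v \<in> carrier H" "R v = \<zero>\<^bsub>H\<^esub>" for v
    using c(2)[OF that(1)] that RQ.RQ_simps(4)[of v] hnorm_ge_0[of "Q v"] hnorm_eq_0_iff[of "Q v"]
    by (simp add: hnorm_zero)
  have comp: "op_comp H D C = id_op H"
    by (rule RQ.eq_on_range_and_kernel[OF op_comp_bounded[OF Db Cb] id_op_bounded])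
      (use RQ.RQ_simps(1) C D kernel in \<open>simp_all add: compose_def\<close>)
  have DC: "D (C u) = u" if "u \<in> carrier H" for u
    using that fun_cong[OF comp, of u] by (simp add: compose_def)
  obtain b where b: "b > 0" "\<And>x. x \<in> carrier H \<Longrightarrow> hnorm H (D x) \<le> b * hnorm H x"
    using space_pair.bound_pos[OF space_pair_self Db] by metis
  have below: "hnorm H u \<le> b * hnorm H (C u)" if u: "u \<in> carrier H" for u
    using b(2)[OF bounded_opsD(1)[OF Cb u]] DC[OF u] by simp
  show ?thesis using Cb C b(1) below by (intro exI[of _ C] exI[of _ b]) simp
qed

section \<open>Operators that are bounded below\<close>

context space_pair begin

lemma bounded_below_limit:
  assumes H: "hilbert_space H" and V: "V \<in> bounded_ops H K"
    and b: "b > 0" "\<And>x. x \<in> carrier H \<Longrightarrow> hnorm H x \<le> b * hnorm K (V x)"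
    and \<sigma>: "\<And>n. \<sigma> n \<in> carrier H" and u: "conv_to K (\<lambda>n. V (\<sigma> n)) u"
  obtains s where "s \<in> carrier H" "V s = u"
proof -
  have uc: "u \<in> carrier K" using K.conv_to_carrier(1)[OF u] .
  have "cauchy_in H \<sigma>"
    unfolding cauchy_in_def
  proof (intro conjI allI impI)
    fix e :: real assume "e > 0"
    then have "e / (2 * b) > 0" using b(1) by simp
    moreover have "(\<lambda>n. hnorm K (V (\<sigma> n) \<ominus>\<^bsub>K\<^esub> u)) \<longlonglongrightarrow> 0" using u by (simp add: conv_to_def)
    ultimately have "\<forall>\<^sub>F n in sequentially. hnorm K (V (\<sigma> n) \<ominus>\<^bsub>K\<^esub> u) < e / (2 * b)"
      using order_tendstoD(2) by blast
    then obtain N where N: "\<And>n. N \<le> n \<Longrightarrow> hnorm K (V (\<sigma> n) \<ominus>\<^bsub>K\<^esub> u) < e / (2 * b)"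
      unfolding eventually_sequentially by blast
    show "\<exists>N. \<forall>m\<ge>N. \<forall>n\<ge>N. hnorm H (\<sigma> m \<ominus>\<^bsub>H\<^esub> \<sigma> n) < e"
    proof (intro exI[of _ N] allI impI)
      fix m n assume mn: "N \<le> m" "N \<le> n"
      note [simp] = bounded_opsD(1)[OF V] \<sigma> uc
      have "hnorm H (\<sigma> m \<ominus>\<^bsub>H\<^esub> \<sigma> n) \<le> b * hnorm K (V (\<sigma> m) \<ominus>\<^bsub>K\<^esub> V (\<sigma> n))"
        using b(2)[of "\<sigma> m \<ominus>\<^bsub>H\<^esub> \<sigma> n"] by (simp add: bounded_ops_minus[OF V])
      also have "\<dots> \<le> b * (hnorm K (V (\<sigma> m) \<ominus>\<^bsub>K\<^esub> u) + hnorm K (V (\<sigma> n) \<ominus>\<^bsub>K\<^esub> u))"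
        using K.hnorm_minus_triangle[of "V (\<sigma> m)" u "V (\<sigma> n)"] K.hnorm_minus_commute[of u "V (\<sigma> n)"] b(1) by simp
      also have "\<dots> < b * (e / (2 * b) + e / (2 * b))"
        using N[OF mn(1)] N[OF mn(2)] b(1) by (intro mult_strict_left_mono add_strict_mono)
      also have "\<dots> = e" using b(1) by simp
      finally show "hnorm H (\<sigma> m \<ominus>\<^bsub>H\<^esub> \<sigma> n) < e" .
    qed
  qed (rule \<sigma>)
  then obtain s where s: "conv_to H \<sigma> s" using hilbert_space.cauchy_conv[OF H] by blast
  show ?thesis
    using that[of s] K.conv_to_unique[OF bounded_ops_conv_to[OF V s] u] H.conv_to_carrier(1)[OF s] by simp
qed

text \<open>
  Solving \<open>G s = y\<close> means representing \<open>\<langle>x, y\<rangle>\<close> as \<open>\<langle>V x, u\<rangle>\<close>; the closed range of \<open>V\<close> contains the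
  representing vector \<open>u\<close>, and \<open>s\<close> is its preimage.
\<close>

lemma gram_form_invertible:
  assumes H: "hilbert_space H" and K: "hilbert_space K" and V: "V \<in> bounded_ops H K"
    and b: "b > 0" "\<And>x. x \<in> carrier H \<Longrightarrow> hnorm H x \<le> b * hnorm K (V x)"
    and G: "G \<in> bounded_ops H H"
    and GV: "\<And>x y. \<lbrakk>x \<in> carrier H; y \<in> carrier H\<rbrakk> \<Longrightarrow> cinner H (G x) y = cinner K (V x) (V y)"
  shows "op_invertible H G"
proof -
  interpret HH: space_pair H H ..
  note [simp] = bounded_opsD[OF V] bounded_opsD[OF G] H.smult_carrier
  have le: "hnorm H s \<le> b\<^sup>2 * hnorm H (G s)" if s: "s \<in> carrier H" for s
  proof -
    have "(hnorm H s)\<^sup>2 \<le> (b * hnorm K (V s))\<^sup>2"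
      using b(2)[OF s] H.hnorm_ge_0[OF s] by (intro power_mono)
    also have "\<dots> = b\<^sup>2 * Re (cinner H (G s) s)" using s by (simp add: GV K.hnorm_sq power_mult_distrib)
    also have "\<dots> \<le> b\<^sup>2 * (hnorm H (G s) * hnorm H s)"
      using order_trans[OF complex_Re_le_cmod H.Cauchy_Schwarz[of "G s" s]] s
      by (intro mult_left_mono) auto
    finally show ?thesis
      using H.hnorm_ge_0[OF s] H.hnorm_ge_0[of "G s"] s
      by (cases "hnorm H s = 0") (auto simp: power2_eq_square[of "hnorm H s"] mult.assoc[symmetric] mult_le_cancel_right)
  qed
  have "\<exists>s\<in>carrier H. G s = y" if y: "y \<in> carrier H" for y
  proof (rule Riesz_along[OF K V, where f="\<lambda>x. cinner H x y" and C="b * hnorm H y"])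
    fix x assume x: "x \<in> carrier H"
    have "cmod (cinner H x y) \<le> hnorm H x * hnorm H y" using H.Cauchy_Schwarz[OF x y] .
    also have "\<dots> \<le> b * hnorm K (V x) * hnorm H y"
      using b(2)[OF x] H.hnorm_ge_0[OF y] by (rule mult_right_mono)
    finally show "cmod (cinner H x y) \<le> b * hnorm H y * hnorm K (V x)" by (simp add: algebra_simps)
  next
    fix u \<sigma> assume \<sigma>: "\<And>n::nat. \<sigma> n \<in> carrier H" and u: "conv_to K (\<lambda>n. V (\<sigma> n)) u"
      and f: "\<And>x. x \<in> carrier H \<Longrightarrow> cinner H x y = cinner K (V x) u"
    obtain s where s: "s \<in> carrier H" "V s = u" using bounded_below_limit[OF H V b \<sigma> u] by metis
    have "G s = y"
    proof (rule H.vec_eqI)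
      fix z assume z: "z \<in> carrier H"
      show "cinner H (G s) z = cinner H y z"
        using GV[OF s(1) z] f[OF z] s z y H.cinner_cnj[OF z y] K.cinner_cnj[of "V z" "V s"]
          K.conv_to_carrier(1)[OF u] by simp
    qed (use s y in auto)
    then show "\<exists>s\<in>carrier H. G s = y" using s by blast
  qed (use y in \<open>simp_all add: H.cinner_rules\<close>)
  then obtain g where g: "\<And>y. y \<in> carrier H \<Longrightarrow> g y \<in> carrier H" "\<And>y. y \<in> carrier H \<Longrightarrow> G (g y) = y" by metis
  have inj: "s = t" if "s \<in> carrier H" "t \<in> carrier H" "G s = G t" for s t
  proof -
    have "hnorm H (s \<ominus>\<^bsub>H\<^esub> t) \<le> b\<^sup>2 * hnorm H (G s \<ominus>\<^bsub>H\<^esub> G t)"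
      using le[of "s \<ominus>\<^bsub>H\<^esub> t"] that(1,2) by (simp add: HH.bounded_ops_minus[OF G])
    then have "hnorm H (s \<ominus>\<^bsub>H\<^esub> t) = 0"
      using that H.hnorm_ge_0[of "s \<ominus>\<^bsub>H\<^esub> t"] by (simp add: H.minus_self H.hnorm_zero)
    then show ?thesis using that H.hnorm_eq_0_iff H.minus_eq_zeroD by simp
  qed
  define B where "B = (\<lambda>y\<in>carrier H. g y)"
  have "B \<in> bounded_ops H H"
  proof (rule bounded_opsI[where C="b\<^sup>2"])
    fix x y assume "x \<in> carrier H" "y \<in> carrier H"
    then show "B (x \<oplus>\<^bsub>H\<^esub> y) = B x \<oplus>\<^bsub>H\<^esub> B y" by - (rule inj, simp_all add: B_def g)
  next
    fix x c assume "x \<in> carrier H"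
    then show "B (c \<odot>\<^bsub>H\<^esub> x) = c \<odot>\<^bsub>H\<^esub> B x" by - (rule inj, simp_all add: B_def g)
  next
    fix y assume "y \<in> carrier H"
    then show "hnorm H (B y) \<le> b\<^sup>2 * hnorm H y" using le[of "g y"] g by (simp add: B_def)
  qed (use g in \<open>auto simp: B_def\<close>)
  moreover have "op_comp H G B = id_op H" using g by (intro ext) (simp add: compose_def B_def)
  moreover have "op_comp H B G = id_op H"
  proof
    fix x show "op_comp H B G x = id_op H x"
      using g inj[of "g (G x)" x] by (cases "x \<in> carrier H") (simp_all add: compose_def B_def)
  qed
  ultimately show ?thesis using G unfolding op_invertible_def by blast
qed

end

context hilbert_space begin

lemma op_invertible_bounded_below:
  assumes "op_invertible H G"
  obtains b where "b > 0" "\<And>x. x \<in> carrier H \<Longrightarrow> hnorm H x \<le> b * hnorm H (G x)"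
proof -
  obtain B where B: "B \<in> bounded_ops H H" "op_comp H B G = id_op H" and G: "G \<in> bounded_ops H H"
    using assms unfolding op_invertible_def by blast
  obtain b where b: "b > 0" "\<And>x. x \<in> carrier H \<Longrightarrow> hnorm H (B x) \<le> b * hnorm H x"
    using space_pair.bound_pos[OF space_pair_self B(1)] by metis
  have "hnorm H x \<le> b * hnorm H (G x)" if "x \<in> carrier H" for x
    using b(2)[of "G x"] fun_cong[OF B(2), of x] that bounded_opsD(1)[OF G that] by (simp add: compose_def)
  then show ?thesis by (rule that[OF b(1)])
qed

lemma left_invertible_iff_bounded_below:
  assumes S: "S \<in> bounded_ops H H"
  shows "left_invertible H S \<longleftrightarrow> (\<exists>b>0. \<forall>x\<in>carrier H. hnorm H x \<le> b * hnorm H (S x))"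
proof
  assume "left_invertible H S"
  then have "op_invertible H (gram H S)" by (simp add: left_invertible_def)
  then obtain b where b: "b > 0" "\<And>x. x \<in> carrier H \<Longrightarrow> hnorm H x \<le> b * hnorm H (gram H S x)"
    using op_invertible_bounded_below by metis
  obtain c where c: "c > 0" "\<And>x. x \<in> carrier H \<Longrightarrow> hnorm H (adj H S x) \<le> c * hnorm H x"
    using space_pair.bound_pos[OF space_pair_self adj_bounded[OF S]] by metis
  have "hnorm H x \<le> (b * c) * hnorm H (S x)" if x: "x \<in> carrier H" for x
  proof -
    have "b * hnorm H (gram H S x) \<le> b * (c * hnorm H (S x))"
      using c(2)[of "S x"] x bounded_opsD(1)[OF S x] b(1) by (simp add: gram_def compose_def)
    then show ?thesis using b(2)[OF x] by simp
  qed
  then show "\<exists>b>0. \<forall>x\<in>carrier H. hnorm H x \<le> b * hnorm H (S x)"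
    using b(1) c(1) by (intro exI[of _ "b * c"]) auto
next
  assume "\<exists>b>0. \<forall>x\<in>carrier H. hnorm H x \<le> b * hnorm H (S x)"
  then obtain b where b: "b > 0" "\<And>x. x \<in> carrier H \<Longrightarrow> hnorm H x \<le> b * hnorm H (S x)" by blast
  have "op_invertible H (gram H S)"
    by (rule space_pair.gram_form_invertible[OF space_pair_self hilbert_space_axioms hilbert_space_axioms
        S b gram_bounded[OF S] cinner_gram[OF S]])
  then show "left_invertible H S" using S by (simp add: left_invertible_def)
qed

end

section \<open>Closed subspaces and square-summable sequences\<close>

lemma orth_compl_simps [simp]:
  "add (orth_compl H K J) = add K" "zero (orth_compl H K J) = zero K"
  "module.smult (orth_compl H K J) = module.smult K" "cinner (orth_compl H K J) = cinner K"
  "hnorm (orth_compl H K J) = hnorm K"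
  by (auto simp: orth_compl_def hnorm_def)

lemma carrier_orth_compl:
  "k \<in> carrier (orth_compl H K J) \<longleftrightarrow> k \<in> carrier K \<and> (\<forall>h\<in>carrier H. cinner K k (J h) = 0)"
  by (simp add: orth_compl_def)

lemma orth_compl_inner_space:
  assumes K: "complex_inner_space K" and J: "\<And>h. h \<in> carrier H \<Longrightarrow> J h \<in> carrier K"
  shows "complex_inner_space (orth_compl H K J)"
proof -
  interpret K: complex_inner_space K by fact
  let ?L = "orth_compl H K J"
  have sub: "x \<in> carrier K" if "x \<in> carrier ?L" for x using that by (simp add: carrier_orth_compl)
  have add: "x \<oplus>\<^bsub>K\<^esub> y \<in> carrier ?L" if "x \<in> carrier ?L" "y \<in> carrier ?L" for x y
    using that J by (simp add: carrier_orth_compl K.cinner_add)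
  have scale: "c \<odot>\<^bsub>K\<^esub> x \<in> carrier ?L" if "x \<in> carrier ?L" for x c
    using that J by (simp add: carrier_orth_compl K.cinner_smult K.smult_carrier)
  have zero: "\<zero>\<^bsub>K\<^esub> \<in> carrier ?L" using J by (simp add: carrier_orth_compl K.cinner_zero_left)
  have group: "abelian_group ?L"
  proof (rule abelian_groupI)
    fix x assume x: "x \<in> carrier ?L"
    have "(-1) \<odot>\<^bsub>K\<^esub> x \<oplus>\<^bsub>K\<^esub> x = \<zero>\<^bsub>K\<^esub>"
      using sub[OF x] by (intro K.vec_eqI) (auto simp: K.cinner_rules)
    then show "\<exists>y\<in>carrier ?L. y \<oplus>\<^bsub>?L\<^esub> x = \<zero>\<^bsub>?L\<^esub>" using scale[OF x] by auto
  qed (simp_all add: add zero sub K.a_ac)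
  have "Module.module complex_ring ?L"
    by (rule moduleI[OF K.R.is_cring group])
      (simp_all add: sub scale K.smult_l_distr K.smult_r_distr K.smult_assoc1 K.smult_one)
  then show ?thesis
    by (rule complex_inner_space.intro)
      (unfold_locales, simp_all add: sub K.cinner_add K.cinner_smult K.cinner_cnj[symmetric] K.cinner_pos)
qed

lemma minus_orth_compl:
  assumes K: "complex_inner_space K" and J: "\<And>h. h \<in> carrier H \<Longrightarrow> J h \<in> carrier K"
    and "x \<in> carrier (orth_compl H K J)" "y \<in> carrier (orth_compl H K J)"
  shows "x \<ominus>\<^bsub>orth_compl H K J\<^esub> y = x \<ominus>\<^bsub>K\<^esub> y"
proof -
  interpret K: complex_inner_space K by fact
  interpret L: complex_inner_space "orth_compl H K J" by (rule orth_compl_inner_space[OF K J])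
  have "y \<in> carrier K" using assms(4) by (simp add: carrier_orth_compl)
  then show ?thesis
    using L.a_inv_eq_smult[OF assms(4)] K.a_inv_eq_smult[of y] by (simp add: a_minus_def)
qed

lemma orth_compl_hilbert:
  assumes K: "hilbert_space K" and J: "\<And>h. h \<in> carrier H \<Longrightarrow> J h \<in> carrier K"
  shows "hilbert_space (orth_compl H K J)"
proof -
  interpret K: hilbert_space K by fact
  let ?L = "orth_compl H K J"
  interpret L: complex_inner_space ?L by (rule orth_compl_inner_space[OF K.complex_inner_space_axioms J])
  note minus = minus_orth_compl[OF K.complex_inner_space_axioms J]
  show ?thesis
  proof (rule L.hilbert_spaceI)
    fix \<sigma> assume \<sigma>: "cauchy_in ?L \<sigma>"
    then have \<sigma>L: "\<And>n. \<sigma> n \<in> carrier ?L" by (simp add: cauchy_in_def)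
    then have "cauchy_in K \<sigma>"
      using \<sigma> by (simp add: cauchy_in_def minus carrier_orth_compl)
    then obtain x where x: "conv_to K \<sigma> x" by (rule K.cauchy_conv)
    have "cinner K x (J h) = 0" if h: "h \<in> carrier H" for h
      using K.conv_to_cinner[OF x J[OF h]] \<sigma>L h LIMSEQ_unique[OF _ tendsto_const]
      by (simp add: carrier_orth_compl)
    then have "x \<in> carrier ?L" using K.conv_to_carrier[OF x] by (simp add: carrier_orth_compl)
    then have "conv_to ?L \<sigma> x" using x \<sigma>L by (simp add: conv_to_def minus)
    then show "\<exists>x. conv_to ?L \<sigma> x" by blast
  qed
qed

definition l2 :: "'a cspace \<Rightarrow> (nat \<Rightarrow> 'a) cspace" where
  "l2 H = \<lparr>carrier = {f. (\<forall>n. f n \<in> carrier H) \<and> summable (\<lambda>n. (hnorm H (f n))\<^sup>2)},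
     monoid.mult = (\<lambda>_ _. undefined), one = undefined,
     zero = (\<lambda>_. \<zero>\<^bsub>H\<^esub>), add = (\<lambda>f g n. f n \<oplus>\<^bsub>H\<^esub> g n),
     smult = (\<lambda>c f n. c \<odot>\<^bsub>H\<^esub> f n),
     cinner = (\<lambda>f g. \<Sum>n. cinner H (f n) (g n))\<rparr>"

lemma l2_simps [simp]:
  "\<zero>\<^bsub>l2 H\<^esub> = (\<lambda>_. \<zero>\<^bsub>H\<^esub>)" "f \<oplus>\<^bsub>l2 H\<^esub> g = (\<lambda>n. f n \<oplus>\<^bsub>H\<^esub> g n)" "c \<odot>\<^bsub>l2 H\<^esub> f = (\<lambda>n. c \<odot>\<^bsub>H\<^esub> f n)"
  by (auto simp: l2_def)

lemma cinner_l2: "cinner (l2 H) f g = (\<Sum>n. cinner H (f n) (g n))"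
  by (simp add: l2_def)

lemma carrier_l2: "f \<in> carrier (l2 H) \<longleftrightarrow> (\<forall>n. f n \<in> carrier H) \<and> summable (\<lambda>n. (hnorm H (f n))\<^sup>2)"
  by (simp add: l2_def)

lemma l2D: "f \<in> carrier (l2 H) \<Longrightarrow> f n \<in> carrier H" by (simp add: carrier_l2)

context
  fixes H :: "'a cspace"
  assumes H: "complex_inner_space H"
begin

interpretation complex_inner_space H by (rule H)

lemma l2_cinner_summable:
  assumes "f \<in> carrier (l2 H)" "g \<in> carrier (l2 H)"
  shows "summable (\<lambda>n. cinner H (f n) (g n))"
proof (rule summable_comparison_test')
  show "summable (\<lambda>n. (hnorm H (f n))\<^sup>2 + (hnorm H (g n))\<^sup>2)"
    using assms by (intro summable_add) (auto simp: carrier_l2)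
  fix n
  have "cmod (cinner H (f n) (g n)) \<le> hnorm H (f n) * hnorm H (g n)"
    by (rule Cauchy_Schwarz[OF l2D[OF assms(1)] l2D[OF assms(2)]])
  also have "\<dots> \<le> (hnorm H (f n))\<^sup>2 + (hnorm H (g n))\<^sup>2"
    using sum_squares_bound[of "hnorm H (f n)" "hnorm H (g n)"]
      zero_le_power2[of "hnorm H (f n)"] zero_le_power2[of "hnorm H (g n)"] by linarith
  finally show "norm (cinner H (f n) (g n)) \<le> (hnorm H (f n))\<^sup>2 + (hnorm H (g n))\<^sup>2" .
qed

lemma l2_add_closed:
  assumes "f \<in> carrier (l2 H)" "g \<in> carrier (l2 H)"
  shows "(\<lambda>n. f n \<oplus>\<^bsub>H\<^esub> g n) \<in> carrier (l2 H)"
  unfolding carrier_l2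
proof
  show "summable (\<lambda>n. (hnorm H (f n \<oplus>\<^bsub>H\<^esub> g n))\<^sup>2)"
  proof (rule summable_comparison_test')
    show "summable (\<lambda>n. 2 * (hnorm H (f n))\<^sup>2 + 2 * (hnorm H (g n))\<^sup>2)"
      using assms by (intro summable_add summable_mult) (auto simp: carrier_l2)
    fix n
    have "0 \<le> (hnorm H (f n \<ominus>\<^bsub>H\<^esub> g n))\<^sup>2" by simp
    then have "(hnorm H (f n \<oplus>\<^bsub>H\<^esub> g n))\<^sup>2 \<le> 2 * (hnorm H (f n))\<^sup>2 + 2 * (hnorm H (g n))\<^sup>2"
      using hnorm_add_sq[OF l2D[OF assms(1)] l2D[OF assms(2)], of n n]
        hnorm_minus_sq[OF l2D[OF assms(1)] l2D[OF assms(2)], of n n] by linarith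
    then show "norm ((hnorm H (f n \<oplus>\<^bsub>H\<^esub> g n))\<^sup>2) \<le> 2 * (hnorm H (f n))\<^sup>2 + 2 * (hnorm H (g n))\<^sup>2"
      by (simp only: real_norm_def abs_power2)
  qed
qed (use assms in \<open>auto simp: carrier_l2\<close>)

lemma l2_smult_closed:
  assumes "f \<in> carrier (l2 H)" shows "(\<lambda>n. c \<odot>\<^bsub>H\<^esub> f n) \<in> carrier (l2 H)"
  using assms by (simp add: carrier_l2 smult_carrier hnorm_smult power_mult_distrib summable_mult)

lemma l2_inner_space: "complex_inner_space (l2 H)"
proof -
  have group: "abelian_group (l2 H)"
  proof (rule abelian_groupI)
    fix f assume f: "f \<in> carrier (l2 H)"
    have "(\<lambda>n. (-1) \<odot>\<^bsub>H\<^esub> f n \<oplus>\<^bsub>H\<^esub> f n) = (\<lambda>n. \<zero>\<^bsub>H\<^esub>)"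
      using l2D[OF f] by (intro ext vec_eqI) (auto simp: cinner_rules)
    then show "\<exists>g\<in>carrier (l2 H). g \<oplus>\<^bsub>l2 H\<^esub> f = \<zero>\<^bsub>l2 H\<^esub>"
      using l2_smult_closed[OF f, of "-1"] by (intro bexI[of _ "\<lambda>n. (-1) \<odot>\<^bsub>H\<^esub> f n"]) auto
  qed (auto simp: l2_add_closed a_ac l2D carrier_l2[of "\<lambda>_. \<zero>\<^bsub>H\<^esub>"] hnorm_zero)
  have "Module.module complex_ring (l2 H)"
    by (rule moduleI[OF R.is_cring group])
      (simp_all add: l2_smult_closed l2D smult_l_distr smult_r_distr smult_assoc1 smult_one)
  then show ?thesis
  proof (intro complex_inner_space.intro complex_inner_space_axioms.intro)
    fix x y z assume xyz: "x \<in> carrier (l2 H)" "y \<in> carrier (l2 H)" "z \<in> carrier (l2 H)"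
    show "cinner (l2 H) (x \<oplus>\<^bsub>l2 H\<^esub> y) z = cinner (l2 H) x z + cinner (l2 H) y z"
      using xyz by (simp add: cinner_l2 cinner_add l2D suminf_add[OF l2_cinner_summable l2_cinner_summable])
  next
    fix x y c assume "x \<in> carrier (l2 H)" "y \<in> carrier (l2 H)"
    then show "cinner (l2 H) (c \<odot>\<^bsub>l2 H\<^esub> x) y = c * cinner (l2 H) x y"
      by (simp add: cinner_l2 cinner_smult l2D suminf_mult[OF l2_cinner_summable])
  next
    fix x y assume xy: "x \<in> carrier (l2 H)" "y \<in> carrier (l2 H)"
    have "cnj (cinner (l2 H) x y) = (\<Sum>n. cnj (cinner H (x n) (y n)))"
      unfolding cinner_l2 by (rule bounded_linear.suminf[OF bounded_linear_cnj l2_cinner_summable[OF xy]])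
    then show "cinner (l2 H) y x = cnj (cinner (l2 H) x y)"
      unfolding cinner_l2 using cinner_cnj[OF l2D[OF xy(1)] l2D[OF xy(2)]] by simp
  next
    fix x assume x: "x \<in> carrier (l2 H)" "x \<noteq> \<zero>\<^bsub>l2 H\<^esub>"
    then obtain n where n: "x n \<noteq> \<zero>\<^bsub>H\<^esub>" by auto
    have "Re (cinner (l2 H) x x) = (\<Sum>n. Re (cinner H (x n) (x n)))"
      unfolding cinner_l2 by (rule bounded_linear.suminf[OF bounded_linear_Re l2_cinner_summable[OF x(1) x(1)]])
    also have "\<dots> > 0"
      by (rule suminf_pos2[of _ n])
        (use summable_Re[OF l2_cinner_summable[OF x(1) x(1)]] cinner_self_nonneg l2D[OF x(1)] cinner_pos n in auto)
    finally show "0 < Re (cinner (l2 H) x x)" .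
  qed
qed

lemma hnorm_l2_sq:
  assumes "f \<in> carrier (l2 H)"
  shows "(hnorm (l2 H) f)\<^sup>2 = (\<Sum>n. (hnorm H (f n))\<^sup>2)"
proof -
  interpret K: complex_inner_space "l2 H" by (rule l2_inner_space)
  have "Re (cinner (l2 H) f f) = (\<Sum>n. Re (cinner H (f n) (f n)))"
    unfolding cinner_l2 by (rule bounded_linear.suminf[OF bounded_linear_Re l2_cinner_summable[OF assms assms]])
  then show ?thesis using assms by (simp add: K.hnorm_sq hnorm_sq l2D)
qed

lemma minus_l2:
  assumes "f \<in> carrier (l2 H)" "g \<in> carrier (l2 H)"
  shows "f \<ominus>\<^bsub>l2 H\<^esub> g = (\<lambda>n. f n \<ominus>\<^bsub>H\<^esub> g n)"
proof -
  interpret K: complex_inner_space "l2 H" by (rule l2_inner_space)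
  show ?thesis
    using K.a_inv_eq_smult[OF assms(2)] a_inv_eq_smult[OF l2D[OF assms(2)]] by (simp add: a_minus_def)
qed

lemma sum_le_hnorm_l2:
  assumes "f \<in> carrier (l2 H)"
  shows "(\<Sum>n<N. (hnorm H (f n))\<^sup>2) \<le> (hnorm (l2 H) f)\<^sup>2"
  unfolding hnorm_l2_sq[OF assms] using assms by (intro sum_le_suminf) (auto simp: carrier_l2)

lemma hnorm_component_le:
  assumes "f \<in> carrier (l2 H)"
  shows "hnorm H (f n) \<le> hnorm (l2 H) f"
proof -
  interpret K: complex_inner_space "l2 H" by (rule l2_inner_space)
  have "(hnorm H (f n))\<^sup>2 \<le> (hnorm (l2 H) f)\<^sup>2"
    using sum_le_hnorm_l2[OF assms, of "Suc n"] sum_nonneg[of "{..<n}" "\<lambda>n. (hnorm H (f n))\<^sup>2"] by simp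
  then show ?thesis by (rule power2_le_imp_le) (rule K.hnorm_ge_0[OF assms])
qed

end

text \<open>
  A Cauchy sequence converges in each coordinate. The Cauchy estimate for finitely many coordinates
  passes to the limit, and its bound does not depend on their number.
\<close>

lemma l2_hilbert:
  fixes H :: "'a cspace"
  assumes H: "hilbert_space H"
  shows "hilbert_space (l2 H)"
proof -
  interpret H: hilbert_space H by fact
  note HI = H.complex_inner_space_axioms
  interpret K: complex_inner_space "l2 H" by (rule l2_inner_space[OF HI])
  show ?thesis
  proof (rule K.hilbert_spaceI)
    fix \<sigma> assume \<sigma>: "cauchy_in (l2 H) \<sigma>"
    then have \<sigma>K: "\<sigma> n \<in> carrier (l2 H)" for n by (simp add: cauchy_in_def)
    note \<sigma>H = l2D[OF \<sigma>K]
    have diffK: "\<sigma> m \<ominus>\<^bsub>l2 H\<^esub> \<sigma> n \<in> carrier (l2 H)" for m n using \<sigma>K by simp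
    have diff_apply: "(\<sigma> m \<ominus>\<^bsub>l2 H\<^esub> \<sigma> n) k = \<sigma> m k \<ominus>\<^bsub>H\<^esub> \<sigma> n k" for m n k
      by (simp add: minus_l2[OF HI \<sigma>K \<sigma>K])
    have comp: "hnorm H (\<sigma> m k \<ominus>\<^bsub>H\<^esub> \<sigma> n k) \<le> hnorm (l2 H) (\<sigma> m \<ominus>\<^bsub>l2 H\<^esub> \<sigma> n)" for m n k
      using hnorm_component_le[OF HI diffK[of m n], of k] by (simp only: diff_apply)
    have "cauchy_in H (\<lambda>n. \<sigma> n k)" for k
      using \<sigma> \<sigma>H comp unfolding cauchy_in_def by (meson order_le_less_trans)
    then have "\<exists>x. conv_to H (\<lambda>n. \<sigma> n k) x" for k using H.cauchy_conv by metis
    then obtain g where g: "\<And>k. conv_to H (\<lambda>n. \<sigma> n k) (g k)" by metis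
    note gH = H.conv_to_carrier(1)[OF g]
    have tail: "\<exists>N. \<forall>m\<ge>N. summable (\<lambda>k. (hnorm H (\<sigma> m k \<ominus>\<^bsub>H\<^esub> g k))\<^sup>2)
        \<and> (\<Sum>k. (hnorm H (\<sigma> m k \<ominus>\<^bsub>H\<^esub> g k))\<^sup>2) \<le> e\<^sup>2" if e: "e > 0" for e
    proof -
      obtain N where N: "\<And>m n. \<lbrakk>N \<le> m; N \<le> n\<rbrakk> \<Longrightarrow> hnorm (l2 H) (\<sigma> m \<ominus>\<^bsub>l2 H\<^esub> \<sigma> n) < e"
        using \<sigma> e unfolding cauchy_in_def by blast
      have bnd: "(\<Sum>k<M. (hnorm H (\<sigma> m k \<ominus>\<^bsub>H\<^esub> g k))\<^sup>2) \<le> e\<^sup>2" if m: "N \<le> m" for m M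
      proof -
        have "conv_to H (\<lambda>n. \<sigma> m k \<ominus>\<^bsub>H\<^esub> \<sigma> n k) (\<sigma> m k \<ominus>\<^bsub>H\<^esub> g k)" for k
        proof (rule H.conv_toI)
          show "(\<lambda>n. hnorm H (\<sigma> n k \<ominus>\<^bsub>H\<^esub> g k)) \<longlonglongrightarrow> 0" using g[of k] by (simp add: conv_to_def)
          fix n
          have "\<sigma> m k \<ominus>\<^bsub>H\<^esub> \<sigma> n k \<ominus>\<^bsub>H\<^esub> (\<sigma> m k \<ominus>\<^bsub>H\<^esub> g k) = g k \<ominus>\<^bsub>H\<^esub> \<sigma> n k"
            using \<sigma>H gH by (intro H.vec_eqI) (auto simp: H.cinner_rules)
          then show "hnorm H (\<sigma> m k \<ominus>\<^bsub>H\<^esub> \<sigma> n k \<ominus>\<^bsub>H\<^esub> (\<sigma> m k \<ominus>\<^bsub>H\<^esub> g k)) \<le> hnorm H (\<sigma> n k \<ominus>\<^bsub>H\<^esub> g k)"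
            using H.hnorm_minus_commute[OF gH \<sigma>H] by simp
        qed (use \<sigma>H gH in auto)
        then have lim: "(\<lambda>n. \<Sum>k<M. (hnorm H (\<sigma> m k \<ominus>\<^bsub>H\<^esub> \<sigma> n k))\<^sup>2)
            \<longlonglongrightarrow> (\<Sum>k<M. (hnorm H (\<sigma> m k \<ominus>\<^bsub>H\<^esub> g k))\<^sup>2)"
          by (intro tendsto_sum tendsto_power H.conv_to_hnorm)
        have "(\<Sum>k<M. (hnorm H (\<sigma> m k \<ominus>\<^bsub>H\<^esub> \<sigma> n k))\<^sup>2) \<le> e\<^sup>2" if n: "N \<le> n" for n
        proof -
          have "(\<Sum>k<M. (hnorm H (\<sigma> m k \<ominus>\<^bsub>H\<^esub> \<sigma> n k))\<^sup>2) \<le> (hnorm (l2 H) (\<sigma> m \<ominus>\<^bsub>l2 H\<^esub> \<sigma> n))\<^sup>2"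
            using sum_le_hnorm_l2[OF HI diffK[of m n], of M] by (simp only: diff_apply)
          also have "\<dots> \<le> e\<^sup>2" using N[OF m n] K.hnorm_ge_0[OF diffK] by (intro power_mono) auto
          finally show ?thesis .
        qed
        then show ?thesis using LIMSEQ_le_const2[OF lim] by blast
      qed
      have "summable (\<lambda>k. (hnorm H (\<sigma> m k \<ominus>\<^bsub>H\<^esub> g k))\<^sup>2)" if "N \<le> m" for m
        by (rule summableI_nonneg_bounded[of _ "e\<^sup>2"]) (use bnd[OF that] in auto)
      then show ?thesis using bnd suminf_le_const by (intro exI[of _ N]) blast
    qed
    have gK: "g \<in> carrier (l2 H)"
    proof -
      obtain N where "summable (\<lambda>k. (hnorm H (\<sigma> N k \<ominus>\<^bsub>H\<^esub> g k))\<^sup>2)" using tail[of 1] by auto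
      then have d: "(\<lambda>k. \<sigma> N k \<ominus>\<^bsub>H\<^esub> g k) \<in> carrier (l2 H)" using \<sigma>H gH by (simp add: carrier_l2)
      have "\<sigma> N \<ominus>\<^bsub>l2 H\<^esub> (\<lambda>k. \<sigma> N k \<ominus>\<^bsub>H\<^esub> g k) = g"
        unfolding minus_l2[OF HI \<sigma>K d] using \<sigma>H gH by (intro ext H.vec_eqI) (auto simp: H.cinner_rules)
      then show ?thesis using K.minus_closed[OF \<sigma>K d, of N] by simp
    qed
    have "(\<lambda>n. hnorm (l2 H) (\<sigma> n \<ominus>\<^bsub>l2 H\<^esub> g)) \<longlonglongrightarrow> 0"
    proof (rule LIMSEQ_I)
      fix e :: real assume e: "e > 0"
      obtain N where N: "\<And>m. N \<le> m \<Longrightarrow> (\<Sum>k. (hnorm H (\<sigma> m k \<ominus>\<^bsub>H\<^esub> g k))\<^sup>2) \<le> (e/2)\<^sup>2"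
        using tail[of "e/2"] e by auto
      have "norm (hnorm (l2 H) (\<sigma> m \<ominus>\<^bsub>l2 H\<^esub> g) - 0) < e" if "N \<le> m" for m
      proof -
        have c: "\<sigma> m \<ominus>\<^bsub>l2 H\<^esub> g \<in> carrier (l2 H)" using \<sigma>K gK by simp
        have "(hnorm (l2 H) (\<sigma> m \<ominus>\<^bsub>l2 H\<^esub> g))\<^sup>2 \<le> (e/2)\<^sup>2"
          unfolding hnorm_l2_sq[OF HI c] using N[OF that] \<sigma>K gK by (simp add: minus_l2[OF HI])
        then have "hnorm (l2 H) (\<sigma> m \<ominus>\<^bsub>l2 H\<^esub> g) \<le> e/2"
          by (rule power2_le_imp_le) (use e in simp)
        then show ?thesis using e K.hnorm_ge_0[OF c] by simp
      qed
      then show "\<exists>N. \<forall>n\<ge>N. norm (hnorm (l2 H) (\<sigma> n \<ominus>\<^bsub>l2 H\<^esub> g) - 0) < e" by blast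
    qed
    then have "conv_to (l2 H) \<sigma> g" using \<sigma>K gK by (simp add: conv_to_def)
    then show "\<exists>x. conv_to (l2 H) \<sigma> x" by blast
  qed
qed

section \<open>Isometric embeddings and liftings\<close>

lemma (in space_pair) proj_onto_eqI:
  assumes J: "isometric_embedding H K J" and k: "k \<in> carrier K" and h: "h \<in> carrier H"
    and orth: "\<And>g. g \<in> carrier H \<Longrightarrow> cinner K (k \<ominus>\<^bsub>K\<^esub> J h) (J g) = 0"
  shows "proj_onto H K J k = h"
  unfolding proj_onto_def
proof (rule the_equality)
  have Jb: "J \<in> bounded_ops H K"
    and iso: "\<And>x y. \<lbrakk>x \<in> carrier H; y \<in> carrier H\<rbrakk> \<Longrightarrow> cinner K (J x) (J y) = cinner H x y"
    using J by (auto simp: isometric_embedding_def)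
  fix h' assume h': "h' \<in> carrier H \<and> (\<forall>g\<in>carrier H. cinner K (k \<ominus>\<^bsub>K\<^esub> J h') (J g) = 0)"
  show "h' = h"
  proof (rule H.vec_eqI)
    fix z assume z: "z \<in> carrier H"
    have "cinner K k (J z) = cinner H h z" "cinner K k (J z) = cinner H h' z"
      using orth[OF z] h' z h k bounded_opsD(1)[OF Jb] by (auto simp: K.cinner_minus_left iso)
    then show "cinner H h' z = cinner H h z" by simp
  qed (use h h' in auto)
qed (use h orth in auto)

lemma (in space_pair) proj_onto_orthogonal:
  assumes H: "hilbert_space H" and J: "isometric_embedding H K J" and k: "k \<in> carrier K"
    and g: "g \<in> carrier H"
  shows "cinner K (k \<ominus>\<^bsub>K\<^esub> J (proj_onto H K J k)) (J g) = 0"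
proof -
  have Jb: "J \<in> bounded_ops H K"
    and iso: "\<And>x y. \<lbrakk>x \<in> carrier H; y \<in> carrier H\<rbrakk> \<Longrightarrow> cinner K (J x) (J y) = cinner H x y"
    using J by (auto simp: isometric_embedding_def)
  obtain P where P: "P \<in> bounded_ops K H"
    "\<forall>x\<in>carrier H. \<forall>y\<in>carrier K. cinner K (J x) y = cinner H x (P y)"
    using adjoint_exists[OF H Jb] by blast
  have Pk: "P k \<in> carrier H" using bounded_opsD(1)[OF P(1) k] .
  have orth: "cinner K (k \<ominus>\<^bsub>K\<^esub> J (P k)) (J g) = 0" if g: "g \<in> carrier H" for g
    using g k Pk bspec[OF bspec[OF P(2) g] k] bounded_opsD(1)[OF Jb]
      K.cinner_cnj[of "J g" k] H.cinner_cnj[of g "P k"]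
    by (simp add: K.cinner_minus_left iso)
  have "proj_onto H K J k = P k" by (rule proj_onto_eqI[OF J k Pk orth])
  then show ?thesis using orth[OF g] by simp
qed

text \<open>
  Let \<open>E x\<close> be the component of \<open>S J x\<close> orthogonal to the embedded space. Then
  \<open>A - T\<^sup>* T = E\<^sup>* E\<close> and, since \<open>S\<close> is a quasi-isometry, \<open>A - T\<^sup>* A T = (S E)\<^sup>* (S E)\<close>. The operator
  \<open>S\<close> is bounded and bounded below, so the two forms are equivalent.
\<close>

lemma range_majorant_of_lifting:
  fixes H :: "'a cspace" and K :: "'k cspace"
  assumes H: "hilbert_space H" and T: "T \<in> bounded_ops H H"
    and lift: "left_inv_quasi_isometric_lifting H K J T S" and inv: "gram_invariant H K J S"
  shows "has_range_majorant H T"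
proof -
  have K: "hilbert_space K" and J: "isometric_embedding H K J" and Sb: "S \<in> bounded_ops K K"
    and proj: "\<And>k. k \<in> carrier K \<Longrightarrow> proj_onto H K J (S k) = T (proj_onto H K J k)"
    and li: "left_invertible K S" and qi: "quasi_isometry K S"
    using lift by (auto simp: left_inv_quasi_isometric_lifting_def lifting_def)
  interpret H: hilbert_space H by fact
  interpret K: hilbert_space K by fact
  interpret HK: space_pair H K ..
  interpret KK: space_pair K K ..
  have Jb: "J \<in> bounded_ops H K"
    and iso: "\<And>x y. \<lbrakk>x \<in> carrier H; y \<in> carrier H\<rbrakk> \<Longrightarrow> cinner K (J x) (J y) = cinner H x y"
    using J by (auto simp: isometric_embedding_def)
  note [simp] = bounded_opsD[OF T] bounded_opsD[OF Sb] bounded_opsD[OF Jb]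
    bounded_opsD[OF K.gram_bounded[OF Sb]] H.smult_carrier K.smult_carrier
  have norm_J: "hnorm K (J x) = hnorm H x" if "x \<in> carrier H" for x
    using that by (simp add: hnorm_def iso)
  obtain b where b: "b > 0" "\<And>k. k \<in> carrier K \<Longrightarrow> hnorm K k \<le> b * hnorm K (S k)"
    using li K.left_invertible_iff_bounded_below[OF Sb] by blast
  obtain c where c: "c > 0" "\<And>k. k \<in> carrier K \<Longrightarrow> hnorm K (S k) \<le> c * hnorm K k"
    using KK.bound_pos[OF Sb] by metis
  have qi': "cinner K (S (S k)) (S (S l)) = cinner K (S k) (S l)" if "k \<in> carrier K" "l \<in> carrier K" for k l
    using qi that K.quasi_isometry_iff[OF Sb] by blast
  define A where "A = gram_restr H K J S"
  have A_carrier [simp]: "A x \<in> carrier H" and JA: "J (A x) = gram K S (J x)" if x: "x \<in> carrier H" for x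
  proof -
    have "gram K S (J x) \<in> J ` carrier H" using inv x unfolding gram_invariant_def by blast
    then show "A x \<in> carrier H" "J (A x) = gram K S (J x)"
      using x by (simp_all add: A_def gram_restr_def inv_into_into f_inv_into_f)
  qed
  have A_form: "cinner H (A x) y = cinner K (S (J x)) (S (J y))" if "x \<in> carrier H" "y \<in> carrier H" for x y
    using that iso[of "A x" y] by (simp add: JA K.cinner_gram[OF Sb])
  obtain g where g: "\<And>k. k \<in> carrier K \<Longrightarrow> hnorm K (gram K S k) \<le> g * hnorm K k"
    using KK.bound_pos[OF K.gram_bounded[OF Sb]] by metis
  have Ab: "A \<in> bounded_ops H H"
  proof (rule bounded_opsI[where C=g])
    fix x y assume "x \<in> carrier H" "y \<in> carrier H"
    then show "A (x \<oplus>\<^bsub>H\<^esub> y) = A x \<oplus>\<^bsub>H\<^esub> A y"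
      by (intro H.vec_eqI) (auto simp: A_form H.cinner_rules K.cinner_rules)
  next
    fix x d assume "x \<in> carrier H"
    then show "A (d \<odot>\<^bsub>H\<^esub> x) = d \<odot>\<^bsub>H\<^esub> A x"
      by (intro H.vec_eqI) (auto simp: A_form H.cinner_rules K.cinner_rules)
  next
    fix x assume x: "x \<in> carrier H"
    then show "hnorm H (A x) \<le> g * hnorm H x"
      using g[of "J x"] norm_J[of "A x"] by (simp add: JA norm_J)
  qed (simp_all, simp add: A_def gram_restr_def)
  define V where "V = compose (carrier H) S J"
  have V: "V \<in> bounded_ops H K"
    unfolding V_def by (intro bounded_ops_compose[OF _ _ _ Sb Jb]) unfold_locales
  have A_inv: "op_invertible H A"
  proof (rule HK.gram_form_invertible[OF H K V b(1) _ Ab])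
    show "hnorm H x \<le> b * hnorm K (V x)" if "x \<in> carrier H" for x
      using b(2)[of "J x"] that by (simp add: V_def compose_def norm_J)
  qed (simp add: V_def compose_def A_form)
  define E where "E x = S (J x) \<ominus>\<^bsub>K\<^esub> J (T x)" for x
  have E [simp]: "E x \<in> carrier K" if "x \<in> carrier H" for x using that by (simp add: E_def)
  have E_orth: "cinner K (E x) (J y) = 0" if x: "x \<in> carrier H" and y: "y \<in> carrier H" for x y
  proof -
    have "proj_onto H K J (J x) = x"
      by (rule HK.proj_onto_eqI[OF J]) (use x in \<open>auto simp: K.minus_self K.cinner_zero_left\<close>)
    then have "proj_onto H K J (S (J x)) = T x" using proj[of "J x"] x by simp
    then show ?thesis using HK.proj_onto_orthogonal[OF H J _ y, of "S (J x)"] x by (simp add: E_def)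
  qed
  have dec: "S (J x) = J (T x) \<oplus>\<^bsub>K\<^esub> E x" if x: "x \<in> carrier H" for x
    using x by (intro K.vec_eqI) (auto simp: E_def K.cinner_rules)
  have norm1: "(hnorm K (S (J x)))\<^sup>2 = (hnorm H (T x))\<^sup>2 + (hnorm K (E x))\<^sup>2" if x: "x \<in> carrier H" for x
    unfolding dec[OF x] using x K.cinner_cnj[of "E x" "J (T x)"]
    by (subst K.hnorm_add_sq_orthogonal) (auto simp: E_orth norm_J)
  have norm2: "(hnorm K (S (J x)))\<^sup>2 = (hnorm K (S (J (T x))))\<^sup>2 + (hnorm K (S (E x)))\<^sup>2"
    if x: "x \<in> carrier H" for x
  proof -
    have "cinner K (S (J (T x))) (S (E x)) = cinner K (J (A (T x))) (E x)"
      using x by (simp add: JA K.cinner_gram[OF Sb])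
    also have "\<dots> = 0" using x K.cinner_cnj[of "E x" "J (A (T x))"] by (simp add: E_orth)
    finally have orth: "cinner K (S (J (T x))) (S (E x)) = 0" .
    have "(hnorm K (S (J x)))\<^sup>2 = (hnorm K (S (S (J x))))\<^sup>2"
      using x by (simp add: K.hnorm_sq qi')
    also have "S (S (J x)) = S (J (T x)) \<oplus>\<^bsub>K\<^esub> S (E x)"
      using x dec[OF x] by simp
    finally show ?thesis using x orth by (simp add: K.hnorm_add_sq_orthogonal)
  qed
  define AT where "AT = op_comp H (adj H T) (op_comp H A T)"
  have ATb: "AT \<in> bounded_ops H H"
    unfolding AT_def by (intro H.op_comp_bounded H.adj_bounded T Ab)
  have AT_form: "cinner H (AT x) y = cinner H (A (T x)) (T y)" if "x \<in> carrier H" "y \<in> carrier H" for x y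
    using that by (simp add: AT_def compose_def H.cinner_adj_left[OF T])
  note Gb = H.gram_bounded[OF T]
  have A_norm: "cinner H (A x) x = complex_of_real ((hnorm K (S (J x)))\<^sup>2)" if "x \<in> carrier H" for x
    using that by (simp add: A_form K.cinner_self)
  have f1: "cinner H (A x) x - cinner H (gram H T x) x = complex_of_real ((hnorm K (E x))\<^sup>2)"
    if x: "x \<in> carrier H" for x
    using x by (simp add: A_norm norm1 H.cinner_gram[OF T] H.cinner_self)
  have f2: "cinner H (A x) x - cinner H (AT x) x = complex_of_real ((hnorm K (S (E x)))\<^sup>2)"
    if x: "x \<in> carrier H" for x
    using x by (simp add: A_norm norm2 AT_form)
  have sq: "complex_of_real (r\<^sup>2) \<in> \<real>\<^sub>\<ge>\<^sub>0" for r :: real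
    by (simp only: nonneg_Reals_of_real_iff zero_le_power2)
  have le1: "op_le H (gram H T) A"
    unfolding H.op_le_iff[OF Gb Ab] by (intro ballI) (simp only: f1 sq)
  have le2: "op_le H AT A"
    unfolding H.op_le_iff[OF ATb Ab] by (intro ballI) (simp only: f2 sq)
  have pos: "op_positive H (op_diff H A (gram H T))" "op_positive H (op_diff H A AT)"
    using le1 le2 by (simp_all add: op_le_def)
  have n1: "hnorm H (op_sqrt H (op_diff H A (gram H T)) x) = hnorm K (E x)"
    and n2: "hnorm H (op_sqrt H (op_diff H A AT) x) = hnorm K (S (E x))" if x: "x \<in> carrier H" for x
  proof -
    note 1 = H.cinner_op_sqrt[OF pos(1) x x] and 2 = H.cinner_op_sqrt[OF pos(2) x x]
    have "cinner H (op_diff H A (gram H T) x) x = complex_of_real ((hnorm K (E x))\<^sup>2)"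
      "cinner H (op_diff H A AT x) x = complex_of_real ((hnorm K (S (E x)))\<^sup>2)"
      using f1[OF x] f2[OF x] x bounded_opsD(1)[OF Gb x] bounded_opsD(1)[OF ATb x]
      by (simp_all add: op_diff_def H.cinner_minus_left)
    then show "hnorm H (op_sqrt H (op_diff H A (gram H T)) x) = hnorm K (E x)"
      "hnorm H (op_sqrt H (op_diff H A AT) x) = hnorm K (S (E x))"
      unfolding hnorm_def[of H] 1 2 using x K.hnorm_ge_0 by simp_all
  qed
  interpret P12: positive_pair H "op_sqrt H (op_diff H A (gram H T))" "op_sqrt H (op_diff H A AT)"
    by unfold_locales (intro H.op_sqrt_positive pos)+
  interpret P21: positive_pair H "op_sqrt H (op_diff H A AT)" "op_sqrt H (op_diff H A (gram H T))"
    by unfold_locales (intro H.op_sqrt_positive pos)+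
  have "op_range H (op_sqrt H (op_diff H A (gram H T))) = op_range H (op_sqrt H (op_diff H A AT))"
    using P12.bound_imp_range_subset[of c] P21.bound_imp_range_subset[of b] b c
    by (simp add: n1 n2 set_eq_subset)
  then show ?thesis
    unfolding has_range_majorant_def AT_def using A_inv le1 le2 unfolding AT_def by blast
qed

section \<open>The model lifting\<close>

text \<open>
  Here \<open>R\<close> and \<open>C R\<close> play the parts of the square roots of \<open>A - T\<^sup>* T\<close> and \<open>A - T\<^sup>* A T\<close>, and the constants
  \<open>a\<close>, \<open>b\<close> express that \<open>A\<close> and \<open>C\<close> are bounded below. The last assumption singles out the canonical
  choice of \<open>C\<close>, which is the identity when the two roots coincide.
\<close>

locale model_lifting = hilbert_space H for H :: "'a cspace" +
  fixes T A R C :: "'a \<Rightarrow> 'a" and a b :: real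
  assumes T: "T \<in> bounded_ops H H" and A: "A \<in> bounded_ops H H"
    and R: "R \<in> bounded_ops H H" and C: "C \<in> bounded_ops H H"
    and R_form: "\<And>x y. \<lbrakk>x \<in> carrier H; y \<in> carrier H\<rbrakk>
      \<Longrightarrow> cinner H (R x) (R y) = cinner H (A x) y - cinner H (T x) (T y)"
    and CR_form: "\<And>x y. \<lbrakk>x \<in> carrier H; y \<in> carrier H\<rbrakk>
      \<Longrightarrow> cinner H (C (R x)) (C (R y)) = cinner H (A x) y - cinner H (A (T x)) (T y)"
    and a: "a > 0" and A_below: "\<And>x. x \<in> carrier H \<Longrightarrow> (hnorm H x)\<^sup>2 \<le> a * Re (cinner H (A x) x)"
    and b: "b > 0" and C_below: "\<And>x. x \<in> carrier H \<Longrightarrow> hnorm H x \<le> b * hnorm H (C x)"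
    and C_id: "(\<And>x. x \<in> carrier H \<Longrightarrow> A (T x) = T x) \<Longrightarrow> C = id_op H"
begin

definition K :: "(nat \<Rightarrow> 'a) cspace" where "K = l2 H"

definition J :: "'a \<Rightarrow> nat \<Rightarrow> 'a" where
  "J = (\<lambda>x\<in>carrier H. \<lambda>n. if n = 0 then x else \<zero>\<^bsub>H\<^esub>)"

definition S :: "(nat \<Rightarrow> 'a) \<Rightarrow> nat \<Rightarrow> 'a" where
  "S = (\<lambda>f\<in>carrier K. \<lambda>n. if n = 0 then T (f 0) else if n = 1 then R (f 0)
     else if n = 2 then C (f 1) else f (n - 1))"

lemmas op_simps = bounded_opsD[OF T] bounded_opsD[OF A] bounded_opsD[OF R] bounded_opsD[OF C]
  smult_carrier

lemma zero_simps: "T \<zero>\<^bsub>H\<^esub> = \<zero>\<^bsub>H\<^esub>" "A \<zero>\<^bsub>H\<^esub> = \<zero>\<^bsub>H\<^esub>" "R \<zero>\<^bsub>H\<^esub> = \<zero>\<^bsub>H\<^esub>" "C \<zero>\<^bsub>H\<^esub> = \<zero>\<^bsub>H\<^esub>"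
  using space_pair.bounded_ops_zero[OF space_pair_self] T A R C by auto

lemma K_hilbert: "hilbert_space K"
  unfolding K_def by (rule l2_hilbert) (rule hilbert_space_axioms)

sublocale K: hilbert_space K by (rule K_hilbert)

lemma HK: "space_pair H K" and KK: "space_pair K K" by unfold_locales

lemma KD: "f \<in> carrier K \<Longrightarrow> f n \<in> carrier H"
  by (simp add: K_def l2D)

lemma K_simps: "f \<oplus>\<^bsub>K\<^esub> g = (\<lambda>n. f n \<oplus>\<^bsub>H\<^esub> g n)" "c \<odot>\<^bsub>K\<^esub> f = (\<lambda>n. c \<odot>\<^bsub>H\<^esub> f n)" "\<zero>\<^bsub>K\<^esub> = (\<lambda>_. \<zero>\<^bsub>H\<^esub>)"
  by (simp_all add: K_def)

lemma S_apply:
  assumes "f \<in> carrier K"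
  shows "S f 0 = T (f 0)" "S f (Suc 0) = R (f 0)" "S f 2 = C (f (Suc 0))" "S f (Suc (Suc 0)) = C (f (Suc 0))"
    "S f (Suc (Suc (Suc n))) = f (Suc (Suc n))"
  using assms by (simp_all add: S_def)

text \<open>
  From the third coordinate on \<open>S\<close> acts on its argument as a plain shift, so these coordinates enter every
  computation only through this sum.
\<close>

definition tail :: "(nat \<Rightarrow> 'a) \<Rightarrow> (nat \<Rightarrow> 'a) \<Rightarrow> complex" where
  "tail f g = (\<Sum>n. cinner H (f (n + 2)) (g (n + 2)))"

lemma summable_K:
  assumes "f \<in> carrier K" "g \<in> carrier K" shows "summable (\<lambda>n. cinner H (f n) (g n))"
  using l2_cinner_summable[OF complex_inner_space_axioms] assms by (simp add: K_def)

lemma cinner_K: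
  assumes "f \<in> carrier K" "g \<in> carrier K"
  shows "cinner K f g = cinner H (f 0) (g 0) + cinner H (f 1) (g 1) + tail f g"
  using suminf_split_initial_segment[OF summable_K[OF assms], of 2]
  by (simp add: K_def cinner_l2 tail_def numeral_2_eq_2)

lemma hnorm_K_sq:
  assumes "f \<in> carrier K"
  shows "(hnorm K f)\<^sup>2 = (hnorm H (f 0))\<^sup>2 + (hnorm H (f 1))\<^sup>2 + Re (tail f f)"
  using assms by (simp add: K.hnorm_sq cinner_K hnorm_sq KD)

lemma tail_nonneg: "f \<in> carrier K \<Longrightarrow> 0 \<le> Re (tail f f)"
proof -
  assume f: "f \<in> carrier K"
  have s: "summable (\<lambda>n. cinner H (f (n + 2)) (f (n + 2)))"
    using summable_K[OF f f] summable_ignore_initial_segment[of "\<lambda>n. cinner H (f n) (f n)" 2] by simp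
  have "Re (tail f f) = (\<Sum>n. Re (cinner H (f (n + 2)) (f (n + 2))))"
    unfolding tail_def by (rule bounded_linear.suminf[OF bounded_linear_Re s])
  also have "\<dots> \<ge> 0"
    by (rule suminf_nonneg) (use summable_Re[OF s] cinner_self_nonneg KD[OF f] in auto)
  finally show ?thesis .
qed

lemma S_closed: assumes f: "f \<in> carrier K" shows "S f \<in> carrier K"
proof -
  have "S f n \<in> carrier H" for n
    using f KD[OF f] by (simp add: S_def op_simps)
  moreover have "summable (\<lambda>n. (hnorm H (S f (n + 3)))\<^sup>2)"
  proof -
    have "summable (\<lambda>n. (hnorm H (f (n + 2)))\<^sup>2)"
      using f summable_ignore_initial_segment[of "\<lambda>n. (hnorm H (f n))\<^sup>2" 2] by (simp add: K_def carrier_l2)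
    then show ?thesis using S_apply(5)[OF f] by (simp add: numeral_eq_Suc)
  qed
  then have "summable (\<lambda>n. (hnorm H (S f n))\<^sup>2)"
    using summable_iff_shift[of "\<lambda>n. (hnorm H (S f n))\<^sup>2" 3] by blast
  ultimately show ?thesis by (simp add: K_def carrier_l2)
qed

lemma tail_S:
  assumes f: "f \<in> carrier K" and g: "g \<in> carrier K"
  shows "tail (S f) (S g) = cinner H (C (f 1)) (C (g 1)) + tail f g"
proof -
  have s: "summable (\<lambda>n. cinner H (S f (n + 2)) (S g (n + 2)))"
    using summable_K[OF S_closed[OF f] S_closed[OF g]]
      summable_ignore_initial_segment[of "\<lambda>n. cinner H (S f n) (S g n)" 2] by simp
  show ?thesis
    unfolding tail_def using suminf_split_head[OF s] f g by (simp add: S_apply)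
qed

text \<open>
  The first two coordinates of \<open>S f\<close> combine by \<open>T\<^sup>* T + R\<^sup>* R = A\<close>; the Gram operator of \<open>S\<close> is therefore
  diagonal with entries \<open>A\<close>, \<open>C\<^sup>* C\<close>, \<open>I\<close>, \<open>I\<close>, ...
\<close>

lemma cinner_S_S:
  assumes f: "f \<in> carrier K" and g: "g \<in> carrier K"
  shows "cinner K (S f) (S g) = cinner H (A (f 0)) (g 0) + cinner H (C (f 1)) (C (g 1)) + tail f g"
  using f g by (simp add: cinner_K S_closed S_apply tail_S R_form KD)

lemma S_bounded: "S \<in> bounded_ops K K"
proof -
  obtain c where c: "c > 0" "\<And>x. x \<in> carrier H \<Longrightarrow> hnorm H (C x) \<le> c * hnorm H x"
    using space_pair.bound_pos[OF space_pair_self C] by metis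
  obtain d where d: "d > 0" "\<And>x. x \<in> carrier H \<Longrightarrow> hnorm H (A x) \<le> d * hnorm H x"
    using space_pair.bound_pos[OF space_pair_self A] by metis
  have le: "hnorm K (S f) \<le> sqrt (d + c\<^sup>2 + 1) * hnorm K f" if f: "f \<in> carrier K" for f
  proof (rule power2_le_imp_le)
    have "Re (cinner H (A (f 0)) (f 0)) \<le> hnorm H (A (f 0)) * hnorm H (f 0)"
      using Cauchy_Schwarz[of "A (f 0)" "f 0"] complex_Re_le_cmod order_trans KD[OF f] op_simps(4) by blast
    also have "\<dots> \<le> d * hnorm H (f 0) * hnorm H (f 0)"
      using d(2) KD[OF f] by (intro mult_right_mono hnorm_ge_0) auto
    finally have 1: "Re (cinner H (A (f 0)) (f 0)) \<le> d * (hnorm H (f 0))\<^sup>2" by (simp add: power2_eq_square)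
    have "(hnorm H (C (f 1)))\<^sup>2 \<le> (c * hnorm H (f 1))\<^sup>2"
      using c(2)[OF KD[OF f]] KD[OF f] by (intro power_mono hnorm_ge_0) (auto simp: op_simps)
    then have 2: "(hnorm H (C (f 1)))\<^sup>2 \<le> c\<^sup>2 * (hnorm H (f 1))\<^sup>2" by (simp add: power_mult_distrib)
    have "(hnorm K (S f))\<^sup>2 = Re (cinner H (A (f 0)) (f 0)) + (hnorm H (C (f 1)))\<^sup>2 + Re (tail f f)"
      using f S_closed[OF f] by (simp add: K.hnorm_sq cinner_S_S hnorm_sq KD op_simps)
    also have "\<dots> \<le> (d + c\<^sup>2 + 1) * (hnorm K f)\<^sup>2"
      unfolding hnorm_K_sq[OF f] distrib_left
      using 1 2 tail_nonneg[OF f] d(1)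
      by (intro add_mono) (auto simp: algebra_simps intro: order_trans)
    finally show "(hnorm K (S f))\<^sup>2 \<le> (sqrt (d + c\<^sup>2 + 1) * hnorm K f)\<^sup>2"
      using d(1) by (simp add: power_mult_distrib)
    show "0 \<le> sqrt (d + c\<^sup>2 + 1) * hnorm K f" using d(1) K.hnorm_ge_0[OF f] by simp
  qed
  show ?thesis
  proof (rule bounded_opsI[where C="sqrt (d + c\<^sup>2 + 1)"])
    fix f g assume fg: "f \<in> carrier K" "g \<in> carrier K"
    then have "f \<oplus>\<^bsub>K\<^esub> g \<in> carrier K" by simp
    then show "S (f \<oplus>\<^bsub>K\<^esub> g) = S f \<oplus>\<^bsub>K\<^esub> S g"
      using fg KD[OF fg(1)] KD[OF fg(2)] by (auto simp: S_def K_simps op_simps)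
  next
    fix f d assume f: "f \<in> carrier K"
    then have "d \<odot>\<^bsub>K\<^esub> f \<in> carrier K" by (simp add: K.smult_carrier)
    then show "S (d \<odot>\<^bsub>K\<^esub> f) = d \<odot>\<^bsub>K\<^esub> S f"
      using f KD[OF f] by (auto simp: S_def K_simps op_simps)
  qed (use S_closed le in \<open>auto simp: S_def\<close>)
qed

lemma S_below:
  assumes f: "f \<in> carrier K"
  shows "hnorm K f \<le> sqrt (a + b\<^sup>2 + 1) * hnorm K (S f)"
proof (rule power2_le_imp_le)
  have 1: "(hnorm H (f 0))\<^sup>2 \<le> a * Re (cinner H (A (f 0)) (f 0))" using A_below KD[OF f] by blast
  have "(hnorm H (f 1))\<^sup>2 \<le> (b * hnorm H (C (f 1)))\<^sup>2"
    using C_below KD[OF f] by (intro power_mono hnorm_ge_0) auto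
  then have 2: "(hnorm H (f 1))\<^sup>2 \<le> b\<^sup>2 * (hnorm H (C (f 1)))\<^sup>2" by (simp add: power_mult_distrib)
  define p q r where "p = Re (cinner H (A (f 0)) (f 0))" and "q = (hnorm H (C (f 1)))\<^sup>2" and "r = Re (tail f f)"
  have p: "0 \<le> p"
  proof -
    have "0 \<le> a * p" using 1 unfolding p_def by (meson order_trans zero_le_power2)
    then show ?thesis using a by (simp add: zero_le_mult_iff)
  qed
  have qr: "0 \<le> q" "0 \<le> r" using tail_nonneg[OF f] by (auto simp: q_def r_def)
  have Sf: "(hnorm K (S f))\<^sup>2 = p + q + r"
    using f S_closed[OF f] by (simp add: K.hnorm_sq cinner_S_S hnorm_sq KD op_simps p_def q_def r_def)
  have "(hnorm K f)\<^sup>2 \<le> a * p + b\<^sup>2 * q + r"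
    unfolding hnorm_K_sq[OF f] using 1 2 by (simp add: p_def q_def r_def)
  also have "\<dots> \<le> (a + b\<^sup>2 + 1) * (p + q + r)"
    using p qr a by (simp add: algebra_simps)
  finally show "(hnorm K f)\<^sup>2 \<le> (sqrt (a + b\<^sup>2 + 1) * hnorm K (S f))\<^sup>2"
    using a Sf by (simp add: power_mult_distrib)
  show "0 \<le> sqrt (a + b\<^sup>2 + 1) * hnorm K (S f)" using a K.hnorm_ge_0[OF S_closed[OF f]] by simp
qed

lemma S_left_invertible: "left_invertible K S"
  unfolding K.left_invertible_iff_bounded_below[OF S_bounded]
  using a S_below by (intro exI[of _ "sqrt (a + b\<^sup>2 + 1)"]) (simp add: add_pos_nonneg)

lemma S_quasi_isometry: "quasi_isometry K S"
  unfolding K.quasi_isometry_iff[OF S_bounded]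
  by (simp add: cinner_S_S S_closed S_apply tail_S CR_form KD)

lemma J_closed: "x \<in> carrier H \<Longrightarrow> J x \<in> carrier K"
  by (auto simp: J_def K_def carrier_l2 hnorm_zero split: if_splits intro!: summable_finite[of "{0}"])

lemma J_apply: "x \<in> carrier H \<Longrightarrow> J x 0 = x" "x \<in> carrier H \<Longrightarrow> J x (Suc n) = \<zero>\<^bsub>H\<^esub>"
  by (simp_all add: J_def)

lemma tail_J: "\<lbrakk>f \<in> carrier K; x \<in> carrier H\<rbrakk> \<Longrightarrow> tail f (J x) = 0" "\<lbrakk>f \<in> carrier K; x \<in> carrier H\<rbrakk> \<Longrightarrow> tail (J x) f = 0"
  by (simp_all add: tail_def J_apply cinner_zero_right cinner_zero_left KD)

lemma cinner_J: "\<lbrakk>f \<in> carrier K; x \<in> carrier H\<rbrakk> \<Longrightarrow> cinner K f (J x) = cinner H (f 0) x"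
  by (simp add: cinner_K J_closed J_apply tail_J cinner_zero_right KD)

lemma J_isometric: "isometric_embedding H K J"
proof -
  have iso: "cinner K (J x) (J y) = cinner H x y" if "x \<in> carrier H" "y \<in> carrier H" for x y
    using that by (simp add: cinner_J J_closed J_apply)
  have "J \<in> bounded_ops H K"
  proof (rule bounded_opsI[where C=1])
    show "hnorm K (J x) \<le> 1 * hnorm H x" if "x \<in> carrier H" for x
      using that by (simp add: hnorm_def iso)
    show "J x \<in> carrier K" if "x \<in> carrier H" for x using that by (rule J_closed)
  qed (auto simp: J_def K_simps smult_carrier intro!: ext)
  then show ?thesis using iso by (simp add: isometric_embedding_def)
qed

lemma J_bounded: "J \<in> bounded_ops H K" using J_isometric by (simp add: isometric_embedding_def)

lemma minus_K: "\<lbrakk>f \<in> carrier K; g \<in> carrier K\<rbrakk> \<Longrightarrow> f \<ominus>\<^bsub>K\<^esub> g = (\<lambda>n. f n \<ominus>\<^bsub>H\<^esub> g n)"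
  unfolding K_def by (rule minus_l2[OF complex_inner_space_axioms])

lemma proj_apply:
  assumes f: "f \<in> carrier K" shows "proj_onto H K J f = f 0"
proof (rule space_pair.proj_onto_eqI[OF HK J_isometric f KD[OF f]])
  fix g assume g: "g \<in> carrier H"
  have Jf: "J (f 0) \<in> carrier K" by (rule J_closed[OF KD[OF f]])
  have "(f \<ominus>\<^bsub>K\<^esub> J (f 0)) 0 = \<zero>\<^bsub>H\<^esub>"
    using KD[OF f] by (simp add: minus_K[OF f Jf] J_apply minus_self)
  then show "cinner K (f \<ominus>\<^bsub>K\<^esub> J (f 0)) (J g) = 0"
    using cinner_J[OF K.minus_closed[OF f Jf] g] g by (simp add: cinner_zero_left)
qed

lemma S_lifting: "left_inv_quasi_isometric_lifting H K J T S"
  unfolding left_inv_quasi_isometric_lifting_def lifting_def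
  using K_hilbert J_isometric S_bounded S_left_invertible S_quasi_isometry
  by (simp add: proj_apply S_closed S_apply)

lemma gram_J: assumes x: "x \<in> carrier H" shows "gram K S (J x) = J (A x)"
proof (rule K.vec_eqI)
  fix g assume g: "g \<in> carrier K"
  show "cinner K (gram K S (J x)) g = cinner K (J (A x)) g"
    using x g by (simp add: K.cinner_gram[OF S_bounded] cinner_S_S cinner_K J_closed J_apply tail_J
        zero_simps op_simps cinner_zero_left KD)
qed (use x bounded_opsD(1)[OF K.gram_bounded[OF S_bounded]] in \<open>auto simp: J_closed op_simps\<close>)

lemma S_gram_invariant: "gram_invariant H K J S"
  unfolding gram_invariant_def by (auto simp: gram_J op_simps)

lemma gram_restr_S: "gram_restr H K J S = A"
proof (rule bounded_ops_eqI[OF _ A])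
  have inj: "inj_on J (carrier H)" by (rule inj_onI) (metis J_apply(1))
  have eq: "gram_restr H K J S x = A x" if "x \<in> carrier H" for x
    using that inj by (simp add: gram_restr_def gram_J inv_into_f_f op_simps)
  then show "gram_restr H K J S x = A x" if "x \<in> carrier H" for x using that .
  have "gram_restr H K J S = A"
  proof
    fix x show "gram_restr H K J S x = A x"
      using eq A by (cases "x \<in> carrier H") (auto simp: gram_restr_def bounded_ops_def PiE_def extensional_def)
  qed
  then show "gram_restr H K J S \<in> bounded_ops H H" using A by simp
qed

abbreviation "L \<equiv> orth_compl H K J"
abbreviation "W \<equiv> compl_restr H K J S"

lemma L_hilbert: "hilbert_space L"
  by (rule orth_compl_hilbert[OF K_hilbert J_closed])

sublocale L: hilbert_space L by (rule L_hilbert)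

lemma carrier_L: "f \<in> carrier L \<longleftrightarrow> f \<in> carrier K \<and> f 0 = \<zero>\<^bsub>H\<^esub>"
proof -
  have "f 0 = \<zero>\<^bsub>H\<^esub>" if "f \<in> carrier K" "\<forall>h\<in>carrier H. cinner H (f 0) h = 0"
    using that by (intro vec_eqI) (auto simp: KD cinner_zero_left)
  then show ?thesis by (auto simp: carrier_orth_compl cinner_J cinner_zero_left)
qed

lemma W_apply: "f \<in> carrier L \<Longrightarrow> W f = S f"
  by (simp add: compl_restr_def)

lemma W_closed: "f \<in> carrier L \<Longrightarrow> W f \<in> carrier L"
  by (simp add: W_apply carrier_L S_closed S_apply zero_simps)

lemma W_bounded: "W \<in> bounded_ops L L"
proof -
  obtain c where c: "\<And>f. f \<in> carrier K \<Longrightarrow> hnorm K (S f) \<le> c * hnorm K f"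
    using space_pair.bound_pos[OF KK S_bounded] by metis
  have LK: "f \<in> carrier K" if "f \<in> carrier L" for f using that by (simp add: carrier_L)
  show ?thesis
  proof (rule bounded_opsI[where C=c])
    fix f g assume fg: "f \<in> carrier L" "g \<in> carrier L"
    then have "f \<oplus>\<^bsub>L\<^esub> g \<in> carrier L" by (rule L.a_closed)
    then show "W (f \<oplus>\<^bsub>L\<^esub> g) = W f \<oplus>\<^bsub>L\<^esub> W g"
      using fg LK bounded_opsD(2)[OF S_bounded] by (simp add: W_apply)
  next
    fix f d assume f: "f \<in> carrier L"
    then have "d \<odot>\<^bsub>L\<^esub> f \<in> carrier L" by (rule L.smult_carrier)
    then show "W (d \<odot>\<^bsub>L\<^esub> f) = d \<odot>\<^bsub>L\<^esub> W f"
      using f LK bounded_opsD(3)[OF S_bounded] by (simp add: W_apply)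
  next
    fix f assume "f \<in> carrier L"
    then show "hnorm L (W f) \<le> c * hnorm L f" using c LK by (simp add: W_apply)
  qed (use W_closed in \<open>auto simp: compl_restr_def\<close>)
qed

text \<open>
  The first two coordinates of \<open>W f\<close> vanish, and on such sequences \<open>W\<^sup>* W\<close> is the identity.
\<close>

lemma W_range_condition: "range_condition L W"
proof -
  have "gram L W (W f) = W f" if f: "f \<in> carrier L" for f
  proof (rule L.vec_eqI)
    fix g assume g: "g \<in> carrier L"
    have fg: "f \<in> carrier K" "g \<in> carrier K" "f 0 = \<zero>\<^bsub>H\<^esub>" "g 0 = \<zero>\<^bsub>H\<^esub>" using f g by (auto simp: carrier_L)
    have "cinner L (gram L W (W f)) g = cinner K (S (S f)) (S g)"
      using f g W_closed[OF f] by (simp add: L.cinner_gram[OF W_bounded] W_apply del: orth_compl_simps(4))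
        (simp add: W_apply)
    also have "\<dots> = tail (S f) g"
      using fg by (simp add: cinner_S_S S_closed S_apply zero_simps cinner_zero_left op_simps KD)
    also have "\<dots> = cinner K (S f) g"
      using fg by (simp add: cinner_K S_closed S_apply zero_simps cinner_zero_left KD)
    finally show "cinner L (gram L W (W f)) g = cinner L (W f) g" using f by (simp add: W_apply)
  qed (use f W_closed bounded_opsD(1)[OF L.gram_bounded[OF W_bounded]] in auto)
  then show ?thesis unfolding range_condition_def by auto
qed

text \<open>Since \<open>S\<close> is bounded below and \<open>H\<close> is complete, the image of \<open>H\<close> is already closed.\<close>

lemma S_J_closed_range: "hclosure K (S ` J ` carrier H) = S ` J ` carrier H"
proof -
  define V where "V = compose (carrier H) S J"
  have V: "V \<in> bounded_ops H K"
    unfolding V_def by (intro bounded_ops_compose[OF _ _ _ S_bounded J_bounded]) unfold_locales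
  have below: "hnorm H x \<le> sqrt (a + b\<^sup>2 + 1) * hnorm K (V x)" if "x \<in> carrier H" for x
    using S_below[OF J_closed[OF that]] J_isometric that
    by (simp add: V_def compose_def hnorm_def isometric_embedding_def)
  have pos: "0 < sqrt (a + b\<^sup>2 + 1)" using a by (simp add: add_pos_nonneg)
  have range: "S ` J ` carrier H = V ` carrier H" by (auto simp: V_def compose_def)
  have sub: "V ` carrier H \<subseteq> carrier K" using bounded_opsD(1)[OF V] by auto
  show ?thesis
    unfolding range
  proof (intro subset_antisym subsetI)
    fix u assume "u \<in> hclosure K (V ` carrier H)"
    then obtain \<tau> where \<tau>: "\<forall>n. \<tau> n \<in> V ` carrier H" "conv_to K \<tau> u"
      using K.hclosure_iff_conv_to[OF sub] by blast
    then have "\<forall>n. \<exists>x. x \<in> carrier H \<and> \<tau> n = V x" by blast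
    then obtain \<sigma> where \<sigma>: "\<And>n. \<sigma> n \<in> carrier H" "\<And>n. \<tau> n = V (\<sigma> n)" by metis
    then have "\<tau> = (\<lambda>n. V (\<sigma> n))" by auto
    with \<tau>(2) have lim: "conv_to K (\<lambda>n. V (\<sigma> n)) u" by simp
    show "u \<in> V ` carrier H"
    proof (rule space_pair.bounded_below_limit[OF HK hilbert_space_axioms V pos below, where \<sigma>=\<sigma> and u=u])
      fix s assume "s \<in> carrier H" "V s = u"
      then show "u \<in> V ` carrier H" by blast
    qed (simp_all add: \<sigma>(1) lim)
  next
    fix u assume u: "u \<in> V ` carrier H"
    then have "conv_to K (\<lambda>_. u) u" using sub by (auto simp: conv_to_def K.minus_self K.hnorm_zero)
    then show "u \<in> hclosure K (V ` carrier H)"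
      unfolding K.hclosure_iff_conv_to[OF sub] using u by (intro exI[of _ "\<lambda>_. u"]) simp
  qed
qed

text \<open>
  Orthogonality is the invariance of the embedded space under \<open>S\<^sup>* S\<close>, and the sum splits each
  sequence into its first coordinate and the rest.
\<close>

lemma S_range_decomposition:
  "orthogonal_sum K (op_range K S) (op_range L W) (hclosure K (S ` J ` carrier H))"
  unfolding orthogonal_sum_def S_J_closed_range
proof (intro conjI ballI)
  show "op_range K S = op_range L W <+>\<^bsub>K\<^esub> S ` J ` carrier H"
  proof (intro subset_antisym subsetI)
    fix u assume "u \<in> op_range K S"
    then obtain f where f: "f \<in> carrier K" "u = S f" by blast
    define l where "l = f \<ominus>\<^bsub>K\<^esub> J (f 0)"
    have Jf: "J (f 0) \<in> carrier K" using f by (simp add: J_closed KD)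
    have l: "l \<in> carrier L"
      using f Jf by (simp add: carrier_L l_def) (simp add: minus_K J_apply KD minus_self)
    have lK: "l \<in> carrier K" using l by (simp add: carrier_L)
    have "f = l \<oplus>\<^bsub>K\<^esub> J (f 0)"
      using f Jf unfolding l_def by (intro K.vec_eqI) (auto simp: K.cinner_rules)
    then have "u = W l \<oplus>\<^bsub>K\<^esub> S (J (f 0))"
      using f(2) bounded_opsD(2)[OF S_bounded lK Jf] W_apply[OF l] by simp
    then show "u \<in> op_range L W <+>\<^bsub>K\<^esub> S ` J ` carrier H"
      unfolding set_add_def' using l KD[OF f(1)] by blast
  next
    fix u assume "u \<in> op_range L W <+>\<^bsub>K\<^esub> S ` J ` carrier H"
    then obtain l x where l: "l \<in> carrier L" and x: "x \<in> carrier H" and u: "u = W l \<oplus>\<^bsub>K\<^esub> S (J x)"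
      unfolding set_add_def' by blast
    have lK: "l \<in> carrier K" using l by (simp add: carrier_L)
    have "u = S (l \<oplus>\<^bsub>K\<^esub> J x)"
      using u bounded_opsD(2)[OF S_bounded lK J_closed[OF x]] W_apply[OF l] by simp
    then show "u \<in> op_range K S" using lK J_closed[OF x] by simp
  qed
next
  fix u v assume "u \<in> op_range L W" "v \<in> S ` J ` carrier H"
  then obtain l x where lx: "l \<in> carrier L" "u = W l" "x \<in> carrier H" "v = S (J x)" by blast
  then have "l \<in> carrier K" "l 0 = \<zero>\<^bsub>H\<^esub>" by (auto simp: carrier_L)
  then show "cinner K u v = 0"
    using lx by (simp add: W_apply cinner_S_S J_closed J_apply tail_J zero_simps cinner_zero_left
        cinner_zero_right op_simps KD)
qed

text \<open>
  For a quasi-isometry, \<open>S\<^sup>* S S f - S f\<close> is orthogonal to the range of \<open>S\<close>; under the range condition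
  it also lies in that range, hence vanishes.
\<close>

lemma range_condition_iff_fixed:
  "range_condition K S \<longleftrightarrow> (\<forall>f\<in>carrier K. gram K S (S f) = S f)"
proof
  assume rc: "range_condition K S"
  show "\<forall>f\<in>carrier K. gram K S (S f) = S f"
  proof
    fix f assume f: "f \<in> carrier K"
    note [simp] = S_closed bounded_opsD(1)[OF K.gram_bounded[OF S_bounded]]
    obtain u where u: "u \<in> carrier K" "gram K S (S f) = S u"
      using rc f unfolding range_condition_def by blast
    define w where "w = gram K S (S f) \<ominus>\<^bsub>K\<^esub> S f"
    have orth: "cinner K w (S g) = 0" if g: "g \<in> carrier K" for g
      using f g S_quasi_isometry K.quasi_isometry_iff[OF S_bounded]
      by (simp add: w_def K.cinner_minus_left K.cinner_gram[OF S_bounded])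
    have "w = S (u \<ominus>\<^bsub>K\<^esub> f)"
      using u f space_pair.bounded_ops_minus[OF KK S_bounded] by (simp add: w_def)
    then have "cinner K w w = 0" using orth[of "u \<ominus>\<^bsub>K\<^esub> f"] u f by simp
    then have "w = \<zero>\<^bsub>K\<^esub>" using K.cinner_eq_zero_iff f by (simp add: w_def)
    then show "gram K S (S f) = S f" using K.minus_eq_zeroD f by (simp add: w_def)
  qed
qed (auto simp: range_condition_def)

text \<open>
  The equation \<open>S\<^sup>* S S = S\<close> has first coordinate \<open>A T = T\<close>; conversely \<open>A T = T\<close> forces \<open>C = I\<close>, which
  settles the second coordinate \<open>C\<^sup>* C R = R\<close>.
\<close>

lemma S_range_condition_iff:
  "range_condition K S \<longleftrightarrow> (\<forall>x\<in>carrier H. A (T x) = T x)"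
proof
  assume "range_condition K S"
  then have fixed: "\<And>f. f \<in> carrier K \<Longrightarrow> gram K S (S f) = S f" by (simp add: range_condition_iff_fixed)
  show "\<forall>x\<in>carrier H. A (T x) = T x"
  proof
    fix x assume x: "x \<in> carrier H"
    show "A (T x) = T x"
    proof (rule vec_eqI)
      fix y assume y: "y \<in> carrier H"
      have "cinner K (gram K S (S (J x))) (J y) = cinner H (A (T x)) y"
        using x y by (simp add: K.cinner_gram[OF S_bounded] cinner_S_S S_closed J_closed S_apply J_apply
            tail_J zero_simps cinner_zero_right op_simps)
      moreover have "cinner K (S (J x)) (J y) = cinner H (T x) y"
        using x y by (simp add: cinner_J S_closed J_closed S_apply J_apply)
      ultimately show "cinner H (A (T x)) y = cinner H (T x) y" using fixed[OF J_closed[OF x]] by simp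
    qed (use x in \<open>auto simp: op_simps\<close>)
  qed
next
  assume AT: "\<forall>x\<in>carrier H. A (T x) = T x"
  then have "C = id_op H" by (intro C_id) auto
  then have C: "C x = x" if "x \<in> carrier H" for x using that by simp
  have "gram K S (S f) = S f" if f: "f \<in> carrier K" for f
  proof (rule K.vec_eqI)
    fix g assume g: "g \<in> carrier K"
    have "cinner K (gram K S (S f)) g = cinner K (S (S f)) (S g)"
      by (rule K.cinner_gram[OF S_bounded S_closed[OF f] g])
    also have "\<dots> = cinner H (A (S f 0)) (g 0) + cinner H (C (S f 1)) (C (g 1)) + tail (S f) g"
      by (rule cinner_S_S[OF S_closed[OF f] g])
    also have "\<dots> = cinner K (S f) g"
      using f g AT by (simp add: cinner_K S_closed S_apply C KD op_simps)
    finally show "cinner K (gram K S (S f)) g = cinner K (S f) g" .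
  qed (use f S_closed bounded_opsD(1)[OF K.gram_bounded[OF S_bounded]] in auto)
  then show "range_condition K S" by (simp add: range_condition_iff_fixed)
qed

lemma fixed_range_consequences:
  assumes AT: "\<And>x. x \<in> carrier H \<Longrightarrow> A (T x) = T x"
  shows "quasicontraction H T" and "isometry L W"
proof -
  show "quasicontraction H T"
    unfolding quasicontraction_iff[OF T]
  proof
    fix x assume x: "x \<in> carrier H"
    have "(hnorm H (R (T x)))\<^sup>2 = (hnorm H (T x))\<^sup>2 - (hnorm H (T (T x)))\<^sup>2"
      using x R_form[of "T x" "T x"] by (simp add: hnorm_sq op_simps AT)
    then have "(hnorm H (T (T x)))\<^sup>2 \<le> (hnorm H (T x))\<^sup>2" using zero_le_power2[of "hnorm H (R (T x))"] by linarith
    then show "hnorm H (T (T x)) \<le> hnorm H (T x)"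
      by (rule power2_le_imp_le) (use x in \<open>simp add: hnorm_ge_0 op_simps\<close>)
  qed
  have C: "C x = x" if "x \<in> carrier H" for x using that by (simp add: C_id[OF AT])
  show "isometry L W"
    unfolding L.isometry_iff[OF W_bounded]
  proof (intro ballI)
    fix f g assume fg: "f \<in> carrier L" "g \<in> carrier L"
    then have K: "f \<in> carrier K" "g \<in> carrier K" "f 0 = \<zero>\<^bsub>H\<^esub>" by (auto simp: carrier_L)
    have "cinner L (W f) (W g) = cinner K (S f) (S g)" using fg by (simp add: W_apply)
    also have "\<dots> = cinner H (A (f 0)) (g 0) + cinner H (C (f 1)) (C (g 1)) + tail f g"
      by (rule cinner_S_S[OF K(1,2)])
    also have "\<dots> = cinner L f g" using K by (simp add: cinner_K C KD zero_simps)
    finally show "cinner L (W f) (W g) = cinner L f g" .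
  qed
qed

end

section \<open>From the majorant to the lifting\<close>

text \<open>
  If \<open>A T = T\<close> then the two defects of the majorant \<open>A\<close> are equal, hence so are their roots, and \<open>C\<close> is the
  identity on the range and on the kernel of \<open>R\<close>.
\<close>

lemma model_lifting_of_majorant:
  fixes H :: "'a cspace"
  assumes H: "hilbert_space H" and T: "T \<in> bounded_ops H H" and maj: "has_range_majorant H T"
  obtains A R C a b where "model_lifting H T A R C a b"
proof -
  interpret hilbert_space H by fact
  obtain A where inv: "op_invertible H A" and le1: "op_le H (gram H T) A"
    and le2: "op_le H (op_comp H (adj H T) (op_comp H A T)) A"
    and ran: "op_range H (op_sqrt H (op_diff H A (gram H T))) =
       op_range H (op_sqrt H (op_diff H A (op_comp H (adj H T) (op_comp H A T))))"
    using maj unfolding has_range_majorant_def by blast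
  have A: "A \<in> bounded_ops H H" using inv by (simp add: op_invertible_def)
  note Gb = gram_bounded[OF T]
  define AT where "AT = op_comp H (adj H T) (op_comp H A T)"
  have ATb: "AT \<in> bounded_ops H H"
    unfolding AT_def by (intro op_comp_bounded adj_bounded T A)
  define R where "R = op_sqrt H (op_diff H A (gram H T))"
  define Q where "Q = op_sqrt H (op_diff H A AT)"
  have pos: "op_positive H (op_diff H A (gram H T))" "op_positive H (op_diff H A AT)"
    using le1 le2 by (simp_all add: op_le_def AT_def)
  have Rp: "op_positive H R" and Qp: "op_positive H Q"
    using op_sqrt_positive pos by (auto simp: R_def Q_def)
  interpret RQ: positive_pair H R Q by unfold_locales (rule Rp Qp)+
  note [simp] = bounded_opsD(1)[OF A] bounded_opsD(1)[OF T] bounded_opsD(1)[OF Gb] bounded_opsD(1)[OF ATb]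
  have R_form: "cinner H (R x) (R y) = cinner H (A x) y - cinner H (T x) (T y)"
    if "x \<in> carrier H" "y \<in> carrier H" for x y
    unfolding R_def cinner_op_sqrt[OF pos(1) that] using that
    by (simp add: op_diff_def cinner_minus_left cinner_gram[OF T])
  have AT_form: "cinner H (AT x) y = cinner H (A (T x)) (T y)" if "x \<in> carrier H" "y \<in> carrier H" for x y
    using that by (simp add: AT_def compose_def cinner_adj_left[OF T])
  have Q_form: "cinner H (Q x) (Q y) = cinner H (A x) y - cinner H (A (T x)) (T y)"
    if "x \<in> carrier H" "y \<in> carrier H" for x y
    unfolding Q_def cinner_op_sqrt[OF pos(2) that] using that
    by (simp add: op_diff_def cinner_minus_left AT_form)
  have "op_range H R = op_range H Q" using ran by (simp only: R_def Q_def AT_def)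
  from equal_range_intertwiner[OF Rp Qp this]
  obtain C b where C: "C \<in> bounded_ops H H" and b: "0 < b"
    and C': "\<forall>x\<in>carrier H. C (R x) = Q x" "\<forall>v\<in>carrier H. R v = \<zero>\<^bsub>H\<^esub> \<longrightarrow> C v = v"
      "\<forall>u\<in>carrier H. hnorm H u \<le> b * hnorm H (C u)"
    by (elim exE conjE)
  have A_pos: "op_positive H A"
    unfolding op_positive_def
  proof (intro conjI ballI A)
    fix x assume x: "x \<in> carrier H"
    have "cinner H (A x) x = complex_of_real ((hnorm H (R x))\<^sup>2 + (hnorm H (T x))\<^sup>2)"
      using R_form[OF x x] x RQ.RQ_simps(1)[OF x] by (simp add: cinner_self)
    then show "cinner H (A x) x \<in> \<real>\<^sub>\<ge>\<^sub>0" by (simp only: nonneg_Reals_of_real_iff) simp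
  qed
  obtain d where d: "d > 0" "\<And>x. x \<in> carrier H \<Longrightarrow> hnorm H (A x) \<le> d * hnorm H x"
    using space_pair.bound_pos[OF space_pair_self A] by metis
  obtain e where e: "e > 0" "\<And>x. x \<in> carrier H \<Longrightarrow> hnorm H x \<le> e * hnorm H (A x)"
    using op_invertible_bounded_below[OF inv] by metis
  have A_below: "(hnorm H x)\<^sup>2 \<le> (e\<^sup>2 * d) * Re (cinner H (A x) x)" if x: "x \<in> carrier H" for x
  proof -
    have "(hnorm H x)\<^sup>2 \<le> (e * hnorm H (A x))\<^sup>2" using e(2)[OF x] hnorm_ge_0[OF x] by (rule power_mono)
    also have "\<dots> = e\<^sup>2 * (hnorm H (A x))\<^sup>2" by (simp add: power_mult_distrib)
    also have "\<dots> \<le> e\<^sup>2 * (d * Re (cinner H (A x) x))"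
      using op_positive_hnorm_le[OF A_pos d x] by (intro mult_left_mono) auto
    finally show ?thesis by (simp add: mult.assoc)
  qed
  have C_id: "C = id_op H" if fixed: "\<And>x. x \<in> carrier H \<Longrightarrow> A (T x) = T x"
  proof (rule RQ.eq_on_range_and_kernel[OF C id_op_bounded])
    have "AT = gram H T"
      unfolding bounded_ops_eq_iff[OF ATb Gb] by (simp add: AT_form cinner_gram[OF T] fixed)
    then have "Q = R" by (simp add: Q_def R_def)
    then show "C (R x) = id_op H (R x)" if "x \<in> carrier H" for x using that C' RQ.RQ_simps(1) by simp
  qed (simp add: C')
  have "model_lifting H T A R C (e\<^sup>2 * d) b"
    by unfold_locales
      (use T A RQ.R_bounded C C' R_form A_below b C_id d(1) e(1) in \<open>simp_all add: Q_form\<close>)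
  then show ?thesis by (rule that)
qed

theorem theorem2p4:
  fixes H :: "'a cspace" and T :: "'a \<Rightarrow> 'a"
  assumes "hilbert_space H" and "T \<in> bounded_ops H H"
  shows
    "(\<forall>(K' :: 'k cspace) J' S'.
        left_inv_quasi_isometric_lifting H K' J' T S' \<and> gram_invariant H K' J' S'
        \<longrightarrow> has_range_majorant H T) \<and>
     (has_range_majorant H T \<longrightarrow>
       (\<exists>(K :: (nat \<Rightarrow> 'a) cspace) J S.
          left_inv_quasi_isometric_lifting H K J T S \<and>
          gram_invariant H K J S \<and>
          (let L = orth_compl H K J; W = compl_restr H K J S; A = gram_restr H K J S in
             orthogonal_sum K (op_range K S) (op_range L W) (hclosure K (S ` J ` carrier H)) \<and>
             range_condition L W \<and>
             (range_condition K S \<longleftrightarrow>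
                op_range H T \<subseteq> a_kernel H H (op_diff H A (id_op H))) \<and>
             (range_condition K S \<longrightarrow> quasicontraction H T \<and> isometry L W))))"
proof (intro conjI impI allI)
  fix K' :: "'k cspace" and J' S'
  assume "left_inv_quasi_isometric_lifting H K' J' T S' \<and> gram_invariant H K' J' S'"
  then show "has_range_majorant H T" using range_majorant_of_lifting[OF assms] by blast
next
  assume "has_range_majorant H T"
  then obtain A R C a b where "model_lifting H T A R C a b"
    using model_lifting_of_majorant[OF assms] by blast
  then interpret M: model_lifting H T A R C a b .
  have kernel: "op_range H T \<subseteq> a_kernel H H (op_diff H A (id_op H)) \<longleftrightarrow> (\<forall>x\<in>carrier H. A (T x) = T x)"
  proof -
    have "A y \<ominus>\<^bsub>H\<^esub> y = \<zero>\<^bsub>H\<^esub> \<longleftrightarrow> A y = y" if "y \<in> carrier H" for y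
      using that M.minus_eq_zeroD[of "A y" y] M.minus_self[of y] M.op_simps(4)[of y] by auto
    then show ?thesis using M.op_simps(1)
      by (auto simp: a_kernel_def' op_diff_def image_subset_iff)
  qed
  show "\<exists>(K :: (nat \<Rightarrow> 'a) cspace) J S.
          left_inv_quasi_isometric_lifting H K J T S \<and>
          gram_invariant H K J S \<and>
          (let L = orth_compl H K J; W = compl_restr H K J S; A = gram_restr H K J S in
             orthogonal_sum K (op_range K S) (op_range L W) (hclosure K (S ` J ` carrier H)) \<and>
             range_condition L W \<and>
             (range_condition K S \<longleftrightarrow>
                op_range H T \<subseteq> a_kernel H H (op_diff H A (id_op H))) \<and>
             (range_condition K S \<longrightarrow> quasicontraction H T \<and> isometry L W))"
    unfolding Let_def
  proof (intro exI conjI)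
    show "left_inv_quasi_isometric_lifting H M.K M.J T M.S" by (rule M.S_lifting)
    show "gram_invariant H M.K M.J M.S" by (rule M.S_gram_invariant)
    show "orthogonal_sum M.K (op_range M.K M.S) (op_range M.L M.W) (hclosure M.K (M.S ` M.J ` carrier H))"
      by (rule M.S_range_decomposition)
    show "range_condition M.L M.W" by (rule M.W_range_condition)
    show "range_condition M.K M.S \<longleftrightarrow> op_range H T \<subseteq> a_kernel H H (op_diff H (gram_restr H M.K M.J M.S) (id_op H))"
      unfolding M.gram_restr_S kernel by (rule M.S_range_condition_iff)
    show "range_condition M.K M.S \<longrightarrow> quasicontraction H T \<and> isometry M.L M.W"
      using M.S_range_condition_iff M.fixed_range_consequences by blast
  qed
qed

end
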